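(* Let $f:\mathbb{C}\to\widehat{\mathbb{C}}$ be a transcendental meromorphic function whose Schwarzian derivative $S_f$ is a polynomial (i.e. $f$ is a Nevanlinna function), and let $m$ denote the degree of the polynomial $S_f$. Suppose that $\infty$ is not an asymptotic value of $f$. Then the limit $\lim_{R\to\infty}\dim \mathcal{J}_R(f)$ exists and $$\dim \mathcal{I}(f)=\lim_{R\to\infty}\dim \mathcal{J}_R(f)=\frac{m+2}{m+4}.$$
   Context: $\widehat{\mathbb{C}}=\mathbb{C}\cup\{\infty\}$ is the Riemann sphere. A meromorphic function on $\mathbb{C}$ is transcendental if it is not a rational function. The Schwarzian derivative of $f$ is $$S_f=\left(\frac{f''}{f'}\right)'-\frac12\left(\frac{f''}{f'}\right)^2 .$$ A Nevanlinna function is a meromorphic function whose Schwarzian derivative is a polynomial. A point $a\in\widehat{\mathbb{C}}$ is an asymptotic value of $f$ if there is a curve $\gamma:[0,\infty)\to\mathbb{C}$ with $\gamma(t)\to\infty$ and $f(\gamma(t))\to a$ as $t\to\infty$. $f^n$ denotes the $n$-th iterate of $f$ (with $f^0=\mathrm{id}$); $f^n(z)$ is defined for all $n$ exactly when no iterate $f^k(z)$ is a pole of $f$. The escaping set is $$\mathcal{I}(f)=\{z\in\mathbb{C}: f^n(z) \text{ is defined for all } n \text{ and } f^n(z)\to\infty \text{ as } n\to\infty\},$$ and for $R>0$, $$\mathcal{J}_R(f)=\{z\in\mathbb{C}: f^n(z)\text{ is defined and } |f^n(z)|>R \text{ for all } n\in\mathbb{N}=\{0,1,2,\dots\}\}.$$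 $\dim A$ denotes the Hausdorff dimension of $A\subset\mathbb{C}$. *)

theory Defs
  imports "HOL-Complex_Analysis.Complex_Analysis"
begin

(* A meromorphic function from the plane to the Riemann sphere is represented by a function
   f :: complex => complex with f nicely_meromorphic_on UNIV: every singularity other than a pole
   has been removed, and f takes the dummy value 0 at its poles. The poles are therefore always
   identified by is_pole f, never by the value of f. *)

definition transcendental_meromorphic :: "(complex \<Rightarrow> complex) \<Rightarrow> bool" where
  "transcendental_meromorphic f \<longleftrightarrow>
     f nicely_meromorphic_on UNIV \<and>
     \<not> (\<exists>p q. q \<noteq> 0 \<and> (\<forall>z. poly q z \<noteq> 0 \<longrightarrow> f z = poly p z / poly q z))"

(* The pointwise formula gives the value of the meromorphic function S_f only off a discrete set
   (the poles of f and the zeros of f'), so identities for it should be stated cosparsely. *)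

definition schwarzian :: "(complex \<Rightarrow> complex) \<Rightarrow> complex \<Rightarrow> complex" where
  "schwarzian f z =
     deriv (\<lambda>w. deriv (deriv f) w / deriv f w) z - (deriv (deriv f) z / deriv f z)\<^sup>2 / 2"

(* The Riemann sphere is Alexandroff_compactification euclidean on complex option,
   with None as the point at infinity. *)

definition to_sphere :: "(complex \<Rightarrow> complex) \<Rightarrow> complex \<Rightarrow> complex option" where
  "to_sphere f z = (if is_pole f z then None else Some (f z))"

definition asymptotic_value :: "(complex \<Rightarrow> complex) \<Rightarrow> complex option \<Rightarrow> bool" where
  "asymptotic_value f a \<longleftrightarrow>
     (\<exists>\<gamma> :: real \<Rightarrow> complex. continuous_on {0..} \<gamma> \<and> filterlim \<gamma> at_infinity at_top \<and>
        limitin (Alexandroff_compactification euclidean) (\<lambda>t. to_sphere f (\<gamma> t)) a at_top)"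

definition iterates_defined :: "(complex \<Rightarrow> complex) \<Rightarrow> complex \<Rightarrow> bool" where
  "iterates_defined f z \<longleftrightarrow> (\<forall>k. \<not> is_pole f ((f ^^ k) z))"

definition escaping_set :: "(complex \<Rightarrow> complex) \<Rightarrow> complex set" where
  "escaping_set f =
     {z. iterates_defined f z \<and> filterlim (\<lambda>n. (f ^^ n) z) at_infinity sequentially}"

definition stay_outside_set :: "real \<Rightarrow> (complex \<Rightarrow> complex) \<Rightarrow> complex set" where
  "stay_outside_set R f = {z. iterates_defined f z \<and> (\<forall>n. norm ((f ^^ n) z) > R)}"

(* Covering sets must be bounded, since diameter is a junk value on unbounded sets. *)

definition hausdorff_premeasure :: "real \<Rightarrow> real \<Rightarrow> 'a::metric_space set \<Rightarrow> ennreal" where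
  "hausdorff_premeasure s \<delta> A =
     (INF U \<in> {U :: nat \<Rightarrow> 'a set.
               A \<subseteq> (\<Union>i. U i) \<and> (\<forall>i. bounded (U i) \<and> diameter (U i) \<le> \<delta>)}.
        \<Sum>i. ennreal (diameter (U i) powr s))"

definition hausdorff_measure :: "real \<Rightarrow> 'a::metric_space set \<Rightarrow> ennreal" where
  "hausdorff_measure s A = (SUP \<delta>\<in>{0<..}. hausdorff_premeasure s \<delta> A)"

(* Only s > 0 is used, which leaves the infimum unchanged and avoids the question of 0 powr 0. *)

definition hausdorff_dim :: "'a::metric_space set \<Rightarrow> ennreal" where
  "hausdorff_dim A = Inf {ennreal s | s. s > 0 \<and> hausdorff_measure s A = 0}"

end

(* The Schwarzian of f is a polynomial S, so f is a quotient w1/w2 of two entire solutions of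
   w'' + (S/2) w = 0. With P = S/2 and the Liouville variable zeta = int sqrt P, the function
   P^(1/4) w satisfies y'' = -(1 + O(1/zeta^2)) y, hence y = A e^(i zeta) + B e^(-i zeta) up to a
   factor 1 + O(1/zeta). Since infinity is not an asymptotic value, both coefficients of the denominator are
   non-zero on every critical ray. So the poles a_k on a critical ray are asymptotic to an arithmetic
   progression in zeta, f is bounded away from them, and near them it looks like a
   Moebius image of cot zeta. With alpha = 2/(m+2) this gives |a_k| ~ k^alpha and residues of size
   k^(alpha-1). A branch of the inverse of f taking a neighbourhood of a_l into one of a_k therefore
   contracts by k^(alpha-1) l^(-2 alpha), and the critical exponent of the resulting infinite
   iterated function system is the s with s (1 + alpha) = 1.
   For larger s the Hausdorff content of J_R is at most half of itself when R is large; for smaller s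
   a Cantor set of escaping points is parametrised by mixed radix expansions of the points of [0,1),
   with a parametrisation whose inverse is Hoelder continuous with exponent s. *)

theory Submission
  imports Defs "HOL-Real_Asymp.Real_Asymp"
begin

section \<open>Hausdorff content\<close>

text \<open>The value of the exponent comes from a cancellation. The contraction k^(\<alpha>-1)
  l^(-2\<alpha>) involves both ends of a transition, but along an orbit the target of one step is
  the source of the next, so each intermediate index l contributes l^(-(1+\<alpha>)). In the system
  of inequalities for contents the same cancellation appears through the weight k^(s(\<alpha>-1)),
  which leaves the series of l^(-s(1+\<alpha>)); and 1/(1+\<alpha>) = (m+2)/(m+4).

  Two obstacles shape the analytic half. The Liouville variable makes about (m+2)/2 turns around
  infinity, so its inverse is built in logarithmic coordinates and then cut into finitely many
  charts. And the error of the asymptotics has to be relative to the two exponentials with their own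
  weights, uniformly in vertical directions. Only in this form does a missing exponential in the
  denominator drive f to infinity along a vertical ray, and only in this form can every point where
  f is large be confined to small discs about the lattice of zeros.\<close>

text \<open>Covers of arbitrary size are allowed, so there is no limit over a mesh size to deal with; the
  content vanishes exactly on the null sets of the Hausdorff measure.\<close>

definition hausdorff_content :: "real \<Rightarrow> 'a::metric_space set \<Rightarrow> ennreal" where
  "hausdorff_content s A =
     (INF U \<in> {U :: nat \<Rightarrow> 'a set. A \<subseteq> (\<Union>i. U i) \<and> (\<forall>i. bounded (U i))}.
        \<Sum>i. ennreal (diameter (U i) powr s))"

lemma ennreal_le_suminf: "f i \<le> (\<Sum>i. f i)" for f :: "nat \<Rightarrow> ennreal"
  using sum_le_suminf[of f "{i}"] by simp

lemma hausdorff_content_le: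
  fixes U :: "nat \<Rightarrow> 'a::metric_space set"
  assumes "A \<subseteq> (\<Union>i. U i)" "\<And>i. bounded (U i)"
  shows "hausdorff_content s A \<le> (\<Sum>i. ennreal (diameter (U i) powr s))"
  unfolding hausdorff_content_def by (rule INF_lower) (use assms in auto)

lemma hausdorff_content_greatest:
  fixes A :: "'a::metric_space set"
  assumes "\<And>U :: nat \<Rightarrow> 'a set. A \<subseteq> (\<Union>i. U i) \<Longrightarrow> (\<And>i. bounded (U i)) \<Longrightarrow>
             x \<le> (\<Sum>i. ennreal (diameter (U i) powr s))"
  shows "x \<le> hausdorff_content s A"
  unfolding hausdorff_content_def by (rule INF_greatest) (use assms in auto)

lemma hausdorff_content_cover:
  fixes A :: "'a::metric_space set"
  assumes "hausdorff_content s A < x"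
  obtains U :: "nat \<Rightarrow> 'a set" where "A \<subseteq> (\<Union>i. U i)" "\<And>i. bounded (U i)"
    "(\<Sum>i. ennreal (diameter (U i) powr s)) < x"
  using assms unfolding hausdorff_content_def INF_less_iff by auto

lemma hausdorff_content_mono: "A \<subseteq> B \<Longrightarrow> hausdorff_content s A \<le> hausdorff_content s B"
  unfolding hausdorff_content_def by (rule INF_superset_mono) auto

text \<open>One summand never exceeds the whole sum, so a cover whose sum is below
  \<open>\<delta> powr s\<close> automatically has mesh at most \<open>\<delta>\<close>: cheap
  covers are fine covers.\<close>

lemma hausdorff_measure_eq_0_iff:
  fixes A :: "'a::metric_space set"
  assumes s: "s > 0"
  shows "hausdorff_measure s A = 0 \<longleftrightarrow> hausdorff_content s A = 0"
proof
  assume "hausdorff_measure s A = 0"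
  then have "hausdorff_premeasure s 1 A \<le> 0"
    unfolding hausdorff_measure_def by (metis SUP_upper greaterThan_iff zero_less_one)
  moreover have "hausdorff_content s A \<le> hausdorff_premeasure s 1 A"
    unfolding hausdorff_content_def hausdorff_premeasure_def by (rule INF_superset_mono) auto
  ultimately show "hausdorff_content s A = 0" by auto
next
  assume A: "hausdorff_content s A = 0"
  have "hausdorff_premeasure s \<delta> A \<le> ennreal e" if "\<delta> > 0" "e > 0" for \<delta> e
  proof -
    have "hausdorff_content s A < ennreal (min e (\<delta> powr s))"
      using A that by (auto simp: min_def)
    then obtain U :: "nat \<Rightarrow> 'a set" where U: "A \<subseteq> (\<Union>i. U i)" "\<And>i. bounded (U i)"
      "(\<Sum>i. ennreal (diameter (U i) powr s)) < ennreal (min e (\<delta> powr s))"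
      by (rule hausdorff_content_cover) blast
    have "diameter (U i) \<le> \<delta>" for i
    proof -
      have "ennreal (diameter (U i) powr s) \<le> (\<Sum>i. ennreal (diameter (U i) powr s))"
        by (rule ennreal_le_suminf)
      also have "\<dots> < ennreal (min e (\<delta> powr s))" by (rule U)
      also have "\<dots> \<le> ennreal (\<delta> powr s)" by (rule ennreal_leI) simp
      finally have "diameter (U i) powr s < \<delta> powr s"
        by (simp add: ennreal_less_iff)
      then show ?thesis using s that powr_mono2[of s \<delta> "diameter (U i)"] by linarith
    qed
    then have "hausdorff_premeasure s \<delta> A \<le> (\<Sum>i. ennreal (diameter (U i) powr s))"
      unfolding hausdorff_premeasure_def by (intro INF_lower) (use U in auto)
    also have "\<dots> \<le> ennreal e" using U(3) order_less_imp_le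
      by (metis ennreal_leI min.cobounded1 order.trans)
    finally show ?thesis .
  qed
  then have "hausdorff_premeasure s \<delta> A = 0" if "\<delta> > 0" for \<delta>
    using that by (metis ennreal_le_epsilon add_0 le_zero_eq)
  then show "hausdorff_measure s A = 0" unfolding hausdorff_measure_def by simp
qed

lemma hausdorff_content_UN_le:
  fixes A :: "nat \<Rightarrow> 'a::metric_space set"
  shows "hausdorff_content s (\<Union>n. A n) \<le> (\<Sum>n. hausdorff_content s (A n))"
proof (rule ennreal_le_epsilon)
  fix e :: real assume "e > 0" and fin: "(\<Sum>n. hausdorff_content s (A n)) < top"
  have lt: "hausdorff_content s (A n) < top" for n
    using fin sum_le_suminf[of "\<lambda>n. hausdorff_content s (A n)" "{n}"]
    by (simp add: order_le_less_trans)
  have "hausdorff_content s (A n) < hausdorff_content s (A n) + ennreal (e * (1/2)^Suc n)" for n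
    using lt[of n] \<open>e > 0\<close> by (metis ennreal_add_left_cancel_less add.right_neutral
        ennreal_less_zero_iff mult_pos_pos zero_less_divide_1_iff zero_less_numeral zero_less_power infinity_ennreal_def order_less_irrefl)
  then have "\<forall>n. \<exists>U :: nat \<Rightarrow> 'a set. A n \<subseteq> (\<Union>i. U i) \<and> (\<forall>i. bounded (U i)) \<and>
      (\<Sum>i. ennreal (diameter (U i) powr s)) < hausdorff_content s (A n) + ennreal (e * (1/2)^Suc n)"
    by (metis hausdorff_content_cover)
  then obtain U :: "nat \<Rightarrow> nat \<Rightarrow> 'a set" where U: "\<And>n. A n \<subseteq> (\<Union>i. U n i)" "\<And>n i. bounded (U n i)"
      "\<And>n. (\<Sum>i. ennreal (diameter (U n i) powr s)) < hausdorff_content s (A n) + ennreal (e * (1/2)^Suc n)"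
    by metis
  define g where "g = (\<lambda>(n,i). ennreal (diameter (U n i) powr s))"
  have cover: "(\<Union>n. A n) \<subseteq> (\<Union>k. case prod_decode k of (n,i) \<Rightarrow> U n i)"
  proof
    fix x assume "x \<in> (\<Union>n. A n)"
    then obtain n i where "x \<in> U n i" using U(1) by blast
    then show "x \<in> (\<Union>k. case prod_decode k of (n,i) \<Rightarrow> U n i)"
      by (intro UN_I[of "prod_encode (n,i)"]) auto
  qed
  have "hausdorff_content s (\<Union>n. A n) \<le>
     (\<Sum>k. ennreal (diameter (case prod_decode k of (n,i) \<Rightarrow> U n i) powr s))"
    by (rule hausdorff_content_le[OF cover]) (use U in \<open>auto split: prod.split\<close>)
  also have "\<dots> = (\<Sum>k. g (prod_decode k))"
    by (intro suminf_cong) (auto simp: g_def split: prod.split)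
  also have "\<dots> = (\<Sum>n. \<Sum>i. g (n,i))"
    by (rule suminf_ennreal_2dimen) simp
  also have "\<dots> \<le> (\<Sum>n. hausdorff_content s (A n) + ennreal (e * (1/2)^Suc n))"
    using less_imp_le[OF U(3)] by (intro suminf_le) (simp_all add: g_def del: power_Suc)
  also have "\<dots> = (\<Sum>n. hausdorff_content s (A n)) + (\<Sum>n. ennreal (e * (1/2)^Suc n))"
    by (rule suminf_add[symmetric]) auto
  also have "(\<Sum>n. ennreal (e * (1/2)^Suc n)) = ennreal e"
    using sums_mult[OF power_half_series, of e] \<open>e > 0\<close>
    by (intro suminf_ennreal_eq) auto
  finally show "hausdorff_content s (\<Union>n. A n) \<le> (\<Sum>n. hausdorff_content s (A n)) + ennreal e" .
qed

lemma hausdorff_content_countable_UN_eq_0: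
  fixes A :: "'b \<Rightarrow> 'a::metric_space set"
  assumes "countable I" "\<And>i. i \<in> I \<Longrightarrow> hausdorff_content s (A i) = 0"
  shows "hausdorff_content s (\<Union>i\<in>I. A i) = 0"
proof (cases "I = {}")
  case True
  then have "hausdorff_content s (\<Union>i\<in>I. A i) \<le> (\<Sum>i::nat. ennreal (diameter ({}::'a set) powr s))"
    by (intro hausdorff_content_le) auto
  then show ?thesis by simp
next
  case False
  then have "(\<Union>i\<in>I. A i) = (\<Union>n. A (from_nat_into I n))"
    using assms(1) by (metis range_from_nat_into image_image)
  moreover have "\<dots> = (\<Union>n. A (from_nat_into I n))" ..
  ultimately have "hausdorff_content s (\<Union>i\<in>I. A i) \<le> (\<Sum>n. hausdorff_content s (A (from_nat_into I n)))"
    by (metis hausdorff_content_UN_le)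
  also have "\<dots> = 0" using False assms(2) by (simp add: from_nat_into)
  finally show ?thesis by simp
qed

lemma hausdorff_content_le_diameter:
  assumes "bounded A"
  shows "hausdorff_content s A \<le> ennreal (diameter A powr s)"
proof -
  have "hausdorff_content s A \<le> (\<Sum>i. ennreal (diameter (if i = (0::nat) then A else {}) powr s))"
    by (rule hausdorff_content_le) (use assms in auto)
  also have "\<dots> = (\<Sum>i\<in>{0}. ennreal (diameter (if i = (0::nat) then A else {}) powr s))"
    by (rule suminf_finite) auto
  finally show ?thesis by simp
qed

lemma diameter_vimage_le:
  fixes g :: "'a::metric_space \<Rightarrow> 'b::metric_space"
  assumes "L \<ge> 0" and L: "\<And>x y. x \<in> V \<Longrightarrow> y \<in> V \<Longrightarrow> dist x y \<le> L * dist (g x) (g y)"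
    and U: "g ` V \<subseteq> U" "bounded U"
  shows "bounded V" "diameter V \<le> L * diameter U"
proof -
  have *: "dist x y \<le> L * diameter U" if "x \<in> V" "y \<in> V" for x y
  proof -
    have "dist x y \<le> L * dist (g x) (g y)" by (rule L) fact+
    also have "\<dots> \<le> L * diameter U"
      by (intro mult_left_mono diameter_bounded_bound) (use that U \<open>L \<ge> 0\<close> in auto)
    finally show ?thesis .
  qed
  show "bounded V" unfolding bounded_def using * by (metis)
  show "diameter V \<le> L * diameter U"
  proof (cases "V = {}")
    case True then show ?thesis using \<open>L \<ge> 0\<close> diameter_ge_0[OF U(2)] by simp
  next
    case False
    then show ?thesis unfolding diameter_def[of V] by (auto intro!: cSUP_least *)
  qed
qed

text \<open>Each set of a cover of the image is pulled back to \<open>A\<close>, where the inverse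
  Lipschitz bound controls its diameter. With \<open>g\<close> the function f on a piece where it
  expands, this carries content from one pole neighbourhood to another.\<close>

lemma hausdorff_content_expanding:
  fixes g :: "'a::metric_space \<Rightarrow> 'b::metric_space"
  assumes "s > 0" "L \<ge> 0" and L: "\<And>x y. x \<in> A \<Longrightarrow> y \<in> A \<Longrightarrow> dist x y \<le> L * dist (g x) (g y)"
  shows "hausdorff_content s A \<le> ennreal (L powr s) * hausdorff_content s (g ` A)"
proof (cases "L = 0")
  case True
  have "bounded A" "diameter A \<le> 0"
    using diameter_vimage_le[of 0 A "\<lambda>_. undefined" "{undefined :: 'a}"] L True by auto
  then have "diameter A = 0" using diameter_ge_0 by (metis antisym)
  then show ?thesis using hausdorff_content_le_diameter[OF \<open>bounded A\<close>, of s] by simp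
next
  case False
  then have "L > 0" using assms by simp
  then have Ls: "ennreal (L powr s) \<noteq> 0" "ennreal (L powr s) \<noteq> top" by auto
  have "hausdorff_content s A / ennreal (L powr s) \<le> hausdorff_content s (g ` A)"
  proof (rule hausdorff_content_greatest)
    fix U :: "nat \<Rightarrow> 'b set"
    assume U: "g ` A \<subseteq> (\<Union>i. U i)" "\<And>i. bounded (U i)"
    define V where "V i = A \<inter> g -` U i" for i
    have V: "bounded (V i)" "diameter (V i) \<le> L * diameter (U i)" for i
      by (rule diameter_vimage_le[of L "V i" g "U i"]; use U \<open>L > 0\<close> L in \<open>auto simp: V_def\<close>)+
    have "hausdorff_content s A \<le> (\<Sum>i. ennreal (diameter (V i) powr s))"
      by (rule hausdorff_content_le) (use U V in \<open>fastforce simp: V_def\<close>)+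
    also have "\<dots> \<le> (\<Sum>i. ennreal (L powr s) * ennreal (diameter (U i) powr s))"
    proof (rule suminf_le)
      fix i
      have "diameter (V i) powr s \<le> (L * diameter (U i)) powr s"
        by (rule powr_mono2) (use V diameter_ge_0 \<open>s > 0\<close> in auto)
      also have "\<dots> = L powr s * diameter (U i) powr s"
        using \<open>L > 0\<close> U diameter_ge_0 by (simp add: powr_mult)
      finally show "ennreal (diameter (V i) powr s) \<le> ennreal (L powr s) * ennreal (diameter (U i) powr s)"
        by (metis ennreal_leI ennreal_mult' powr_ge_zero)
    qed auto
    also have "\<dots> = ennreal (L powr s) * (\<Sum>i. ennreal (diameter (U i) powr s))"
      by simp
    finally show "hausdorff_content s A / ennreal (L powr s) \<le> (\<Sum>i. ennreal (diameter (U i) powr s))"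
      using Ls by (metis ennreal_divide_times ennreal_mult_divide_eq divide_right_mono_ennreal mult.commute)
  qed
  then have "ennreal (L powr s) * (hausdorff_content s A / ennreal (L powr s)) \<le> ennreal (L powr s) * hausdorff_content s (g ` A)"
    by (rule mult_left_mono) simp
  moreover have "ennreal (L powr s) * (hausdorff_content s A / ennreal (L powr s)) = hausdorff_content s A"
    using Ls by (simp add: ennreal_times_divide mult_divide_eq_ennreal mult.commute)
  ultimately show ?thesis by simp
qed

text \<open>This is the mass distribution principle, the mass being Lebesgue measure on the
  parameter interval. A set \<open>U\<close> captures only parameters from an interval of length
  \<open>C * diameter U powr s\<close>, so every cover costs at least 1/C. The captured parameters
  are enclosed in closed intervals, because the parametrisation used later comes from a bare choice
  and need not be measurable.\<close>

lemma hausdorff_content_Hoelder_pos: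
  fixes e :: "real \<Rightarrow> 'a::metric_space"
  assumes "s > 0" "C > 0" and eA: "\<And>x. x \<in> {0..<1} \<Longrightarrow> e x \<in> A"
    and H: "\<And>x y. x \<in> {0..<1} \<Longrightarrow> y \<in> {0..<1} \<Longrightarrow> \<bar>x - y\<bar> \<le> C * dist (e x) (e y) powr s"
  shows "hausdorff_content s A > 0"
proof -
  have "ennreal (1 / C) \<le> hausdorff_content s A"
  proof (rule hausdorff_content_greatest)
    fix U :: "nat \<Rightarrow> 'a set"
    assume U: "A \<subseteq> (\<Union>i. U i)" "\<And>i. bounded (U i)"
    define T where "T i = {x \<in> {0..<1}. e x \<in> U i}" for i
    define d where "d i = C * diameter (U i) powr s" for i
    have d0: "d i \<ge> 0" for i unfolding d_def using \<open>C > 0\<close> by simp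
    have "\<exists>t. T i \<subseteq> {t..t + d i}" for i
    proof (cases "T i = {}")
      case False
      have bdd: "bdd_below (T i)" unfolding T_def bdd_below_def by auto
      have "x \<le> Inf (T i) + d i" if x: "x \<in> T i" for x
      proof -
        have "x - d i \<le> Inf (T i)"
        proof (rule cInf_greatest[OF False])
          fix y assume y: "y \<in> T i"
          have "x - y \<le> C * dist (e x) (e y) powr s" using H[of x y] x y by (auto simp: T_def)
          also have "\<dots> \<le> C * diameter (U i) powr s"
            by (intro mult_left_mono powr_mono2 diameter_bounded_bound) (use x y U \<open>s > 0\<close> \<open>C > 0\<close> in \<open>auto simp: T_def\<close>)
          finally show "x - d i \<le> y" by (simp add: d_def)
        qed
        then show ?thesis by simp
      qed
      moreover have "Inf (T i) \<le> x" if "x \<in> T i" for x using that bdd by (rule cInf_lower)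
      ultimately show ?thesis by (intro exI[of _ "Inf (T i)"]) auto
    qed auto
    then obtain t where t: "\<And>i. T i \<subseteq> {t i..t i + d i}" by metis
    have "{0..<1} \<subseteq> (\<Union>i. {t i..t i + d i})"
    proof
      fix x :: real assume "x \<in> {0..<1}"
      then obtain i where "x \<in> T i" using eA U(1) unfolding T_def by blast
      then show "x \<in> (\<Union>i. {t i..t i + d i})" using t by blast
    qed
    then have "emeasure lborel {0..<1::real} \<le> emeasure lborel (\<Union>i. {t i..t i + d i})"
      by (rule emeasure_mono) auto
    also have "\<dots> \<le> (\<Sum>i. emeasure lborel {t i..t i + d i})"
      by (rule emeasure_subadditive_countably) auto
    also have "\<dots> = (\<Sum>i. ennreal C * ennreal (diameter (U i) powr s))"
      using d0 \<open>C > 0\<close> by (intro suminf_cong) (simp add: d_def ennreal_mult)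
    also have "\<dots> = ennreal C * (\<Sum>i. ennreal (diameter (U i) powr s))" by simp
    finally have "1 \<le> ennreal C * (\<Sum>i. ennreal (diameter (U i) powr s))" by simp
    then have "ennreal (1/C) * 1 \<le> ennreal (1/C) * (ennreal C * (\<Sum>i. ennreal (diameter (U i) powr s)))"
      by (rule mult_left_mono) simp
    also have "\<dots> = (\<Sum>i. ennreal (diameter (U i) powr s))"
      using \<open>C > 0\<close> by (simp add: mult.assoc[symmetric] ennreal_mult[symmetric])
    finally show "ennreal (1 / C) \<le> (\<Sum>i. ennreal (diameter (U i) powr s))" by simp
  qed
  moreover have "ennreal (1/C) > 0" using \<open>C > 0\<close> by simp
  ultimately show ?thesis by (metis order_less_le_trans)
qed

text \<open>A cover with sum below 1 has all diameters below 1, and then raising the exponent lowers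
  every summand.\<close>

lemma hausdorff_content_eq_0_mono:
  assumes "0 < t" "t \<le> s" "hausdorff_content t A = 0"
  shows "hausdorff_content s A = 0"
proof -
  have "hausdorff_content s A \<le> ennreal e" if "e > 0" for e
  proof -
    have "hausdorff_content t A < ennreal (min e 1)" using assms that by (auto simp: min_def)
    then obtain U where U: "A \<subseteq> (\<Union>i. U i)" "\<And>i::nat. bounded (U i)"
      "(\<Sum>i. ennreal (diameter (U i) powr t)) < ennreal (min e 1)"
      by (rule hausdorff_content_cover) blast
    have "hausdorff_content s A \<le> (\<Sum>i. ennreal (diameter (U i) powr s))"
      by (rule hausdorff_content_le) (use U in auto)
    also have "\<dots> \<le> (\<Sum>i. ennreal (diameter (U i) powr t))"
    proof (rule suminf_le)
      fix i
      have "ennreal (diameter (U i) powr t) \<le> (\<Sum>i. ennreal (diameter (U i) powr t))"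
        by (rule ennreal_le_suminf)
      also have "\<dots> < ennreal (min e 1)" by (rule U)
      also have "\<dots> \<le> ennreal 1" by (rule ennreal_leI) simp
      finally have "diameter (U i) powr t < 1" by (metis ennreal_less_iff powr_ge_zero)
      then have "diameter (U i) \<le> 1"
        using ge_one_powr_ge_zero[of "diameter (U i)" t] \<open>t > 0\<close> by linarith
      then show "ennreal (diameter (U i) powr s) \<le> ennreal (diameter (U i) powr t)"
        using \<open>t \<le> s\<close> diameter_ge_0[OF U(2)] by (intro ennreal_leI powr_mono') auto
    qed auto
    also have "\<dots> \<le> ennreal e" using U(3)
      by (metis ennreal_leI min.cobounded1 order.trans order_less_imp_le)
    finally show ?thesis .
  qed
  then show ?thesis by (metis ennreal_le_epsilon add_0 le_zero_eq)
qed

lemma hausdorff_dim_le: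
  assumes "s > 0" "hausdorff_content s A = 0"
  shows "hausdorff_dim A \<le> ennreal s"
  unfolding hausdorff_dim_def using assms hausdorff_measure_eq_0_iff by (intro Inf_lower) auto

lemma hausdorff_dim_ge:
  assumes "hausdorff_content s A > 0"
  shows "hausdorff_dim A \<ge> ennreal s"
  unfolding hausdorff_dim_def
proof (rule Inf_greatest, clarify)
  fix t :: real assume "t > 0" "hausdorff_measure t A = 0"
  then have "\<not> t \<le> s"
    using hausdorff_content_eq_0_mono[of t s A] hausdorff_measure_eq_0_iff[of t A] assms by auto
  then show "ennreal s \<le> ennreal t" by (intro ennreal_leI) simp
qed

text \<open>Made for sets that are not included in each other: the escaping set need not lie in J_R,
  but it is null in every positive dimension in which J_R is null.\<close>

lemma hausdorff_dim_mono_null: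
  assumes "\<And>t. t > 0 \<Longrightarrow> hausdorff_content t B = 0 \<Longrightarrow> hausdorff_content t A = 0"
  shows "hausdorff_dim A \<le> hausdorff_dim B"
proof -
  have "hausdorff_measure t A = 0" if "t > 0" "hausdorff_measure t B = 0" for t
    using that assms[of t] by (simp add: hausdorff_measure_eq_0_iff)
  then show ?thesis unfolding hausdorff_dim_def by (intro Inf_superset_mono) blast
qed

section \<open>The Liouville variable at infinity\<close>

text \<open>A quantitative form of the Noshiro-Warschawski criterion. Along the segment from v to u,
  the real part of c f times the conjugate of u - v has derivative at least m |u - v|^2, and the
  real mean value theorem applies. It gives injectivity and a lower Lipschitz bound on convex sets,
  which a lower bound for |f'| alone would not give.\<close>

lemma expanding_if_Re_deriv_ge:
  fixes f :: "complex \<Rightarrow> complex"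
  assumes S: "convex S" and f: "\<And>x. x \<in> S \<Longrightarrow> (f has_field_derivative f' x) (at x)"
    and c: "norm c = 1" and m: "\<And>x. x \<in> S \<Longrightarrow> m \<le> Re (c * f' x)"
    and u: "u \<in> S" "v \<in> S"
  shows "m * norm (u - v) \<le> norm (f u - f v)"
proof (cases "u = v")
  case False
  define l where "l t = v + of_real t * (u - v)" for t :: real
  define g where "g t = Re (c * f (l t) * cnj (u - v))" for t :: real
  have l: "l t \<in> S" if "0 \<le> t" "t \<le> 1" for t
    using convexD_alt[OF S u(2) u(1) that] by (simp add: l_def algebra_simps scaleR_conv_of_real)
  have "(g has_real_derivative (Re (c * f' (l t)) * (norm (u - v))\<^sup>2)) (at t)" if t: "0 \<le> t" "t \<le> 1" for t
  proof -
    have "(l has_vector_derivative (u - v)) (at t)"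
      unfolding l_def has_vector_derivative_def
      by (auto intro!: derivative_eq_intros simp: scaleR_conv_of_real)
    then have "((\<lambda>t. f (l t)) has_vector_derivative ((u - v) * f' (l t))) (at t)"
      using field_vector_diff_chain_at[of l "u - v" t f "f' (l t)"] f[OF l[OF t]]
      by (simp add: o_def)
    then have "((\<lambda>t. c * f (l t) * cnj (u - v)) has_vector_derivative (c * ((u - v) * f' (l t)) * cnj (u - v))) (at t)"
      by (intro derivative_intros)
    then have "(g has_vector_derivative Re (c * ((u - v) * f' (l t)) * cnj (u - v))) (at t)"
      unfolding g_def by (rule bounded_linear.has_vector_derivative[OF bounded_linear_Re])
    also have "c * ((u - v) * f' (l t)) * cnj (u - v) = (c * f' (l t)) * of_real ((norm (u - v))\<^sup>2)"
      unfolding complex_norm_square by (simp only: mult_ac)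
    also have "Re \<dots> = Re (c * f' (l t)) * (norm (u - v))\<^sup>2" by simp
    finally show ?thesis by (simp only: has_real_derivative_iff_has_vector_derivative)
  qed
  then obtain z where z: "z > 0" "z < 1" "g 1 - g 0 = (1 - 0) * (Re (c * f' (l z)) * (norm (u - v))\<^sup>2)"
    using MVT2[of 0 1 g "\<lambda>t. Re (c * f' (l t)) * (norm (u - v))\<^sup>2"] by auto
  have "m * (norm (u - v))\<^sup>2 \<le> Re (c * f' (l z)) * (norm (u - v))\<^sup>2"
    by (intro mult_right_mono m l) (use z in auto)
  also have "\<dots> = Re (c * (f u - f v) * cnj (u - v))"
    using z(3) by (simp add: g_def l_def algebra_simps)
  also have "\<dots> \<le> norm (c * (f u - f v) * cnj (u - v))" by (rule complex_Re_le_cmod)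
  also have "\<dots> = norm (f u - f v) * norm (u - v)" using c
    by (simp add: norm_mult del: complex_cnj_diff)
  finally show ?thesis using False by (simp add: power2_eq_square mult.assoc[symmetric])
qed simp

text \<open>Brouwer's theorem applied to \<open>\<lambda>x. a - e x\<close>. Surjectivity thus costs
  only an estimate of the size of the perturbation, not of its derivative.\<close>

lemma perturbed_identity_attains:
  fixes e :: "'a::euclidean_space \<Rightarrow> 'a"
  assumes "r \<ge> 0" "continuous_on (cball a r) e" "\<And>x. x \<in> cball a r \<Longrightarrow> norm (e x) \<le> r"
  obtains x where "x \<in> cball a r" "x + e x = a"
proof -
  obtain x where "x \<in> cball a r" "a - e x = x"
  proof (rule brouwer[of "cball a r" "\<lambda>x. a - e x"])
    show "continuous_on (cball a r) (\<lambda>x. a - e x)" by (intro continuous_intros assms)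
    show "(\<lambda>x. a - e x) \<in> cball a r \<rightarrow> cball a r" using assms(3) by (auto simp: dist_norm)
  qed (use \<open>r \<ge> 0\<close> in auto)
  then show ?thesis using that[of x] by (metis diff_add_cancel)
qed

lemma poly_norm_le:
  fixes q :: "complex poly"
  assumes "degree q \<le> k"
  obtains C where "C > 0" "\<And>z. norm z \<ge> 1 \<Longrightarrow> norm (poly q z) \<le> C * norm z ^ k"
proof
  show "(\<Sum>i\<le>degree q. norm (coeff q i)) + 1 > 0" by (intro add_nonneg_pos sum_nonneg) auto
  fix z :: complex assume z: "norm z \<ge> 1"
  have "norm (poly q z) \<le> (\<Sum>i\<le>degree q. norm (coeff q i * z ^ i))"
    unfolding poly_altdef by (rule norm_sum)
  also have "\<dots> \<le> (\<Sum>i\<le>degree q. norm (coeff q i) * norm z ^ k)"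
    by (intro sum_mono) (use z assms in \<open>auto simp: norm_mult norm_power intro!: mult_left_mono power_increasing\<close>)
  also have "\<dots> = (\<Sum>i\<le>degree q. norm (coeff q i)) * norm z ^ k" by (simp add: sum_distrib_right)
  also have "\<dots> \<le> ((\<Sum>i\<le>degree q. norm (coeff q i)) + 1) * norm z ^ k" by (intro mult_right_mono) auto
  finally show "norm (poly q z) \<le> ((\<Sum>i\<le>degree q. norm (coeff q i)) + 1) * norm z ^ k" .
qed

lemma poly_asymp_lead:
  fixes P :: "complex poly"
  assumes "P \<noteq> 0"
  obtains C where "C > 0"
    "\<And>z. norm z \<ge> 1 \<Longrightarrow> norm (poly P z / (lead_coeff P * z ^ degree P) - 1) \<le> C / norm z"
proof -
  define a where "a = lead_coeff P"
  define m where "m = degree P"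
  have a: "a \<noteq> 0" using assms by (simp add: a_def)
  \<comment> \<open>Multiplying the remainder by z brings its degree back up to at most m, so one
    norm bound with exponent m serves every degree, zero included.\<close>
  define q where "q = pCons 0 (P - monom a m)"
  have "degree q \<le> m"
  proof (rule degree_le, clarify)
    fix i assume "m < i"
    then obtain k where "i = Suc k" "k \<ge> m" by (cases i) auto
    then show "coeff q i = 0"
      unfolding q_def a_def m_def by (cases "k = degree P") (auto simp: coeff_eq_0)
  qed
  then obtain C where C: "C > 0" "\<And>z. norm z \<ge> 1 \<Longrightarrow> norm (poly q z) \<le> C * norm z ^ m"
    by (rule poly_norm_le) blast
  have "norm (poly P z / (a * z ^ m) - 1) \<le> (C / norm a) / norm z" if z: "norm z \<ge> 1" for z
  proof -
    have z0: "z \<noteq> 0" using z by auto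
    then have "poly P z / (a * z ^ m) - 1 = poly q z / (a * z ^ m * z)"
      using a by (simp add: q_def poly_monom field_simps)
    then have "norm (poly P z / (a * z ^ m) - 1) = norm (poly q z) / (norm a * norm z ^ m * norm z)"
      by (simp add: norm_mult norm_divide norm_power)
    also have "\<dots> \<le> C * norm z ^ m / (norm a * norm z ^ m * norm z)"
      by (intro divide_right_mono C z) auto
    also have "\<dots> = (C / norm a) / norm z" using z0 a by (simp add: field_simps)
    finally show ?thesis .
  qed
  then show thesis using that[of "C / norm a"] C(1) a unfolding a_def m_def by simp
qed

lemma norm_csqrt_minus_1_le: "norm (csqrt w - 1) \<le> norm (w - 1)"
proof -
  have eq: "w - 1 = (csqrt w - 1) * (csqrt w + 1)" by (simp add: algebra_simps power2_eq_square[symmetric])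
  have "Re (csqrt w) \<ge> 0" using csqrt_principal[of w] by linarith
  then have "norm (csqrt w + 1) \<ge> 1"
    using complex_Re_le_cmod[of "csqrt w + 1"] by (simp del: csqrt.sel)
  then have "norm (csqrt w - 1) * 1 \<le> norm (csqrt w - 1) * norm (csqrt w + 1)"
    by (intro mult_left_mono) auto
  also have "\<dots> = norm (w - 1)" by (simp only: eq norm_mult)
  finally show ?thesis by simp
qed

text \<open>Read in the coordinate ln z, this is a neighbourhood of infinity on finitely many
  sheets; \<open>B\<close> determines how many.\<close>

definition half_strip :: "real \<Rightarrow> real \<Rightarrow> complex set" where
  "half_strip X B = {x. Re x > X \<and> \<bar>Im x\<bar> < B}"

lemma half_strip_eq: "half_strip X B = {x. Re x > X} \<inter> ({x. Im x < B} \<inter> {x. Im x > - B})"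
  by (auto simp: half_strip_def)

lemma open_half_strip: "open (half_strip X B)"
  unfolding half_strip_eq by (intro open_Int open_halfspace_Re_gt open_halfspace_Im_lt open_halfspace_Im_gt)

lemma convex_half_strip: "convex (half_strip X B)"
  unfolding half_strip_eq by (intro convex_Int convex_halfspace_Re_gt convex_halfspace_Im_lt convex_halfspace_Im_gt)

text \<open>In the coordinate \<open>x = ln z\<close> the Liouville variable is \<open>exp (s x)\<close> with \<open>s\<close> nearly affine. This makes
  its inversion a perturbation of the identity, on a convex domain that meets many sheets.\<close>

lemma log_liouville_coordinate:
  fixes P :: "complex poly" and B :: real
  assumes P: "P \<noteq> 0" and B: "B > 0"
  defines "\<mu> \<equiv> (real (degree P) + 2) / 2"
  defines "\<Lambda> \<equiv> Ln (csqrt (lead_coeff P) / of_real \<mu>)"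
  obtains s X0 where
    "\<And>x. x \<in> half_strip X0 B \<Longrightarrow> s field_differentiable (at x)"
    "\<And>x. x \<in> half_strip X0 B \<Longrightarrow> (deriv s x * exp (s x))\<^sup>2 = poly P (exp x) * exp (2 * x)"
    "\<And>\<delta>. \<delta> > 0 \<Longrightarrow> \<exists>X1 \<ge> X0. \<forall>x \<in> half_strip X1 B.
        norm (s x - (of_real \<mu> * x + \<Lambda>)) \<le> \<delta> \<and> norm (deriv s x - of_real \<mu>) \<le> \<delta>"
proof -
  define m where "m = degree P"
  define a where "a = lead_coeff P"
  define b where "b = csqrt a"
  define \<kappa> where "\<kappa> = b / of_real \<mu>"
  have a: "a \<noteq> 0" and b: "b \<noteq> 0" "b\<^sup>2 = a" using P by (auto simp: a_def b_def)
  have \<mu>: "\<mu> \<ge> 1" by (simp add: \<mu>_def)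
  then have \<kappa>: "\<kappa> \<noteq> 0" "exp \<Lambda> = \<kappa>" using b by (auto simp: \<kappa>_def \<Lambda>_def b_def a_def)
  obtain C where C: "C > 0"
    "\<And>z. norm z \<ge> 1 \<Longrightarrow> norm (poly P z / (a * z ^ m) - 1) \<le> C / norm z"
    using poly_asymp_lead[OF P] unfolding a_def m_def by blast
  define Q where "Q x = poly P (exp x) / (a * exp x ^ m)" for x
  have Q1: "norm (Q x - 1) \<le> C * exp (- Re x)" if "Re x \<ge> 0" for x
    using C(2)[of "exp x"] that unfolding Q_def by (simp add: exp_minus field_simps)
  \<comment> \<open>Beyond \<open>Y\<close> the normalised polynomial \<open>Q\<close> stays within
    1/2 of 1, so its principal square root is holomorphic there.\<close>
  define Y where "Y = max 1 (ln (2 * C))"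
  have Y: "C * exp (- Re x) \<le> 1 / 2" if "Re x \<ge> Y" for x
  proof -
    have "exp (ln (2 * C)) \<le> exp (Re x)" using that by (simp add: Y_def)
    then show ?thesis using C(1) by (simp add: exp_minus field_simps)
  qed
  have Qhalf: "norm (Q x - 1) \<le> 1 / 2" if "Re x \<ge> Y" for x
    using Q1[of x] Y[of x] that by (simp add: Y_def)
  have RQ: "Re (Q x) > 0" if "Re x \<ge> Y" for x
    using Qhalf[OF that] abs_Re_le_cmod[of "Q x - 1"] by auto
  define R where "R x = csqrt (Q x)" for x
  have R1: "norm (R x - 1) \<le> C * exp (- Re x)" if "Re x \<ge> Y" for x
    using norm_csqrt_minus_1_le[of "Q x"] Q1[of x] that by (simp add: R_def Y_def)
  define H where "H = half_strip Y B"
  have HY: "Re x > Y" "\<bar>Im x\<bar> < B" if "x \<in> H" for x using that by (auto simp: H_def half_strip_def)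
  have "Q holomorphic_on H" unfolding Q_def by (intro holomorphic_intros) (use a in auto)
  then have Rh: "R holomorphic_on H" unfolding R_def
    by (intro holomorphic_on_csqrt') (use HY RQ in \<open>auto simp: complex_nonpos_Reals_iff less_imp_le\<close>, 
        metis HY(1) RQ less_imp_le not_le)
  \<comment> \<open>In the coordinate x the form sqrt(P) dz becomes \<open>g x\<close> dx. Its main
    part b exp(\<mu> x) has the explicit primitive \<kappa> exp(\<mu> x), so only the remainder
    \<open>gh\<close> has to be integrated by an existence theorem.\<close>
  define g where "g x = b * exp (of_real \<mu> * x) * R x" for x
  define gh where "gh x = b * exp (of_real \<mu> * x) * (R x - 1)" for x
  have "gh holomorphic_on H" unfolding gh_def by (intro holomorphic_intros Rh)
  then obtain h0 where h0: "\<And>x. x \<in> H \<Longrightarrow> (h0 has_field_derivative gh x) (at x)"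
    using holomorphic_convex_primitive'[of H gh] convex_half_strip open_half_strip
    unfolding H_def by (metis at_within_open)
  define x0 where "x0 = complex_of_real (Y + 1)"
  have x0: "x0 \<in> H" using B by (simp add: x0_def H_def half_strip_def)
  define h where "h x = h0 x - h0 x0" for x
  have h: "(h has_field_derivative gh x) (at x)" if "x \<in> H" for x
    unfolding h_def using h0[OF that] by (auto intro!: derivative_eq_intros)
  have ghb: "norm (gh x) \<le> norm b * C * exp ((\<mu> - 1) * Re x)" if "x \<in> H" for x
  proof -
    have "norm (gh x) = norm b * exp (\<mu> * Re x) * norm (R x - 1)" by (simp add: gh_def norm_mult)
    also have "\<dots> \<le> norm b * exp (\<mu> * Re x) * (C * exp (- Re x))"
      by (intro mult_left_mono R1) (use HY[OF that] in auto)
    also have "\<dots> = norm b * C * exp ((\<mu> - 1) * Re x)" by (simp add: algebra_simps exp_add[symmetric] exp_diff exp_minus) (simp add: field_simps)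
    finally show ?thesis .
  qed
  have hb: "norm (h x) \<le> norm b * C * exp ((\<mu> - 1) * Re x) * norm (x - x0)" if x: "x \<in> H" "Re x \<ge> Y + 1" for x
  proof -
    \<comment> \<open>Cutting the strip at \<open>Re x\<close> keeps the path of integration where
      the growing bound for \<open>gh\<close> does not exceed its value at the endpoint.\<close>
    define S where "S = H \<inter> {w. Re w \<le> Re x}"
    have cS: "convex S" unfolding S_def H_def by (intro convex_Int convex_half_strip convex_halfspace_Re_le)
    have "norm (h x - h x0) \<le> norm b * C * exp ((\<mu> - 1) * Re x) * norm (x - x0)"
    proof (rule field_differentiable_bound[OF cS])
      fix z assume z: "z \<in> S"
      show "(h has_field_derivative gh z) (at z within S)"
        using h z unfolding S_def by (blast intro: has_field_derivative_at_within)
      have "norm (gh z) \<le> norm b * C * exp ((\<mu> - 1) * Re z)" using ghb z by (simp add: S_def)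
      also have "\<dots> \<le> norm b * C * exp ((\<mu> - 1) * Re x)"
        using z \<mu> C(1) by (intro mult_left_mono) (auto simp: S_def mult_left_mono)
      finally show "norm (gh z) \<le> norm b * C * exp ((\<mu> - 1) * Re x)" .
    qed (use x x0 in \<open>auto simp: S_def x0_def\<close>)
    then show ?thesis by (simp add: h_def)
  qed
  \<comment> \<open>The relative error of the primitive: \<kappa> exp(\<mu> x) + h x = \<kappa>
    exp(\<mu> x) (1 + e x). Once \<open>e\<close> is small, the Liouville variable therefore has a
    holomorphic logarithm, which is \<open>s\<close>.\<close>
  define e where "e x = h x * exp (- of_real \<mu> * x) / \<kappa>" for x
  define K where "K = norm b * C / norm \<kappa>"
  have K: "K > 0" using C b \<kappa> by (simp add: K_def)
  have eb: "norm (e x) \<le> K * exp (- Re x) * (Re x + B + Y + 1)" if x: "x \<in> H" "Re x \<ge> Y + 1" for x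
  proof -
    have "norm (e x) = norm (h x) * exp (- \<mu> * Re x) / norm \<kappa>"
      by (simp add: e_def norm_mult norm_divide)
    also have "\<dots> \<le> (norm b * C * exp ((\<mu> - 1) * Re x) * norm (x - x0)) * exp (- \<mu> * Re x) / norm \<kappa>"
      by (intro divide_right_mono mult_right_mono hb x) auto
    also have "\<dots> = K * (exp ((\<mu> - 1) * Re x) * exp (- \<mu> * Re x)) * norm (x - x0)"
      by (simp add: K_def)
    also have "exp ((\<mu> - 1) * Re x) * exp (- \<mu> * Re x) = exp (- Re x)"
      by (simp add: exp_add[symmetric] algebra_simps)
    also have "K * exp (- Re x) * norm (x - x0) \<le> K * exp (- Re x) * (Re x + B + Y + 1)"
    proof (intro mult_left_mono)
      have "norm (x - x0) \<le> \<bar>Re (x - x0)\<bar> + \<bar>Im (x - x0)\<bar>" by (rule cmod_le)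
      also have "\<dots> \<le> Re x + B + Y + 1" using HY[OF x(1)] x(2) by (simp add: x0_def Y_def)
      finally show "norm (x - x0) \<le> Re x + B + Y + 1" .
    qed (use K in auto)
    finally show ?thesis .
  qed
  \<comment> \<open>The linear factor is the length of the path of integration; the gain exp(-t)
    from the square root absorbs it.\<close>
  have lim: "((\<lambda>t::real. K * exp (- t) * (t + B + Y + 1)) \<longlongrightarrow> 0) at_top"
  proof -
    have "((\<lambda>t::real. K * (t / exp t) + K * (B + Y + 1) * exp (- t)) \<longlongrightarrow> K * 0 + K * (B + Y + 1) * 0) at_top"
      by (intro tendsto_intros tendsto_power_div_exp_0[of 1, simplified] filterlim_compose[OF exp_at_bot filterlim_uminus_at_bot_at_top])
    then show ?thesis by (simp add: algebra_simps exp_minus divide_inverse)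
  qed
  have small: "\<exists>X1 \<ge> Y + 1. \<forall>x \<in> half_strip X1 B. norm (e x) \<le> d \<and> norm (R x - 1) \<le> d" if d: "d > 0" for d
  proof -
    have "eventually (\<lambda>t. K * exp (- t) * (t + B + Y + 1) < d) at_top"
      using lim d by (rule order_tendstoD)
    moreover have "((\<lambda>t. C * exp (- t)) \<longlongrightarrow> C * 0) at_top"
      by (intro tendsto_intros filterlim_compose[OF exp_at_bot filterlim_uminus_at_bot_at_top])
    then have "eventually (\<lambda>t. C * exp (- t) < d) at_top"
      using d by (intro order_tendstoD) auto
    ultimately have "eventually (\<lambda>t. K * exp (- t) * (t + B + Y + 1) < d \<and> C * exp (- t) < d) at_top"
      by (rule eventually_conj)
    then obtain X where X: "\<And>t. t \<ge> X \<Longrightarrow> K * exp (- t) * (t + B + Y + 1) < d \<and> C * exp (- t) < d"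
      unfolding eventually_at_top_linorder by blast
    show ?thesis
    proof (intro exI[of _ "max X (Y+1)"] conjI ballI)
      fix x assume "x \<in> half_strip (max X (Y+1)) B"
      then have x: "x \<in> H" "Re x \<ge> Y + 1" "Re x \<ge> X" by (auto simp: H_def half_strip_def)
      show "norm (e x) \<le> d" using eb[OF x(1,2)] X[OF x(3)] by linarith
      show "norm (R x - 1) \<le> d" using R1[of x] x X[OF x(3)] by simp
    qed simp
  qed
  obtain X0 where X0: "X0 \<ge> Y + 1" "\<And>x. x \<in> half_strip X0 B \<Longrightarrow> norm (e x) \<le> 1 / 4"
    using small[of "1/4"] by auto
  have H0: "x \<in> H" if "x \<in> half_strip X0 B" for x using that X0(1) by (auto simp: H_def half_strip_def)
  define s where "s x = of_real \<mu> * x + \<Lambda> + Ln (1 + e x)" for x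
  have e1: "1 + e x \<noteq> 0" "1 + e x \<notin> \<real>\<^sub>\<le>\<^sub>0" if "x \<in> half_strip X0 B" for x
  proof -
    have "\<bar>Re (e x)\<bar> \<le> 1/4" using X0(2)[OF that] abs_Re_le_cmod[of "e x"] by linarith
    then have "Re (1 + e x) > 0" by simp
    then show "1 + e x \<noteq> 0" "1 + e x \<notin> \<real>\<^sub>\<le>\<^sub>0"  by (auto simp: complex_nonpos_Reals_iff simp del: plus_complex.sel)
  qed
  have exps: "exp (s x) = \<kappa> * exp (of_real \<mu> * x) + h x" if "x \<in> half_strip X0 B" for x
  proof -
    have "exp (s x) = exp (of_real \<mu> * x) * \<kappa> * (1 + e x)"
      using e1[OF that] \<kappa> by (simp add: s_def exp_add)
    also have "\<dots> = \<kappa> * exp (of_real \<mu> * x) + h x * (exp (of_real \<mu> * x) * exp (- of_real \<mu> * x))"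
      using \<kappa> by (simp add: e_def field_simps del: exp_minus_inverse)
    finally show ?thesis by (simp add: exp_minus_inverse)
  qed
  have ediff: "e field_differentiable (at x)" if "x \<in> H" for x
    unfolding e_def using h[OF that] \<kappa>
    by (intro derivative_intros field_differentiable_divide field_differentiable_mult) (auto simp: field_differentiable_def intro!: derivative_eq_intros exI)
  have sdiff: "s field_differentiable (at x)" if x: "x \<in> half_strip X0 B" for x
  proof -
    have "(\<lambda>x. 1 + e x) field_differentiable (at x)"
      by (intro derivative_intros field_differentiable_add ediff H0 x)
    then have "(\<lambda>x. Ln (1 + e x)) field_differentiable (at x)"
      using e1[OF x] field_differentiable_compose[of "\<lambda>x. 1 + e x" x Ln] field_differentiable_at_Ln by (simp add: o_def)
    then show ?thesis unfolding s_def
      by (intro field_differentiable_add field_differentiable_mult) (auto intro!: derivative_intros)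
  qed
  have sder: "deriv s x * exp (s x) = g x" if x: "x \<in> half_strip X0 B" for x
  proof -
    have "((\<lambda>x. exp (s x)) has_field_derivative (exp (s x) * deriv s x)) (at x)"
      using sdiff[OF x] by (auto intro!: derivative_eq_intros simp: field_differentiable_derivI)
    moreover have "((\<lambda>x. exp (s x)) has_field_derivative g x) (at x)"
    proof (rule has_field_derivative_transform_within_open)
      show "((\<lambda>x. \<kappa> * exp (of_real \<mu> * x) + h x) has_field_derivative g x) (at x)"
        using h[OF H0[OF x]] \<mu> by (auto intro!: derivative_eq_intros simp: g_def gh_def \<kappa>_def algebra_simps)
    qed (use x exps open_half_strip in auto)
    ultimately show ?thesis by (metis DERIV_unique mult.commute)
  qed
  show ?thesis
  proof (rule that[of X0 s])
    show "s field_differentiable (at x)" if "x \<in> half_strip X0 B" for x by (rule sdiff) fact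
  next
    fix x assume x: "x \<in> half_strip X0 B"
    have "(deriv s x * exp (s x))\<^sup>2 = a * exp (of_real \<mu> * x) ^ 2 * Q x"
      using sder[OF x] b by (simp add: g_def power_mult_distrib R_def)
    also have "exp (of_real \<mu> * x) ^ 2 = exp (2 * (of_real \<mu> * x))" by (rule exp_double[symmetric])
    also have "2 * (of_real \<mu> * x) = 2 * x + of_nat m * x"
      by (simp add: \<mu>_def m_def algebra_simps)
    also have "exp \<dots> = exp (2 * x) * exp x ^ m" by (simp add: exp_add exp_of_nat_mult)
    finally show "(deriv s x * exp (s x))\<^sup>2 = poly P (exp x) * exp (2 * x)"
      using a by (simp add: Q_def)
  next
    fix \<delta> :: real assume \<delta>: "\<delta> > 0"
    define d where "d = min (1/4) (\<delta> / (4 * \<mu>))"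
    have d: "d > 0" "d \<le> 1/4" "4 * \<mu> * d \<le> \<delta>"
      using \<delta> \<mu> by (auto simp: d_def min_def field_simps)
    obtain X1 where X1: "X1 \<ge> Y + 1" "\<And>x. x \<in> half_strip X1 B \<Longrightarrow> norm (e x) \<le> d \<and> norm (R x - 1) \<le> d"
      using small[OF d(1)] by blast
    show "\<exists>X1 \<ge> X0. \<forall>x \<in> half_strip X1 B.
        norm (s x - (of_real \<mu> * x + \<Lambda>)) \<le> \<delta> \<and> norm (deriv s x - of_real \<mu>) \<le> \<delta>"
    proof (intro exI[of _ "max X0 X1"] conjI ballI)
      fix x assume "x \<in> half_strip (max X0 X1) B"
      then have x: "x \<in> half_strip X0 B" "x \<in> half_strip X1 B" by (auto simp: half_strip_def)
      have ed: "norm (e x) \<le> d" and Rd: "norm (R x - 1) \<le> d" using X1(2)[OF x(2)] by auto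
      have "norm (s x - (of_real \<mu> * x + \<Lambda>)) = norm (Ln (1 + e x))" by (simp add: s_def)
      also have "\<dots> \<le> 2 * norm (e x)" using ed d by (intro norm_Ln_le) auto
      also have "\<dots> \<le> 2 * d" using ed by simp
      also have "\<dots> \<le> 4 * \<mu> * d" using d(1) \<mu> by simp
      finally show "norm (s x - (of_real \<mu> * x + \<Lambda>)) \<le> \<delta>" using d(3) by linarith
      have ne: "1 + e x \<noteq> 0" by (rule e1[OF x(1)])
      have "exp (s x) = \<kappa> * exp (of_real \<mu> * x) * (1 + e x)"
        using e1[OF x(1)] \<kappa> by (simp add: s_def exp_add)
      then have "deriv s x * (\<kappa> * exp (of_real \<mu> * x) * (1 + e x)) = \<kappa> * of_real \<mu> * exp (of_real \<mu> * x) * R x"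
        using sder[OF x(1)] \<mu> by (simp add: g_def \<kappa>_def)
      then have "\<kappa> * exp (of_real \<mu> * x) * (deriv s x * (1 + e x)) = \<kappa> * exp (of_real \<mu> * x) * (of_real \<mu> * R x)"
        by (simp only: mult_ac)
      then have "deriv s x * (1 + e x) = of_real \<mu> * R x" using \<kappa>(1) by simp
      then have "(deriv s x - of_real \<mu>) * (1 + e x) = of_real \<mu> * ((R x - 1) - e x)"
        by (simp add: algebra_simps)
      then have "norm (deriv s x - of_real \<mu>) * norm (1 + e x) = \<mu> * norm ((R x - 1) - e x)"
        using \<mu> by (metis norm_mult norm_of_real abs_of_nonneg order_trans zero_le_one)
      also have "\<dots> \<le> \<mu> * (2 * d)"
        using \<mu> ed Rd norm_triangle_ineq4[of "R x - 1" "e x"] by (intro mult_left_mono) auto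
      finally have 1: "norm (deriv s x - of_real \<mu>) * norm (1 + e x) \<le> \<mu> * (2 * d)" .
      have "norm (1 + e x) \<ge> 1/2" using norm_triangle_ineq2[of 1 "- e x"] ed d by simp
      then have "norm (deriv s x - of_real \<mu>) * (1/2) \<le> norm (deriv s x - of_real \<mu>) * norm (1 + e x)"
        by (intro mult_left_mono) auto
      then show "norm (deriv s x - of_real \<mu>) \<le> \<delta>" using 1 d(3) by linarith
    qed simp
  qed
qed

text \<open>\<open>X\<close> inverts the coordinate s: the real part of the derivative of s is at
  least 1/2, which gives injectivity, and Brouwer's theorem shows that s covers a slightly smaller
  strip. The identity for \<open>exp (2 * v)\<close> is d\<zeta>^2 = P(z) dz^2 written in v = ln
  \<zeta> and x = ln z. The lower bound on \<open>B\<close> serves the last clause, which catches z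
  with any argument between -pi and pi.\<close>

lemma log_chart:
  fixes P :: "complex poly" and B :: real
  defines "\<mu> \<equiv> (real (degree P) + 2) / 2"
  defines "\<Lambda> \<equiv> Ln (csqrt (lead_coeff P) / of_real \<mu>)"
  assumes P: "P \<noteq> 0" and B: "B > \<mu> * pi + norm \<Lambda> + 2"
  obtains X S0 where
    "X holomorphic_on half_strip S0 B"
    "\<And>v. v \<in> half_strip S0 B \<Longrightarrow> exp (2 * v) = (deriv X v)\<^sup>2 * poly P (exp (X v)) * exp (2 * X v)"
    "\<And>\<delta>. \<delta> > 0 \<Longrightarrow> \<exists>S1 \<ge> S0. \<forall>v \<in> half_strip S1 B.
        norm (X v - (v - \<Lambda>) / of_real \<mu>) \<le> \<delta> \<and> norm (deriv X v - 1 / of_real \<mu>) \<le> \<delta>"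
    "\<exists>X1. \<forall>x. Re x > X1 \<and> \<bar>Im x\<bar> \<le> pi \<longrightarrow>
        (\<exists>v \<in> half_strip S0 B. X v = x \<and> norm (v - (of_real \<mu> * x + \<Lambda>)) \<le> 1)"
proof -
  define B1 where "B1 = B + norm \<Lambda> + 2"
  have \<mu>: "\<mu> \<ge> 1" by (simp add: \<mu>_def)
  have B0: "B > 0" and B1: "B1 > 0" "B1 > pi"
  proof -
    have "\<mu> * pi \<ge> 1 * pi" using \<mu> by (intro mult_right_mono) auto
    then show "B > 0" "B1 > 0" "B1 > pi" using B pi_gt_zero unfolding B1_def by (smt (verit) norm_ge_zero)+
  qed
  obtain s X0 where s:
    "\<And>x. x \<in> half_strip X0 B1 \<Longrightarrow> s field_differentiable (at x)"
    "\<And>x. x \<in> half_strip X0 B1 \<Longrightarrow> (deriv s x * exp (s x))\<^sup>2 = poly P (exp x) * exp (2 * x)"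
    "\<And>\<delta>. \<delta> > 0 \<Longrightarrow> \<exists>X1 \<ge> X0. \<forall>x \<in> half_strip X1 B1.
        norm (s x - (of_real \<mu> * x + \<Lambda>)) \<le> \<delta> \<and> norm (deriv s x - of_real \<mu>) \<le> \<delta>"
    by (rule log_liouville_coordinate[OF P B1(1), folded \<mu>_def \<Lambda>_def]) (rule that; assumption)
  obtain X1 where X1: "X1 \<ge> X0" "\<And>x. x \<in> half_strip X1 B1 \<Longrightarrow>
        norm (s x - (of_real \<mu> * x + \<Lambda>)) \<le> 1/2 \<and> norm (deriv s x - of_real \<mu>) \<le> 1/2"
    using s(3)[of "1/2"] by auto
  define T where "T = half_strip X1 B1"
  have TX: "x \<in> half_strip X0 B1" if "x \<in> T" for x using that X1(1) by (auto simp: T_def half_strip_def)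
  have sder: "(s has_field_derivative deriv s x) (at x)" if "x \<in> T" for x
    using s(1)[OF TX[OF that]] by (simp add: field_differentiable_derivI)
  have sRe: "Re (1 * deriv s x) \<ge> 1/2" "deriv s x \<noteq> 0" "norm (deriv s x) \<ge> 1/2" if "x \<in> T" for x
  proof -
    have "\<bar>Re (deriv s x - of_real \<mu>)\<bar> \<le> 1/2" 
      using X1(2)[of x] that abs_Re_le_cmod[of "deriv s x - of_real \<mu>"] unfolding T_def by linarith
    then have "\<bar>Re (deriv s x) - \<mu>\<bar> \<le> 1/2" by simp
    then show "Re (1 * deriv s x) \<ge> 1/2" using \<mu> unfolding mult_1 by linarith
    then show "deriv s x \<noteq> 0" by auto
    show "norm (deriv s x) \<ge> 1/2" using \<open>Re (1 * deriv s x) \<ge> 1/2\<close> complex_Re_le_cmod[of "deriv s x"] by simp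
  qed
  have inj: "inj_on s T"
  proof (rule inj_onI)
    fix x y assume xy: "x \<in> T" "y \<in> T" "s x = s y"
    have "1/2 * norm (x - y) \<le> norm (s x - s y)"
      by (rule expanding_if_Re_deriv_ge[of T s "deriv s" 1])
         (use xy sder sRe convex_half_strip in \<open>auto simp: T_def\<close>)
    then show "x = y" using xy by simp
  qed
  have "s holomorphic_on T" using sder by (auto simp: holomorphic_on_def field_differentiable_def intro: has_field_derivative_at_within)
  then obtain X where X: "X holomorphic_on s ` T" "\<And>x. x \<in> T \<Longrightarrow> deriv s x * deriv X (s x) = 1"
      "\<And>x. x \<in> T \<Longrightarrow> X (s x) = x"
    using holomorphic_has_inverse[of s T] inj open_half_strip unfolding T_def by metis
  \<comment> \<open>The solution is sought around the point \<open>a\<close> predicted by the affine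
    model of s. Dividing the error of that model by \<mu> \<ge> 1 keeps it within the radius
    \<delta>.\<close>
  have key: "\<exists>x \<in> half_strip Y B1. s x = v \<and> norm (x - (v - \<Lambda>) / of_real \<mu>) \<le> \<delta>"
    if v: "v \<in> half_strip (\<mu> * (Y + 1) + norm \<Lambda>) B" and Y: "Y \<ge> X1" and \<delta>: "0 < \<delta>" "\<delta> \<le> 1/2"
      and b: "\<And>x. x \<in> half_strip Y B1 \<Longrightarrow> norm (s x - (of_real \<mu> * x + \<Lambda>)) \<le> \<delta>" for v Y \<delta>
  proof -
    define a where "a = (v - \<Lambda>) / of_real \<mu>"
    have Rea: "Re a > Y + 1"
    proof -
      have "\<mu> * (Y + 1) < Re v - Re \<Lambda>" using v complex_Re_le_cmod[of \<Lambda>] by (simp add: half_strip_def)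
      then show ?thesis using \<mu> by (simp add: a_def field_simps)
    qed
    have Ima: "\<bar>Im a\<bar> < B + norm \<Lambda>"
    proof -
      have "\<bar>Im (v - \<Lambda>)\<bar> < B + norm \<Lambda>" using v abs_Im_le_cmod[of \<Lambda>]
        unfolding half_strip_def mem_Collect_eq minus_complex.sel by linarith
      moreover have "\<bar>Im a\<bar> \<le> \<bar>Im (v - \<Lambda>)\<bar>" 
        using \<mu> mult_left_mono[of 1 \<mu> "\<bar>Im v - Im \<Lambda>\<bar>"] by (simp add: a_def abs_divide divide_le_eq)
      ultimately show ?thesis by linarith
    qed
    have sub: "x \<in> half_strip Y B1" if "x \<in> cball a \<delta>" for x
    proof -
      have "\<bar>Re (x - a)\<bar> \<le> 1/2" "\<bar>Im (x - a)\<bar> \<le> 1/2"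
        using that \<delta> abs_Re_le_cmod[of "x - a"] abs_Im_le_cmod[of "x - a"]
        by (auto simp: dist_norm norm_minus_commute)
      then show ?thesis using Rea Ima norm_ge_zero[of \<Lambda>]
        unfolding half_strip_def B1_def mem_Collect_eq minus_complex.sel by (intro conjI; linarith)
    qed
    have subT: "x \<in> T" if "x \<in> cball a \<delta>" for x using sub[OF that] Y by (auto simp: T_def half_strip_def)
    obtain x where x: "x \<in> cball a \<delta>" "x + (s x - (of_real \<mu> * x + \<Lambda>)) / of_real \<mu> = a"
    proof (rule perturbed_identity_attains[of \<delta> a "\<lambda>x. (s x - (of_real \<mu> * x + \<Lambda>)) / of_real \<mu>"])
      have "continuous_on (cball a \<delta>) s"
        using sder subT by (intro continuous_at_imp_continuous_on ballI) (blast intro: DERIV_isCont)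
      then show "continuous_on (cball a \<delta>) (\<lambda>x. (s x - (of_real \<mu> * x + \<Lambda>)) / of_real \<mu>)"
        using \<mu> by (intro continuous_intros) auto
      fix x assume "x \<in> cball a \<delta>"
      then have "norm (s x - (of_real \<mu> * x + \<Lambda>)) \<le> \<delta>" by (intro b sub)
      also have "\<delta> \<le> \<delta> * \<mu>" using \<mu> \<delta> by simp
      finally show "norm ((s x - (of_real \<mu> * x + \<Lambda>)) / of_real \<mu>) \<le> \<delta>"
        using \<mu> by (simp add: norm_divide divide_le_eq)
    qed (use \<delta> in auto)
    have "s x = v" using x(2) \<mu> by (simp add: a_def field_simps)
    then show ?thesis using sub[OF x(1)] x(1) by (auto simp: a_def dist_norm norm_minus_commute)
  qed
  define S0 where "S0 = \<mu> * (X1 + 1) + norm \<Lambda>"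
  have inT: "\<exists>x\<in>T. s x = v" if "v \<in> half_strip S0 B" for v
    using key[of v X1 "1/2"] that X1(2) unfolding S0_def T_def by fastforce
  have holo: "X holomorphic_on half_strip S0 B"
    by (rule holomorphic_on_subset[OF X(1)]) (use inT in blast)
  show ?thesis
  proof (rule that[OF holo])
    fix v assume "v \<in> half_strip S0 B"
    then obtain x where x: "x \<in> T" "s x = v" using inT by blast
    have e: "exp (s x) = deriv X v * (deriv s x * exp (s x))"
      using X(2)[OF x(1)] x(2) by (metis mult.assoc mult.commute mult_1)
    have "exp (2 * v) = (exp (s x))\<^sup>2" using x by (simp add: exp_double)
    also have "\<dots> = (deriv X v)\<^sup>2 * (deriv s x * exp (s x))\<^sup>2"
      using arg_cong[OF e, of "\<lambda>t. t\<^sup>2"] by (simp only: power_mult_distrib)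
    also have "\<dots> = (deriv X v)\<^sup>2 * poly P (exp (X v)) * exp (2 * X v)"
      using s(2)[OF TX[OF x(1)]] X(3)[OF x(1)] x(2) by (simp only: mult.assoc)
    finally show "exp (2 * v) = (deriv X v)\<^sup>2 * poly P (exp (X v)) * exp (2 * X v)" .
  next
    fix \<delta> :: real assume \<delta>: "\<delta> > 0"
    define d where "d = min (1/2) (\<delta> / 2)"
    have d: "d > 0" "d \<le> 1/2" "2 * d \<le> \<delta>" using \<delta> by (auto simp: d_def)
    obtain X2 where X2: "X2 \<ge> X0" "\<And>x. x \<in> half_strip X2 B1 \<Longrightarrow>
        norm (s x - (of_real \<mu> * x + \<Lambda>)) \<le> d \<and> norm (deriv s x - of_real \<mu>) \<le> d"
      using s(3)[OF d(1)] by auto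
    define Y where "Y = max X1 X2"
    have S1: "\<mu> * (Y + 1) + norm \<Lambda> \<ge> S0" unfolding S0_def using \<mu> by (simp add: Y_def)
    show "\<exists>S1 \<ge> S0. \<forall>v \<in> half_strip S1 B.
        norm (X v - (v - \<Lambda>) / of_real \<mu>) \<le> \<delta> \<and> norm (deriv X v - 1 / of_real \<mu>) \<le> \<delta>"
    proof (intro exI[of _ "\<mu> * (Y + 1) + norm \<Lambda>"] conjI[OF S1] ballI)
      fix v assume v: "v \<in> half_strip (\<mu> * (Y + 1) + norm \<Lambda>) B"
      have Y2: "x \<in> half_strip X2 B1" "x \<in> T" if "x \<in> half_strip Y B1" for x
        using that by (auto simp: half_strip_def Y_def T_def)
      obtain x where x: "x \<in> half_strip Y B1" "s x = v" "norm (x - (v - \<Lambda>) / of_real \<mu>) \<le> d"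
        using key[OF v _ d(1,2)] X2(2) Y2 by (metis Y_def max.cobounded1)
      have xT: "x \<in> T" by (rule Y2[OF x(1)])
      have Xv: "X v = x" using X(3)[OF xT] x(2) by simp
      have "deriv s x * deriv X v = 1" using X(2)[OF xT] x(2) by simp
      then have "(deriv X v - 1 / of_real \<mu>) * (deriv s x * of_real \<mu>) = of_real \<mu> - deriv s x"
        using \<mu> by (simp add: field_simps)
      then have "norm (deriv X v - 1 / of_real \<mu>) * (norm (deriv s x) * \<mu>) = norm (deriv s x - of_real \<mu>)"
        using \<mu> by (metis norm_mult norm_of_real norm_minus_commute abs_of_nonneg order_trans zero_le_one)
      also have "\<dots> \<le> d" using X2(2) Y2(1)[OF x(1)] by blast
      finally have "norm (deriv X v - 1 / of_real \<mu>) * (norm (deriv s x) * \<mu>) \<le> d" .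
      moreover have "norm (deriv X v - 1 / of_real \<mu>) * (1/2) \<le> norm (deriv X v - 1 / of_real \<mu>) * (norm (deriv s x) * \<mu>)"
        using sRe(3)[OF xT] \<mu> mult_mono[of "1/2" "norm (deriv s x)" 1 \<mu>] by (intro mult_left_mono) auto
      ultimately have "norm (deriv X v - 1 / of_real \<mu>) \<le> 2 * d" by linarith
      then show "norm (X v - (v - \<Lambda>) / of_real \<mu>) \<le> \<delta> \<and> norm (deriv X v - 1 / of_real \<mu>) \<le> \<delta>"
        using d x unfolding Xv by (intro conjI; linarith)
    qed
  next
    define X2 where "X2 = max X1 (S0 + norm \<Lambda> + 1)"
    define Y where "Y = max X2 0"
    show "\<exists>X1. \<forall>x. Re x > X1 \<and> \<bar>Im x\<bar> \<le> pi \<longrightarrow>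
        (\<exists>v \<in> half_strip S0 B. X v = x \<and> norm (v - (of_real \<mu> * x + \<Lambda>)) \<le> 1)"
    proof (intro exI[of _ Y] allI impI)
      fix x assume x: "Re x > Y \<and> \<bar>Im x\<bar> \<le> pi"
      have xT: "x \<in> T" using x B1 by (auto simp: T_def half_strip_def Y_def X2_def)
      have b: "norm (s x - (of_real \<mu> * x + \<Lambda>)) \<le> 1/2" using X1(2) xT by (simp add: T_def)
      have "\<mu> * Re x \<ge> 1 * Re x" using \<mu> x by (intro mult_right_mono) (auto simp: Y_def)
      moreover have "\<bar>Re (s x) - (\<mu> * Re x + Re \<Lambda>)\<bar> \<le> 1/2"
        using b abs_Re_le_cmod[of "s x - (of_real \<mu> * x + \<Lambda>)"] by simp
      moreover have "Re x > S0 + norm \<Lambda> + 1" using x by (simp add: Y_def X2_def)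
      ultimately have "Re (s x) > S0" using abs_Re_le_cmod[of \<Lambda>] by linarith
      moreover have "\<bar>\<mu> * Im x\<bar> \<le> \<mu> * pi" using \<mu> x by (simp add: abs_mult)
      moreover have "\<bar>Im (s x) - (\<mu> * Im x + Im \<Lambda>)\<bar> \<le> 1/2"
        using b abs_Im_le_cmod[of "s x - (of_real \<mu> * x + \<Lambda>)"] by simp
      ultimately have "\<bar>Im (s x)\<bar> < B" using B abs_Im_le_cmod[of \<Lambda>] by linarith
      with \<open>Re (s x) > S0\<close> have "s x \<in> half_strip S0 B" by (simp add: half_strip_def)
      then show "\<exists>v \<in> half_strip S0 B. X v = x \<and> norm (v - (of_real \<mu> * x + \<Lambda>)) \<le> 1"
        using X(3)[OF xT] b by (intro bexI[of _ "s x"]) auto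
    qed
  qed
qed

text \<open>The region is invariant under translations to the right, which is the direction in which the
  perturbed oscillator is integrated below; it contains all directions up to an angle of 135 degrees.\<close>

definition rdom :: "real \<Rightarrow> complex set" where
  "rdom \<rho> = {v. \<rho> < Re v + \<bar>Im v\<bar>}"

text \<open>A branch \<open>Z\<close> of the inverse of the Liouville variable, with \<open>p\<close> playing the role of \<open>P\<^sup>1\<^sup>/\<^sup>4\<close>. The last
  clause says that the argument of the derivative of \<open>Z\<close> is nearly constant along the critical ray.\<close>

definition liouville_chart ::
  "complex poly \<Rightarrow> real \<Rightarrow> real \<Rightarrow> (complex \<Rightarrow> complex) \<Rightarrow> (complex \<Rightarrow> complex) \<Rightarrow> real \<Rightarrow> bool" where
  "liouville_chart P C \<rho> Z p \<theta> \<longleftrightarrow>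
     p holomorphic_on rdom \<rho> \<and>
     (\<forall>v\<in>rdom \<rho>. (Z has_field_derivative 1 / (p v)\<^sup>2) (at v) \<and> p v \<noteq> 0 \<and> p v ^ 4 = poly P (Z v) \<and>
        norm v powr (2 / (real (degree P) + 2)) \<le> C * norm (Z v) \<and>
        norm (Z v) \<le> C * norm v powr (2 / (real (degree P) + 2)) \<and>
        norm v powr (2 / (real (degree P) + 2) - 1) \<le> C * norm (1 / (p v)\<^sup>2) \<and>
        norm (1 / (p v)\<^sup>2) \<le> C * norm v powr (2 / (real (degree P) + 2) - 1)) \<and>
     (\<forall>B. \<exists>N. \<forall>v\<in>rdom \<rho>. Re v \<ge> N \<longrightarrow> \<bar>Im v\<bar> \<le> B \<longrightarrow>
        norm (1 / (p v)\<^sup>2) / 2 \<le> Re (cis \<theta> * (1 / (p v)\<^sup>2)))"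

section \<open>Charts covering a neighbourhood of infinity\<close>

lemma open_rdom: "open (rdom \<rho>)"
  unfolding rdom_def by (intro open_Collect_less continuous_intros)

lemma rdom_mono: "\<rho> \<le> \<rho>' \<Longrightarrow> rdom \<rho>' \<subseteq> rdom \<rho>"
  by (auto simp: rdom_def)

lemma rdom_norm: "v \<in> rdom \<rho> \<Longrightarrow> \<rho> / 2 < norm v"
  using abs_Re_le_cmod[of v] abs_Im_le_cmod[of v] by (auto simp: rdom_def)

lemma rdom_notin_nonpos: "\<rho> \<ge> 0 \<Longrightarrow> v \<in> rdom \<rho> \<Longrightarrow> v \<notin> \<real>\<^sub>\<le>\<^sub>0"
  by (auto simp: rdom_def complex_nonpos_Reals_iff)

lemma abs_Im_Ln_le:
  assumes "Re v > 0" "\<bar>Im v\<bar> \<le> e * Re v" "e < 1 / 2"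
  shows "\<bar>Im (Ln v)\<bar> \<le> 2 * e"
proof -
  define y where "y = Im v / Re v"
  have y: "\<bar>y\<bar> \<le> e" using assms by (simp add: y_def abs_divide divide_le_eq)
  have v: "v = of_real (Re v) * (1 + \<i> * of_real y)"
    using assms by (simp add: complex_eq_iff y_def)
  have "1 + \<i> * of_real y \<noteq> 0" by (auto simp: complex_eq_iff)
  then have "Ln v = of_real (ln (Re v)) + Ln (1 + \<i> * of_real y)"
    by (subst v, subst Ln_times_of_real) (use assms(1) in \<open>simp_all add: Ln_of_real\<close>)
  then have "\<bar>Im (Ln v)\<bar> \<le> norm (Ln (1 + \<i> * of_real y))" by (simp add: abs_Im_le_cmod)
  also have "\<dots> \<le> 2 * norm (\<i> * of_real y)" using y assms by (intro norm_Ln_le) (auto simp: norm_mult)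
  finally show ?thesis using y by (simp add: norm_mult)
qed

lemma cos_ge_half: "\<bar>x\<bar> \<le> 1 \<Longrightarrow> cos x \<ge> 1 / 2" for x :: real
proof -
  assume "\<bar>x\<bar> \<le> 1"
  moreover have "1 \<le> pi / 3" using pi_gt3 by simp
  ultimately have "cos (pi / 3) \<le> cos \<bar>x\<bar>" by (intro cos_monotone_0_pi_le) auto
  then show ?thesis by (simp add: cos_60)
qed

text \<open>The charts are inverse branches of the Liouville variable on planes turned by successive
  half-turns; a half-turn only changes the sign of \<zeta>, and the equation involves d\<zeta>^2
  alone. While z runs once around infinity, the imaginary part of ln \<zeta> stays bounded, so
  finitely many half-planes Re v \<ge> 0 suffice.\<close>

lemma liouville_charts_exist:
  fixes P :: "complex poly"
  assumes P: "P \<noteq> 0"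
  obtains J :: nat and Z p \<theta> C \<rho> r where
    "C > 0" "\<rho> \<ge> 1"
    "\<And>j. j < J \<Longrightarrow> liouville_chart P C \<rho> (Z j) (p j) (\<theta> j)"
    "\<And>z. norm z > r \<Longrightarrow> \<exists>j<J. \<exists>v \<in> rdom \<rho>. Re v \<ge> 0 \<and> Z j v = z"
proof -
  define \<mu> where "\<mu> = (real (degree P) + 2) / 2"
  define \<Lambda> where "\<Lambda> = Ln (csqrt (lead_coeff P) / of_real \<mu>)"
  have \<mu>: "\<mu> \<ge> 1" by (simp add: \<mu>_def)
  have \<mu>': "2 / (real (degree P) + 2) = 1 / \<mu>" by (simp add: \<mu>_def)
  \<comment> \<open>For arguments of z in [-pi, pi] the imaginary part of ln \<zeta> is at most
    \<mu> pi + |\<Lambda>| + 1, which bounds the number of half-turns; the added 1 covers the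
    rounding below.\<close>
  define J0 where "J0 = nat \<lceil>(\<mu> * pi + norm \<Lambda> + 1) / pi\<rceil> + 1"
  define B where "B = pi * (real J0 + 2) + \<mu> * pi + norm \<Lambda> + 3"
  have B: "B > \<mu> * pi + norm \<Lambda> + 2" unfolding B_def using pi_gt_zero by (smt (verit) mult_nonneg_nonneg of_nat_0_le_iff)
  obtain X S0 where X: "X holomorphic_on half_strip S0 B"
    "\<And>v. v \<in> half_strip S0 B \<Longrightarrow> exp (2 * v) = (deriv X v)\<^sup>2 * poly P (exp (X v)) * exp (2 * X v)"
    "\<And>\<delta>. \<delta> > 0 \<Longrightarrow> \<exists>S1 \<ge> S0. \<forall>v \<in> half_strip S1 B.
        norm (X v - (v - \<Lambda>) / of_real \<mu>) \<le> \<delta> \<and> norm (deriv X v - 1 / of_real \<mu>) \<le> \<delta>"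
    "\<exists>X1. \<forall>x. Re x > X1 \<and> \<bar>Im x\<bar> \<le> pi \<longrightarrow>
        (\<exists>v \<in> half_strip S0 B. X v = x \<and> norm (v - (of_real \<mu> * x + \<Lambda>)) \<le> 1)"
    by (rule log_chart[OF P, folded \<mu>_def, folded \<Lambda>_def, OF B]) (rule that; assumption)
  obtain S1 where S1: "S1 \<ge> S0" "\<And>v. v \<in> half_strip S1 B \<Longrightarrow>
        norm (X v - (v - \<Lambda>) / of_real \<mu>) \<le> 1 / (8 * \<mu>) \<and> norm (deriv X v - 1 / of_real \<mu>) \<le> 1 / (8 * \<mu>)"
    using X(3)[of "1 / (8 * \<mu>)"] \<mu> by auto
  define \<rho> where "\<rho> = 2 * exp (max S1 0) + 1"
  have \<rho>1: "\<rho> \<ge> 1" "\<rho> > 0" using exp_gt_zero[of "max S1 0"] by (auto simp: \<rho>_def simp del: exp_gt_zero)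
  have vb: "norm v > exp S1" "norm v \<ge> 1" "v \<noteq> 0" "v \<notin> \<real>\<^sub>\<le>\<^sub>0" if "v \<in> rdom \<rho>" for v
  proof -
    have *: "norm v > exp (max S1 0)" using rdom_norm[OF that] by (simp add: \<rho>_def)
    have "exp S1 \<le> exp (max S1 0)" "1 \<le> exp (max S1 0)" by auto
    then show "norm v > exp S1" "norm v \<ge> 1" using * by linarith+
    then show "v \<noteq> 0" by auto
    show "v \<notin> \<real>\<^sub>\<le>\<^sub>0" by (rule rdom_notin_nonpos[OF _ that]) (use \<rho>1 in auto)
  qed
  define L where "L j v = Ln v + \<i> * of_real pi * of_int j" for j :: int and v
  define Z where "Z j v = exp (X (L j v))" for j v
  \<comment> \<open>A logarithm of the derivative of \<open>Z j\<close>. It makes \<open>p\<close>,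
    the power -1/2 of that derivative, single-valued.\<close>
  define \<tau> where "\<tau> j v = X (L j v) + Ln (of_real \<mu> * deriv X (L j v)) - Ln v - of_real (ln \<mu>)" for j v
  define p where "p j v = exp (- \<tau> j v / 2)" for j v
  have psq: "1 / (p j v)\<^sup>2 = exp (\<tau> j v)" for j v
  proof -
    have "(p j v)\<^sup>2 = exp (2 * (- \<tau> j v / 2))" unfolding p_def by (rule exp_double[symmetric])
    also have "\<dots> = inverse (exp (\<tau> j v))" by (simp add: exp_minus)
    finally show ?thesis by (simp only: divide_inverse inverse_inverse_eq mult_1)
  qed
  \<comment> \<open>Minus the argument that the affine model of \<open>X\<close> predicts for the
    derivative of \<open>Z j\<close> on the ray, where Ln v has small imaginary part.\<close>
  define \<theta> where "\<theta> j = - (pi * of_int j - Im \<Lambda>) / \<mu>" for j :: int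
  define C where "C = exp (norm \<Lambda> + 1) * (2 * \<mu>)"
  have C: "C > 0" using \<mu> by (simp add: C_def)
  have LS: "L j v \<in> half_strip S1 B" if "v \<in> rdom \<rho>" "\<bar>j\<bar> \<le> int J0" for v j
  proof -
    have "Re (L j v) = ln (norm v)" using vb[OF that(1)] by (simp add: L_def)
    also have "\<dots> > S1" using vb[OF that(1)] by (metis exp_gt_zero ln_exp ln_less_cancel_iff order_less_trans)
    finally have 1: "Re (L j v) > S1" .
    have "\<bar>Im (L j v)\<bar> \<le> \<bar>Im (Ln v)\<bar> + \<bar>pi * of_int j\<bar>" by (simp add: L_def)
    also have "\<bar>Im (Ln v)\<bar> \<le> pi" using vb[OF that(1)] mpi_less_Im_Ln[of v] Im_Ln_le_pi[of v] by (simp add: abs_le_iff)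
    also have "\<bar>pi * of_int j\<bar> \<le> pi * real J0" 
      using that(2) by (simp add: abs_mult)
    also have "pi + pi * real J0 < B"
    proof -
      have "\<mu> * pi \<ge> 0" "pi * (real J0 + 2) = pi * real J0 + 2 * pi"
        using \<mu> by (simp_all add: algebra_simps)
      then show ?thesis unfolding B_def using pi_gt_zero norm_ge_zero[of \<Lambda>] by linarith
    qed
    finally show ?thesis using 1 by (simp add: half_strip_def)
  qed
  have LS0: "L j v \<in> half_strip S0 B" if "v \<in> rdom \<rho>" "\<bar>j\<bar> \<le> int J0" for v j
    using LS[OF that] S1(1) by (auto simp: half_strip_def)
  have dX: "(X has_field_derivative deriv X w) (at w)" if "w \<in> half_strip S0 B" for w
    using holomorphic_derivI[OF X(1) open_half_strip that] .
  have mX: "norm (of_real \<mu> * deriv X w - 1) \<le> 1 / 8" if "w \<in> half_strip S1 B" for w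
  proof -
    have "of_real \<mu> * deriv X w - 1 = of_real \<mu> * (deriv X w - 1 / of_real \<mu>)" using \<mu> by (simp add: field_simps)
    then have "norm (of_real \<mu> * deriv X w - 1) = \<mu> * norm (deriv X w - 1 / of_real \<mu>)"
      using \<mu> by (metis norm_mult norm_of_real abs_of_nonneg order_trans zero_le_one)
    also have "\<dots> \<le> \<mu> * (1 / (8 * \<mu>))" using S1(2)[OF that] \<mu> by (intro mult_left_mono) auto
    finally show ?thesis using \<mu> by simp
  qed
  have mXnz: "of_real \<mu> * deriv X w \<noteq> 0" "of_real \<mu> * deriv X w \<notin> \<real>\<^sub>\<le>\<^sub>0" "norm (deriv X w) \<le> 2 / \<mu>" "norm (deriv X w) \<ge> 1 / (2 * \<mu>)"
    if "w \<in> half_strip S1 B" for w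
  proof -
    have "\<bar>Re (of_real \<mu> * deriv X w - 1)\<bar> \<le> 1/8"
      using mX[OF that] abs_Re_le_cmod[of "of_real \<mu> * deriv X w - 1"] by linarith
    then have "Re (of_real \<mu> * deriv X w) > 0" unfolding minus_complex.sel one_complex.sel by linarith
    then show "of_real \<mu> * deriv X w \<noteq> 0" "of_real \<mu> * deriv X w \<notin> \<real>\<^sub>\<le>\<^sub>0"
      unfolding complex_nonpos_Reals_iff by force+
    have *: "norm (of_real \<mu> * deriv X w) = \<mu> * norm (deriv X w)" using \<mu> by (simp add: norm_mult)
    have "norm (of_real \<mu> * deriv X w) \<le> 2"  "norm (of_real \<mu> * deriv X w) \<ge> 1/2"
      using mX[OF that] norm_triangle_ineq2[of "of_real \<mu> * deriv X w" 1] norm_triangle_ineq2[of 1 "of_real \<mu> * deriv X w"]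
      by (simp_all add: norm_minus_commute)
    then show "norm (deriv X w) \<le> 2 / \<mu>" "norm (deriv X w) \<ge> 1 / (2 * \<mu>)" using \<mu> unfolding * by (simp_all add: field_simps)
  qed
  have chart: "liouville_chart P C \<rho> (Z j) (p j) (\<theta> j)" if j: "\<bar>j\<bar> \<le> int J0" for j
    unfolding liouville_chart_def \<mu>'
  proof (intro conjI ballI allI)
    have Lh: "L j holomorphic_on rdom \<rho>" unfolding L_def by (intro holomorphic_intros) (use vb in auto)
    have dXh: "deriv X holomorphic_on half_strip S0 B" by (intro holomorphic_deriv X open_half_strip)
    have XL: "(\<lambda>v. X (L j v)) holomorphic_on rdom \<rho>"
      using holomorphic_on_compose_gen[OF Lh X(1)] LS0[OF _ j] by (auto simp: o_def)
    have dXL: "(\<lambda>v. deriv X (L j v)) holomorphic_on rdom \<rho>"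
      using holomorphic_on_compose_gen[OF Lh dXh] LS0[OF _ j] by (auto simp: o_def)
    show "p j holomorphic_on rdom \<rho>" unfolding p_def \<tau>_def
      by (intro holomorphic_intros XL dXL) (use vb mXnz(2)[OF LS[OF _ j]] in auto)
  next
    fix v assume v: "v \<in> rdom \<rho>"
    note w = LS[OF v j] LS0[OF v j]
    have "exp (\<tau> j v) = exp (X (L j v)) * (of_real \<mu> * deriv X (L j v)) / v / of_real \<mu>"
      using mXnz(1)[OF w(1)] vb[OF v] \<mu> by (simp add: \<tau>_def exp_diff exp_add exp_of_real)
    then have exp\<tau>: "exp (\<tau> j v) = Z j v * deriv X (L j v) / v" using \<mu> by (simp add: Z_def)
    have p2: "1 / (p j v)\<^sup>2 = exp (\<tau> j v)" by (rule psq)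
    have "(L j has_field_derivative inverse v) (at v)"
      unfolding L_def using vb[OF v] by (auto intro!: derivative_eq_intros simp: divide_inverse)
    then have "((\<lambda>v. X (L j v)) has_field_derivative deriv X (L j v) * inverse v) (at v)"
      by (rule DERIV_chain2[where f = X and g = "L j", OF dX[OF w(2)]])
    then show "(Z j has_field_derivative 1 / (p j v)\<^sup>2) (at v)"
      unfolding p2 exp\<tau> Z_def by (auto intro!: derivative_eq_intros simp: divide_inverse)
    show p0: "p j v \<noteq> 0" by (simp add: p_def)
    have "exp (2 * L j v) = v\<^sup>2"
    proof -
      have "exp (2 * L j v) = exp (2 * Ln v) * exp ((2 * of_int j * of_real pi) * \<i>)"
        unfolding L_def by (simp only: exp_add[symmetric]) (simp add: algebra_simps)
      also have "exp ((2 * of_int j * of_real pi) * \<i>) = 1" using exp_integer_2pi[of "of_int j"] by simp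
      finally show ?thesis using vb[OF v] by (simp add: exp_double)
    qed
    then have v2: "v\<^sup>2 = (deriv X (L j v))\<^sup>2 * poly P (Z j v) * (Z j v)\<^sup>2"
      using X(2)[OF w(2)] by (simp add: Z_def exp_double)
    have nz: "Z j v \<noteq> 0" "deriv X (L j v) \<noteq> 0" "v \<noteq> 0"
      using mXnz(1)[OF w(1)] vb[OF v] by (auto simp: Z_def)
    have "1 / p j v ^ 4 = (1 / (p j v)\<^sup>2)\<^sup>2" by (simp add: power_divide)
    also have "\<dots> = (exp (\<tau> j v))\<^sup>2" by (simp only: p2)
    also have "\<dots> = (Z j v)\<^sup>2 * (deriv X (L j v))\<^sup>2 / v\<^sup>2" unfolding exp\<tau> by (simp add: power_mult_distrib power_divide)
    finally have "v\<^sup>2 = (Z j v)\<^sup>2 * (deriv X (L j v))\<^sup>2 * p j v ^ 4"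
      using nz p0 by (subst (asm) frac_eq_eq) auto
    then have "((Z j v)\<^sup>2 * (deriv X (L j v))\<^sup>2) * p j v ^ 4 = ((Z j v)\<^sup>2 * (deriv X (L j v))\<^sup>2) * poly P (Z j v)"
      unfolding v2 by (simp only: mult_ac)
    then show "p j v ^ 4 = poly P (Z j v)" using nz by simp
    have Xb: "norm (X (L j v) - (L j v - \<Lambda>) / of_real \<mu>) \<le> 1 / 8"
    proof -
      have "1 / (8 * \<mu>) \<le> 1 / 8" using \<mu> by (simp add: field_simps)
      then show ?thesis using S1(2)[OF w(1)] by linarith
    qed
    have ReL: "Re (L j v) = ln (norm v)" using vb[OF v] by (simp add: L_def)
    have "\<bar>Re (X (L j v)) - (ln (norm v) - Re \<Lambda>) / \<mu>\<bar> \<le> 1 / 8"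
      using Xb abs_Re_le_cmod[of "X (L j v) - (L j v - \<Lambda>) / of_real \<mu>"] by (simp add: ReL)
    moreover have "\<bar>Re \<Lambda> / \<mu>\<bar> \<le> norm \<Lambda>"
      using \<mu> abs_Re_le_cmod[of \<Lambda>] mult_left_mono[of 1 \<mu> "norm \<Lambda>"] by (simp add: abs_divide divide_le_eq mult.commute)
    ultimately have Rb: "\<bar>Re (X (L j v)) - ln (norm v) / \<mu>\<bar> \<le> norm \<Lambda> + 1"
      unfolding diff_divide_distrib by linarith
    have pw: "norm v powr (1 / \<mu>) = exp (ln (norm v) / \<mu>)" using vb[OF v] by (simp add: powr_def)
    define E where "E = exp (norm \<Lambda> + 1)"
    have E: "E > 0" by (simp add: E_def)
    have Zn: "norm (Z j v) = exp (Re (X (L j v)))" by (simp add: Z_def)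
    have Z1: "norm v powr (1 / \<mu>) \<le> E * norm (Z j v)" "norm (Z j v) \<le> E * norm v powr (1 / \<mu>)"
      unfolding pw Zn E_def exp_add[symmetric] exp_le_cancel_iff using Rb by linarith+
    have EC: "E \<le> C" unfolding C_def E_def[symmetric] using \<mu> E by simp
    show "norm v powr (1 / \<mu>) \<le> C * norm (Z j v)"
      using Z1(1) mult_right_mono[OF EC, of "norm (Z j v)"] by simp
    show "norm (Z j v) \<le> C * norm v powr (1 / \<mu>)"
      using Z1(2) mult_right_mono[OF EC, of "norm v powr (1 / \<mu>)"] by simp
    have np: "norm (1 / (p j v)\<^sup>2) = norm (Z j v) * norm (deriv X (L j v)) / norm v"
      unfolding p2 exp\<tau> by (simp add: norm_mult norm_divide)
    have pw2: "norm v powr (1 / \<mu> - 1) = norm v powr (1 / \<mu>) / norm v" using vb[OF v] by (simp add: powr_diff)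
    have nv: "norm v > 0" using vb[OF v] by simp
    have "norm v powr (1 / \<mu>) * (1 / (2 * \<mu>)) \<le> (E * norm (Z j v)) * norm (deriv X (L j v))"
      by (intro mult_mono Z1 mXnz(4) w) (use \<mu> E in auto)
    then have "norm v powr (1 / \<mu>) * (1 / (2 * \<mu>)) * (2 * \<mu>) \<le> (E * norm (Z j v)) * norm (deriv X (L j v)) * (2 * \<mu>)"
      using \<mu> by (intro mult_right_mono) auto
    then have "norm v powr (1 / \<mu>) \<le> C * (norm (Z j v) * norm (deriv X (L j v)))"
      using \<mu> unfolding C_def E_def[symmetric] by (simp add: mult_ac)
    then show "norm v powr (1 / \<mu> - 1) \<le> C * norm (1 / (p j v)\<^sup>2)"
      unfolding np pw2 using nv by (simp add: field_simps)
    have "norm (Z j v) * norm (deriv X (L j v)) \<le> (E * norm v powr (1 / \<mu>)) * (2 / \<mu>)"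
      by (intro mult_mono Z1 mXnz(3) w) (use \<mu> E in auto)
    also have "\<dots> \<le> (E * norm v powr (1 / \<mu>)) * (2 * \<mu>)"
    proof (intro mult_left_mono)
      have "\<mu> * \<mu> \<ge> 1 * 1" using \<mu> by (intro mult_mono) auto
      then show "2 / \<mu> \<le> 2 * \<mu>" using \<mu> by (simp add: field_simps)
    qed (use E in auto)
    finally have "norm (Z j v) * norm (deriv X (L j v)) \<le> C * norm v powr (1 / \<mu>)" 
      unfolding C_def E_def[symmetric] by (simp add: mult_ac)
    then show "norm (1 / (p j v)\<^sup>2) \<le> C * norm v powr (1 / \<mu> - 1)"
      unfolding np pw2 using nv by (simp add: divide_right_mono)
  next
    fix B' :: real
    show "\<exists>N. \<forall>v\<in>rdom \<rho>. Re v \<ge> N \<longrightarrow> \<bar>Im v\<bar> \<le> B' \<longrightarrow>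
        norm (1 / (p j v)\<^sup>2) / 2 \<le> Re (cis (\<theta> j) * (1 / (p j v)\<^sup>2))"
    \<comment> \<open>Far out, |Im v| is at most Re v / 16, so the argument of v contributes at most
      1/8. Together with the errors of the affine model the argument of the derivative stays within
      1 of -\<theta>, and the cosine is at least 1/2 there.\<close>
    proof (intro exI[of _ "16 * \<bar>B'\<bar> + 1"] ballI impI)
      fix v assume v: "v \<in> rdom \<rho>" "Re v \<ge> 16 * \<bar>B'\<bar> + 1" "\<bar>Im v\<bar> \<le> B'"
      note w = LS[OF v(1) j] LS0[OF v(1) j]
      have p2: "1 / (p j v)\<^sup>2 = exp (\<tau> j v)" by (rule psq)
      have ILn: "\<bar>Im (Ln v)\<bar> \<le> 2 * (1 / 16)" by (rule abs_Im_Ln_le) (use v in auto)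
      have "norm (X (L j v) - (L j v - \<Lambda>) / of_real \<mu>) \<le> 1 / 8"
      proof -
        have "1 / (8 * \<mu>) \<le> 1 / 8" using \<mu> by (simp add: field_simps)
        then show ?thesis using S1(2)[OF w(1)] by linarith
      qed
      then have "\<bar>Im (X (L j v)) - Im ((L j v - \<Lambda>) / of_real \<mu>)\<bar> \<le> 1 / 8"
        using abs_Im_le_cmod[of "X (L j v) - (L j v - \<Lambda>) / of_real \<mu>"] by simp
      moreover have "Im ((L j v - \<Lambda>) / of_real \<mu>) = Im (Ln v) / \<mu> - \<theta> j"
        by (simp add: L_def \<theta>_def algebra_simps diff_divide_distrib add_divide_distrib)
      moreover have "\<bar>Im (Ln v) / \<mu>\<bar> \<le> 1 / 8" 
        using ILn \<mu> mult_left_mono[of 1 \<mu> "1/8"] by (simp add: abs_divide divide_le_eq)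
      ultimately have 1: "\<bar>Im (X (L j v)) + \<theta> j\<bar> \<le> 1 / 4" by linarith
      have "norm (Ln (1 + (of_real \<mu> * deriv X (L j v) - 1))) \<le> 2 * norm (of_real \<mu> * deriv X (L j v) - 1)"
        by (rule norm_Ln_le) (use mX[OF w(1)] in simp)
      then have "\<bar>Im (Ln (of_real \<mu> * deriv X (L j v)))\<bar> \<le> 1 / 4"
        using mX[OF w(1)] abs_Im_le_cmod[of "Ln (of_real \<mu> * deriv X (L j v))"] by simp
      moreover have "Im (\<tau> j v) = Im (X (L j v)) + Im (Ln (of_real \<mu> * deriv X (L j v))) - Im (Ln v)"
        by (simp only: \<tau>_def plus_complex.sel minus_complex.sel Im_complex_of_real)
      ultimately have "\<bar>Im (\<tau> j v) + \<theta> j\<bar> \<le> 1" using 1 ILn by linarith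
      then have "cos (Im (\<tau> j v) + \<theta> j) \<ge> 1 / 2" by (rule cos_ge_half)
      then have "exp (Re (\<tau> j v)) * (1/2) \<le> exp (Re (\<tau> j v)) * cos (Im (\<tau> j v) + \<theta> j)"
        by (intro mult_left_mono) auto
      moreover have "Re (cis (\<theta> j) * exp (\<tau> j v)) = exp (Re (\<tau> j v)) * cos (Im (\<tau> j v) + \<theta> j)"
        by (simp add: exp_eq_polar cis_mult Re_exp cos_add algebra_simps)
      ultimately show "norm (1 / (p j v)\<^sup>2) / 2 \<le> Re (cis (\<theta> j) * (1 / (p j v)\<^sup>2))"
        unfolding p2 by simp
    qed
  qed
  obtain X1 where X1: "\<And>x. Re x > X1 \<Longrightarrow> \<bar>Im x\<bar> \<le> pi \<Longrightarrow>
        (\<exists>v \<in> half_strip S0 B. X v = x \<and> norm (v - (of_real \<mu> * x + \<Lambda>)) \<le> 1)"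
    using X(4) by blast
  define X2 where "X2 = max 0 (max X1 (ln \<rho> + norm \<Lambda> + 1))"
  have cover: "\<exists>j. \<bar>j\<bar> \<le> int J0 \<and> (\<exists>v \<in> rdom \<rho>. Re v \<ge> 0 \<and> Z j v = z)" if z: "norm z > exp X2" for z
  proof -
    define x where "x = Ln z"
    have z0: "z \<noteq> 0" using z exp_gt_zero[of X2] by auto
    have Rx: "Re x > X2" using z z0 by (simp add: x_def) (metis exp_gt_zero ln_exp ln_less_cancel_iff order_less_trans)
    have Ix: "\<bar>Im x\<bar> \<le> pi" using z0 mpi_less_Im_Ln[of z] Im_Ln_le_pi[of z] by (simp add: abs_le_iff x_def)
    obtain w where w: "w \<in> half_strip S0 B" "X w = x" "norm (w - (of_real \<mu> * x + \<Lambda>)) \<le> 1"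
      using X1[of x] Rx Ix by (auto simp: X2_def)
    have Iw: "\<bar>Im w\<bar> \<le> \<mu> * pi + norm \<Lambda> + 1"
    proof -
      have "\<bar>\<mu> * Im x\<bar> \<le> \<mu> * pi" using \<mu> Ix by (simp add: abs_mult)
      then show ?thesis
        using w(3) abs_Im_le_cmod[of "w - (of_real \<mu> * x + \<Lambda>)"] abs_Im_le_cmod[of \<Lambda>] by simp
    qed
    have Rw: "Re w > ln \<rho>"
    proof -
      have "\<mu> * Re x \<ge> 1 * Re x" using \<mu> Rx by (intro mult_right_mono) (auto simp: X2_def)
      moreover have "\<bar>Re w - (\<mu> * Re x + Re \<Lambda>)\<bar> \<le> 1"
        using w(3) abs_Re_le_cmod[of "w - (of_real \<mu> * x + \<Lambda>)"] by simp
      moreover have "Re x > ln \<rho> + norm \<Lambda> + 1" using Rx by (simp add: X2_def)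
      ultimately show ?thesis using abs_Re_le_cmod[of \<Lambda>] by linarith
    qed
    \<comment> \<open>Rounding to the nearest half-turn leaves an argument of at most pi/2 in
      absolute value, which is the condition Re v \<ge> 0.\<close>
    define j where "j = round (Im w / pi)"
    have jr: "\<bar>of_int j - Im w / pi\<bar> \<le> 1 / 2" unfolding j_def by (rule of_int_round_abs_le)
    have jJ: "\<bar>j\<bar> \<le> int J0"
    proof -
      have "\<bar>Im w / pi\<bar> \<le> (\<mu> * pi + norm \<Lambda> + 1) / pi" using Iw by (simp add: abs_divide divide_right_mono)
      then have "\<bar>real_of_int j\<bar> \<le> (\<mu> * pi + norm \<Lambda> + 1) / pi + 1 / 2" using jr by linarith
      also have "\<dots> \<le> real J0" unfolding J0_def by linarith
      finally show ?thesis by linarith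
    qed
    have Iwj: "\<bar>Im w - pi * of_int j\<bar> \<le> pi / 2"
    proof -
      have "Im w - pi * of_int j = - pi * (of_int j - Im w / pi)" by (simp add: field_simps)
      then have "\<bar>Im w - pi * of_int j\<bar> = pi * \<bar>of_int j - Im w / pi\<bar>" by (simp add: abs_mult)
      also have "\<dots> \<le> pi * (1 / 2)" by (intro mult_left_mono jr) auto
      finally show ?thesis by simp
    qed
    define u where "u = w - \<i> * of_real pi * of_int j"
    define v where "v = exp u"
    have u: "Re u = Re w" "Im u = Im w - pi * of_int j" by (simp_all add: u_def)
    have Iu: "\<bar>Im u\<bar> \<le> pi / 2" using Iwj unfolding u .
    have Lnv: "Ln v = u" unfolding v_def
      by (rule Ln_exp; use Iu pi_gt_zero in linarith)
    have "cos (Im u) \<ge> 0" by (intro cos_ge_zero; use Iu in linarith)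
    then have Rv: "Re v \<ge> 0" by (simp add: v_def Re_exp)
    have "exp (ln \<rho>) < exp (Re w)" using Rw by simp
    then have "norm v > \<rho>" using \<rho>1 u by (simp add: v_def)
    then have "v \<in> rdom \<rho>" using cmod_le[of v] Rv by (simp add: rdom_def)
    moreover have "Z j v = z"
    proof -
      have "L j v = w" by (simp add: L_def Lnv u_def)
      then show ?thesis using w(2) z0 by (simp add: Z_def x_def)
    qed
    ultimately show ?thesis using jJ Rv by blast
  qed
  show ?thesis
  proof (rule that[of C \<rho> "2 * J0 + 1" "\<lambda>j. Z (int j - int J0)" "\<lambda>j. p (int j - int J0)" "\<lambda>j. \<theta> (int j - int J0)" "exp X2"])
    show "liouville_chart P C \<rho> (Z (int j - int J0)) (p (int j - int J0)) (\<theta> (int j - int J0))"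
      if "j < 2 * J0 + 1" for j by (rule chart) (use that in auto)
    fix z :: complex assume "norm z > exp X2"
    then obtain j v where j: "\<bar>j\<bar> \<le> int J0" "v \<in> rdom \<rho>" "Re v \<ge> 0" "Z j v = z" using cover by blast
    then show "\<exists>j<2 * J0 + 1. \<exists>v\<in>rdom \<rho>. Re v \<ge> 0 \<and> Z (int j - int J0) v = z"
      by (intro exI[of _ "nat (j + int J0)"]) auto
  qed (use C \<rho>1 in auto)
qed

section \<open>Perturbed harmonic oscillators\<close>

lemma rdom_add_nonneg: "v \<in> rdom \<rho> \<Longrightarrow> t \<ge> 0 \<Longrightarrow> v + of_real t \<in> rdom \<rho>"
  by (auto simp: rdom_def)

text \<open>Variation of constants: \<open>y = a v e\<^sup>i\<^sup>v + b v e\<^sup>-\<^sup>i\<^sup>v\<close>, where the changes of \<open>a\<close> and \<open>b\<close> along a horizontal ray are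
  controlled by the integrable perturbation \<open>\<phi>\<close>, and both exponentials have constant modulus.\<close>

locale oscillator =
  fixes y \<phi> :: "complex \<Rightarrow> complex" and \<rho> K :: real
  assumes \<rho>: "\<rho> \<ge> 1" and K: "K > 0"
    and holo: "y holomorphic_on rdom \<rho>"
    and ode: "\<And>v. v \<in> rdom \<rho> \<Longrightarrow> deriv (deriv y) v = - (1 + \<phi> v) * y v"
    and \<phi>: "\<And>v. v \<in> rdom \<rho> \<Longrightarrow> norm (\<phi> v) \<le> K / (norm v)\<^sup>2"
begin

definition "a v = exp (- \<i> * v) * (y v - \<i> * deriv y v) / 2"
definition "b v = exp (\<i> * v) * (y v + \<i> * deriv y v) / 2"
text \<open>The weights depend on \<open>Im v\<close> only, hence are constant on a horizontal ray.
  Unlike |y| itself, this size is insensitive to cancellation between the two exponentials.\<close>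

definition "nrm v = norm (a v) * exp (- Im v) + norm (b v) * exp (Im v)"

lemma y_eq: "y v = a v * exp (\<i> * v) + b v * exp (- \<i> * v)"
proof -
  have "exp (\<i> * v) * exp (- \<i> * v) = 1" by (simp add: exp_add[symmetric])
  then show ?thesis unfolding a_def b_def by algebra
qed

lemma nrm_nonneg: "nrm v \<ge> 0" by (simp add: nrm_def)

lemma norm_y_le: "norm (y v) \<le> nrm v"
proof -
  have "norm (y v) \<le> norm (a v * exp (\<i> * v)) + norm (b v * exp (- \<i> * v))"
    unfolding y_eq[of v] by (rule norm_triangle_ineq)
  then show ?thesis by (simp add: nrm_def norm_mult)
qed

lemma dy: "v \<in> rdom \<rho> \<Longrightarrow> (y has_field_derivative deriv y v) (at v)"
  by (rule holomorphic_derivI[OF holo open_rdom])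

lemma ddy: "v \<in> rdom \<rho> \<Longrightarrow> (deriv y has_field_derivative - (1 + \<phi> v) * y v) (at v)"
  using holomorphic_derivI[OF holomorphic_deriv[OF holo open_rdom] open_rdom] ode by simp

lemma da:
  assumes "v \<in> rdom \<rho>"
  shows "(a has_field_derivative (\<i> / 2 * exp (- \<i> * v) * \<phi> v * y v)) (at v)"
proof -
  have "(a has_field_derivative (exp (- \<i> * v) * (- \<i>) * (y v - \<i> * deriv y v)
      + exp (- \<i> * v) * (deriv y v - \<i> * (- (1 + \<phi> v) * y v))) / 2) (at v)"
    unfolding a_def using dy[OF assms] ddy[OF assms] by (auto intro!: derivative_eq_intros)
  moreover have "exp (- \<i> * v) * (- \<i>) * (y v - \<i> * deriv y v)
      + exp (- \<i> * v) * (deriv y v - \<i> * (- (1 + \<phi> v) * y v)) = \<i> * exp (- \<i> * v) * \<phi> v * y v"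
    by (simp add: algebra_simps)
  ultimately show ?thesis by simp
qed

lemma db:
  assumes "v \<in> rdom \<rho>"
  shows "(b has_field_derivative (- \<i> / 2 * exp (\<i> * v) * \<phi> v * y v)) (at v)"
proof -
  have "(b has_field_derivative (exp (\<i> * v) * \<i> * (y v + \<i> * deriv y v)
      + exp (\<i> * v) * (deriv y v + \<i> * (- (1 + \<phi> v) * y v))) / 2) (at v)"
    unfolding b_def using dy[OF assms] ddy[OF assms] by (auto intro!: derivative_eq_intros)
  moreover have "exp (\<i> * v) * \<i> * (y v + \<i> * deriv y v)
      + exp (\<i> * v) * (deriv y v + \<i> * (- (1 + \<phi> v) * y v)) = - \<i> * exp (\<i> * v) * \<phi> v * y v"
    by (simp add: algebra_simps)
  ultimately show ?thesis by simp
qed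

lemma continuous_on_nrm: "S \<subseteq> rdom \<rho> \<Longrightarrow> continuous_on S nrm"
proof -
  assume S: "S \<subseteq> rdom \<rho>"
  have "continuous_on S a" "continuous_on S b"
    using S by (auto intro!: continuous_at_imp_continuous_on DERIV_isCont da db)
  then show ?thesis unfolding nrm_def by (intro continuous_intros)
qed

lemma \<phi>_le:
  assumes "v \<in> rdom \<rho>"
  shows "norm (\<phi> v) \<le> 4 * K / (Re v + \<bar>Im v\<bar>)\<^sup>2"
proof -
  have u: "0 < Re v + \<bar>Im v\<bar>" "(Re v + \<bar>Im v\<bar>) / 2 \<le> norm v"
    using assms \<rho> abs_Re_le_cmod[of v] abs_Im_le_cmod[of v] by (auto simp: rdom_def)
  have "norm (\<phi> v) \<le> K / (norm v)\<^sup>2" by (rule \<phi>[OF assms])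
  also have "\<dots> \<le> K / ((Re v + \<bar>Im v\<bar>) / 2)\<^sup>2"
    using u K by (intro divide_left_mono power_mono mult_pos_pos zero_less_power) auto
  finally show ?thesis using u(1) by (simp add: power_divide mult.commute)
qed

text \<open>After weighting, the derivatives of a and b are at most |\<phi>| |y| / 2, hence at most
  2KM/(u+x)^2, whose integral from s on is at most 2KM/(u+s).\<close>

lemma ray_increment:
  fixes v :: complex
  defines "u \<equiv> Re v + \<bar>Im v\<bar>"
  assumes v: "v \<in> rdom \<rho>" and st: "0 \<le> s" "s \<le> t"
    and M: "\<And>x. s \<le> x \<Longrightarrow> x \<le> t \<Longrightarrow> nrm (v + of_real x) \<le> M"
  shows "norm (a (v + of_real t) - a (v + of_real s)) * exp (- Im v) \<le> 2 * K * M / (u + s)"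
    and "norm (b (v + of_real t) - b (v + of_real s)) * exp (Im v) \<le> 2 * K * M / (u + s)"
proof -
  have u: "u > 0" using v \<rho> by (auto simp: rdom_def u_def)
  have M0: "M \<ge> 0" using M[of s] st nrm_nonneg order_trans by blast
  have *: "norm (g (v + of_real t) - g (v + of_real s)) * E \<le> 2 * K * M / (u + s)"
    if g: "\<And>w. w \<in> rdom \<rho> \<Longrightarrow> (g has_field_derivative g' w) (at w)"
      and g': "\<And>x. norm (g' (v + of_real x)) * E \<le> norm (\<phi> (v + of_real x)) * norm (y (v + of_real x)) / 2"
      and E: "E > 0" for g g' E
  proof -
    have b: "norm (g (v + of_real t) - g (v + of_real s)) \<le>
        - (2 * K * M / E) / (u + t) - (- (2 * K * M / E) / (u + s))"
    proof (cases "s = t")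
      case False
      show ?thesis
      proof (rule differentiable_bound_general[where f = "\<lambda>x. g (v + of_real x)" and f' = "\<lambda>x. g' (v + of_real x)"
           and \<phi> = "\<lambda>x. - (2 * K * M / E) / (u + x)" and \<phi>' = "\<lambda>x. (2 * K * M / E) / (u + x)\<^sup>2"])
      show "s < t" using False st by simp
      have gv: "((\<lambda>x. g (v + of_real x)) has_vector_derivative g' (v + of_real x)) (at x)" if "x \<ge> 0" for x
      proof -
        have "((\<lambda>x. v + of_real x) has_vector_derivative 1) (at x)"
          unfolding has_vector_derivative_def by (auto intro!: derivative_eq_intros simp: scaleR_conv_of_real)
        from field_vector_diff_chain_at[OF this g[OF rdom_add_nonneg[OF v that]]]
        show ?thesis by (simp add: o_def)
      qed
      show "continuous_on {s..t} (\<lambda>x. g (v + of_real x))"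
        using st by (intro continuous_at_imp_continuous_on ballI) (auto intro!: has_vector_derivative_continuous[OF gv])
      have dd: "((\<lambda>x. - (2 * K * M / E) / (u + x)) has_field_derivative (2 * K * M / E) / (u + x)\<^sup>2) (at x)" if "x \<ge> 0" for x
        using u that E by (auto intro!: derivative_eq_intros simp: power2_eq_square mult_ac)
      show "continuous_on {s..t} (\<lambda>x. - (2 * K * M / E) / (u + x))"
        using st by (intro continuous_at_imp_continuous_on ballI DERIV_isCont[OF dd]) auto
      show "((\<lambda>x. g (v + of_real x)) has_vector_derivative g' (v + of_real x)) (at x)" if "s < x" "x < t" for x
        using gv st that by simp
      show "((\<lambda>x. - (2 * K * M / E) / (u + x)) has_vector_derivative (2 * K * M / E) / (u + x)\<^sup>2) (at x)" if "s < x" "x < t" for x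
        using dd[of x] st that by (simp add: has_real_derivative_iff_has_vector_derivative)
      show "norm (g' (v + of_real x)) \<le> (2 * K * M / E) / (u + x)\<^sup>2" if x: "s < x" "x < t" for x
      proof -
        have vx: "v + of_real x \<in> rdom \<rho>" by (rule rdom_add_nonneg[OF v]) (use st x in auto)
        have "norm (g' (v + of_real x)) * E \<le> norm (\<phi> (v + of_real x)) * norm (y (v + of_real x)) / 2" by (rule g')
        also have "\<dots> \<le> (4 * K / (Re (v + of_real x) + \<bar>Im (v + of_real x)\<bar>)\<^sup>2) * M / 2"
        proof (intro divide_right_mono mult_mono \<phi>_le vx)
          show "norm (y (v + of_real x)) \<le> M" using norm_y_le M[of x] x by (meson less_imp_le order_trans)
        qed (use K in auto)
        also have "Re (v + of_real x) + \<bar>Im (v + of_real x)\<bar> = u + x" by (simp add: u_def)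
        finally have "norm (g' (v + of_real x)) * E \<le> 2 * K * M / (u + x)\<^sup>2" by simp
        then have "norm (g' (v + of_real x)) \<le> 2 * K * M / (u + x)\<^sup>2 / E"
          using E by (simp only: pos_le_divide_eq)
        then show ?thesis by (simp add: mult.commute)
      qed
      qed
    qed simp
    have "2 * K * M / E / (u + t) \<ge> 0" using u K M0 E st by simp
    then have "norm (g (v + of_real t) - g (v + of_real s)) \<le> (2 * K * M / E) / (u + s)" using b by simp
    then have "norm (g (v + of_real t) - g (v + of_real s)) * E \<le> (2 * K * M / E) / (u + s) * E"
      using E by (intro mult_right_mono) auto
    also have "\<dots> = 2 * K * M / (u + s)" using E by simp
    finally show ?thesis .
  qed
  show "norm (a (v + of_real t) - a (v + of_real s)) * exp (- Im v) \<le> 2 * K * M / (u + s)"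
  proof (rule *[OF da])
    fix x
    have "norm (\<i> / 2 * exp (- \<i> * (v + of_real x)) * \<phi> (v + of_real x) * y (v + of_real x)) = exp (Im v) * norm (\<phi> (v + of_real x)) * norm (y (v + of_real x)) / 2"
      by (simp add: norm_mult)
    then show "norm (\<i> / 2 * exp (- \<i> * (v + of_real x)) * \<phi> (v + of_real x) * y (v + of_real x)) * exp (- Im v) \<le> norm (\<phi> (v + of_real x)) * norm (y (v + of_real x)) / 2"
      by (simp add: exp_minus field_simps)
  qed simp_all
  show "norm (b (v + of_real t) - b (v + of_real s)) * exp (Im v) \<le> 2 * K * M / (u + s)"
  proof (rule *[OF db])
    fix x
    have "norm (- \<i> / 2 * exp (\<i> * (v + of_real x)) * \<phi> (v + of_real x) * y (v + of_real x)) = exp (- Im v) * norm (\<phi> (v + of_real x)) * norm (y (v + of_real x)) / 2"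
      by (simp add: norm_mult)
    then show "norm (- \<i> / 2 * exp (\<i> * (v + of_real x)) * \<phi> (v + of_real x) * y (v + of_real x)) * exp (Im v) \<le> norm (\<phi> (v + of_real x)) * norm (y (v + of_real x)) / 2"
      by (simp add: exp_minus field_simps)
  qed simp_all
qed

lemma nrm_increment:
  assumes "Im w = Im v" "norm (a w - a v) * exp (- Im v) \<le> c" "norm (b w - b v) * exp (Im v) \<le> c"
  shows "\<bar>nrm w - nrm v\<bar> \<le> 2 * c"
proof -
  have "\<bar>norm (a w) - norm (a v)\<bar> * exp (- Im v) \<le> norm (a w - a v) * exp (- Im v)"
       "\<bar>norm (b w) - norm (b v)\<bar> * exp (Im v) \<le> norm (b w - b v) * exp (Im v)"
    by (intro mult_right_mono norm_triangle_ineq3; simp)+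
  then have "\<bar>(norm (a w) - norm (a v)) * exp (- Im v)\<bar> \<le> c" "\<bar>(norm (b w) - norm (b v)) * exp (Im v)\<bar> \<le> c"
    using assms unfolding abs_mult abs_exp_cancel by linarith+
  then show ?thesis unfolding nrm_def assms(1) left_diff_distrib by linarith
qed

text \<open>A bootstrap at the maximum M of \<open>nrm\<close> on the segment: once u \<ge> 8K,
  \<open>nrm\<close> changes by at most M/2 between the maximum and either end, so M is at most
  twice the value at each end. The last two bounds are expressed by the far end, so that in the
  limit of large T their right-hand sides contain the limiting coefficients.\<close>

lemma ray_bounds:
  fixes v :: complex
  defines "u \<equiv> Re v + \<bar>Im v\<bar>"
  assumes v: "v \<in> rdom \<rho>" and u: "u \<ge> 8 * K" and T: "T \<ge> 0"
  shows "nrm (v + of_real T) \<le> 2 * nrm v"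
    and "norm (a (v + of_real T) - a v) * exp (- Im v) \<le> 4 * K / u * nrm (v + of_real T)"
    and "norm (b (v + of_real T) - b v) * exp (Im v) \<le> 4 * K / u * nrm (v + of_real T)"
proof -
  have u0: "u > 0" using u K by linarith
  have "continuous_on {0..T} (\<lambda>x. nrm (v + of_real x))"
    by (rule continuous_on_compose2[OF continuous_on_nrm[of "(\<lambda>x. v + of_real x) ` {0..T}"]])
       (use rdom_add_nonneg[OF v] in \<open>auto intro!: continuous_intros\<close>)
  then obtain x where x: "x \<in> {0..T}" "\<And>z. z \<in> {0..T} \<Longrightarrow> nrm (v + of_real z) \<le> nrm (v + of_real x)"
    using continuous_attains_sup[of "{0..T}" "\<lambda>x. nrm (v + of_real x)"] T by (metis atLeastatMost_empty_iff compact_Icc linorder_not_le)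
  define M where "M = nrm (v + of_real x)"
  have M: "nrm (v + of_real z) \<le> M" if "0 \<le> z" "z \<le> T" for z using x(2)[of z] that by (simp add: M_def)
  have M0: "M \<ge> 0" by (simp add: M_def nrm_nonneg)
  have small: "2 * K * M / (u + s) \<le> M / 4" if "s \<ge> 0" for s
  proof -
    have "8 * K * M \<le> (u + s) * M" using u that M0 by (intro mult_right_mono) auto
    then show ?thesis using u0 that by (simp add: divide_le_eq mult_ac)
  qed
  have x0: "0 \<le> x" "x \<le> T" using x by auto
  have "norm (a (v + of_real x) - a (v + of_real 0)) * exp (- Im v) \<le> M / 4"
    using ray_increment(1)[OF v order_refl x0(1), of M] M x0 small[of 0] by (fastforce simp: u_def)
  moreover have "norm (b (v + of_real x) - b (v + of_real 0)) * exp (Im v) \<le> M / 4"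
    using ray_increment(2)[OF v order_refl x0(1), of M] M x0 small[of 0] by (fastforce simp: u_def)
  ultimately have "\<bar>nrm (v + of_real x) - nrm v\<bar> \<le> 2 * (M / 4)" by (intro nrm_increment) auto
  then have "M \<le> 2 * nrm v" unfolding M_def by linarith
  then show "nrm (v + of_real T) \<le> 2 * nrm v" using M[of T] T by simp
  have "norm (a (v + of_real T) - a (v + of_real x)) * exp (- Im v) \<le> M / 4"
    using ray_increment(1)[OF v x0, of M] M x0 small[of x] by (fastforce simp: u_def)
  moreover have "norm (b (v + of_real T) - b (v + of_real x)) * exp (Im v) \<le> M / 4"
    using ray_increment(2)[OF v x0, of M] M x0 small[of x] by (fastforce simp: u_def)
  ultimately have "\<bar>nrm (v + of_real T) - nrm (v + of_real x)\<bar> \<le> 2 * (M / 4)" by (intro nrm_increment) auto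
  then have MT: "M \<le> 2 * nrm (v + of_real T)" unfolding M_def by linarith
  have "2 * K * M / u \<le> 2 * K * (2 * nrm (v + of_real T)) / u"
    using MT K u0 by (intro divide_right_mono mult_left_mono) auto
  then have c: "2 * K * M / u \<le> 4 * K / u * nrm (v + of_real T)" by simp
  show "norm (a (v + of_real T) - a v) * exp (- Im v) \<le> 4 * K / u * nrm (v + of_real T)"
    using ray_increment(1)[OF v order_refl T, of M] M c by (fastforce simp: u_def)
  show "norm (b (v + of_real T) - b v) * exp (Im v) \<le> 4 * K / u * nrm (v + of_real T)"
    using ray_increment(2)[OF v order_refl T, of M] M c by (fastforce simp: u_def)
qed

lemma limits_exist:
  obtains A B where "\<And>v. v \<in> rdom \<rho> \<Longrightarrow> (\<lambda>n. a (v + of_nat n)) \<longlonglongrightarrow> A"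
    "\<And>v. v \<in> rdom \<rho> \<Longrightarrow> (\<lambda>n. b (v + of_nat n)) \<longlonglongrightarrow> B"
proof -
  define R where "R = max \<rho> (8 * K) + 1"
  have R: "R > 0" using \<rho> by (simp add: R_def)
  have RD: "v \<in> rdom \<rho>" "Re v + \<bar>Im v\<bar> \<ge> 8 * K" "Re v + \<bar>Im v\<bar> > 0" if "Re v \<ge> R" for v
    using that \<rho> by (auto simp: R_def rdom_def)
  have conv: "convergent (\<lambda>n. g (of_real R + of_nat n))"
    if g: "\<And>v T. Re v \<ge> R \<Longrightarrow> Im v = 0 \<Longrightarrow> T \<ge> 0 \<Longrightarrow>
        norm (g (v + of_real T) - g v) \<le> 4 * K / (Re v + \<bar>Im v\<bar>) * nrm (v + of_real T)"
    for g :: "complex \<Rightarrow> complex"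
  proof -
    define N where "N = nrm (of_real R)"
    have Nb: "nrm (of_real R + of_nat n) \<le> 2 * N" for n
      using ray_bounds(1)[of "of_real R" "of_nat n"] RD[of "of_real R"] by (simp add: N_def)
    have step: "norm (g (of_real R + of_nat n) - g (of_real R + of_nat m)) \<le> (8 * K * N) / real (Suc m)" if "m \<le> n" for m n
    proof -
      have "norm (g (of_real R + of_nat m + of_real (real (n - m))) - g (of_real R + of_nat m)) \<le>
         4 * K / (Re (of_real R + of_nat m) + \<bar>Im (of_real R + of_nat m)\<bar>) * nrm (of_real R + of_nat m + of_real (real (n - m)))"
        by (rule g) (use R in auto)
      moreover have "of_real R + of_nat m + of_real (real (n - m)) = (of_real R + of_nat n :: complex)"
        using that by (simp add: of_nat_diff)
      ultimately have "norm (g (of_real R + of_nat n) - g (of_real R + of_nat m)) \<le>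
         4 * K / (Re (of_real R + of_nat m) + \<bar>Im (of_real R + of_nat m)\<bar>) * nrm (of_real R + of_nat n)"
        by (simp only:)
      then have "norm (g (of_real R + of_nat n) - g (of_real R + of_nat m)) \<le>
          4 * K / (R + real m) * nrm (of_real R + of_nat n)" by simp
      also have "\<dots> \<le> 4 * K / real (Suc m) * (2 * N)"
        using \<rho> K by (intro mult_mono divide_left_mono Nb nrm_nonneg) (auto simp: R_def N_def nrm_nonneg)
      finally show ?thesis by simp
    qed
    have "Cauchy (\<lambda>n. g (of_real R + of_nat n))"
    proof (rule metric_CauchyI)
      fix e :: real assume e: "e > 0"
      have "(\<lambda>m. (8 * K * N) / real (Suc m)) \<longlonglongrightarrow> 0"
        by (rule LIMSEQ_Suc[OF lim_const_over_n])
      then have "eventually (\<lambda>m. (8 * K * N) / real (Suc m) < e / 2) sequentially"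
        using e by (intro order_tendstoD) auto
      then obtain m where m: "(8 * K * N) / real (Suc m) < e / 2"
        unfolding eventually_sequentially by blast
      show "\<exists>M. \<forall>m\<ge>M. \<forall>n\<ge>M. dist (g (of_real R + of_nat m)) (g (of_real R + of_nat n)) < e"
      proof (intro exI[of _ m] allI impI)
        fix i j assume ij: "m \<le> i" "m \<le> j"
        have "dist (g (of_real R + of_nat i)) (g (of_real R + of_nat m)) < e / 2"
             "dist (g (of_real R + of_nat j)) (g (of_real R + of_nat m)) < e / 2"
          using step[OF ij(1)] step[OF ij(2)] m unfolding dist_norm by linarith+
        then show "dist (g (of_real R + of_nat i)) (g (of_real R + of_nat j)) < e"
          by (rule dist_triangle_half_l)
      qed
    qed
    then show ?thesis by (rule Cauchy_convergent)
  qed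
  have "convergent (\<lambda>n. a (of_real R + of_nat n))"
  proof (rule conv)
    fix v T assume "Re v \<ge> R" "Im v = 0" "(T::real) \<ge> 0"
    then show "norm (a (v + of_real T) - a v) \<le> 4 * K / (Re v + \<bar>Im v\<bar>) * nrm (v + of_real T)"
      using ray_bounds(2)[OF RD(1,2)[of v], of T] by simp
  qed
  then obtain A where A: "(\<lambda>n. a (of_real R + of_nat n)) \<longlonglongrightarrow> A" by (auto simp: convergent_def)
  have "convergent (\<lambda>n. b (of_real R + of_nat n))"
  proof (rule conv)
    fix v T assume "Re v \<ge> R" "Im v = 0" "(T::real) \<ge> 0"
    then show "norm (b (v + of_real T) - b v) \<le> 4 * K / (Re v + \<bar>Im v\<bar>) * nrm (v + of_real T)"
      using ray_bounds(3)[OF RD(1,2)[of v], of T] by simp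
  qed
  then obtain B where B: "(\<lambda>n. b (of_real R + of_nat n)) \<longlonglongrightarrow> B" by (auto simp: convergent_def)
  \<comment> \<open>The limits do not depend on the starting point: at z + k the derivatives of a
    and b are O(1/k^2), uniformly for z on a segment, so the difference between two parallel rays
    disappears.\<close>
  have indep: "(\<lambda>n. g (v + of_nat n)) \<longlonglongrightarrow> l"
    if v: "v \<in> rdom \<rho>" and l: "(\<lambda>n. g (of_real R + of_nat n)) \<longlonglongrightarrow> l"
      and g: "\<And>w. w \<in> rdom \<rho> \<Longrightarrow> (g has_field_derivative g' w) (at w)"
      and g': "\<And>w. norm (g' w) \<le> exp \<bar>Im w\<bar> * norm (\<phi> w) * norm (y w)"
    for v l and g g' :: "complex \<Rightarrow> complex"
  proof -
    define n0 where "n0 = nat \<lceil>R + \<bar>Re v\<bar>\<rceil>"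
    have n0: "Re v + real n0 \<ge> R" unfolding n0_def by linarith
    define w1 where "w1 = v + of_nat n0"
    define w2 where "w2 = (of_real R + of_nat n0 :: complex)"
    have Rw: "Re w1 \<ge> R" "Re w2 \<ge> R" using n0 by (auto simp: w1_def w2_def)
    have seg: "Re z \<ge> R" if "z \<in> closed_segment w1 w2" for z
      using that convex_halfspace_Re_ge[of R] Rw closed_segment_subset[of w1 "{x. Re x \<ge> R}" w2] by auto
    have "continuous_on (closed_segment w1 w2) nrm"
      by (rule continuous_on_nrm) (use seg RD in blast)
    then obtain N where N: "\<And>z. z \<in> closed_segment w1 w2 \<Longrightarrow> nrm z \<le> N"
      using continuous_attains_sup[of "closed_segment w1 w2" nrm] by auto
    have N0: "N \<ge> 0" using N[of w1] nrm_nonneg[of w1] by simp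
    obtain I where I: "\<And>z. z \<in> closed_segment w1 w2 \<Longrightarrow> \<bar>Im z\<bar> \<le> I"
      using bounded_closed_segment[of w1 w2] unfolding bounded_iff by (meson abs_Im_le_cmod order_trans)
    have gd: "norm (g' (z + of_nat k)) \<le> exp I * (4 * K) * (2 * N) / (real (Suc k))\<^sup>2"
      if z: "z \<in> closed_segment w1 w2" for z k
    proof -
      have Rz: "Re (z + of_nat k) \<ge> R" "Re z \<ge> R" using seg[OF z] by auto
      have "norm (g' (z + of_nat k)) \<le> exp \<bar>Im (z + of_nat k)\<bar> * norm (\<phi> (z + of_nat k)) * norm (y (z + of_nat k))"
        by (rule g')
      also have "\<dots> \<le> exp I * (4 * K / (real (Suc k))\<^sup>2) * (2 * N)"
      proof (intro mult_mono)
        show "exp \<bar>Im (z + of_nat k)\<bar> \<le> exp I" using I[OF z] by simp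
        have "norm (\<phi> (z + of_nat k)) \<le> 4 * K / (Re (z + of_nat k) + \<bar>Im (z + of_nat k)\<bar>)\<^sup>2"
          by (rule \<phi>_le[OF RD(1)[OF Rz(1)]])
        also have "\<dots> \<le> 4 * K / (real (Suc k))\<^sup>2"
          using Rz(2) K \<rho> by (intro divide_left_mono power_mono mult_pos_pos zero_less_power) (auto simp: R_def)
        finally show "norm (\<phi> (z + of_nat k)) \<le> 4 * K / (real (Suc k))\<^sup>2" .
        have "norm (y (z + of_nat k)) \<le> nrm (z + of_nat k)" by (rule norm_y_le)
        also have "\<dots> \<le> 2 * nrm z" using ray_bounds(1)[of z "of_nat k"] RD[OF Rz(2)] by simp
        finally show "norm (y (z + of_nat k)) \<le> 2 * N" using N[OF z] by linarith
      qed (use K N0 in auto)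
      finally show ?thesis by simp
    qed
    have diff: "norm (g (w1 + of_nat k) - g (w2 + of_nat k)) \<le> exp I * (4 * K) * (2 * N) / (real (Suc k))\<^sup>2 * norm (w1 - w2)" for k
    proof (rule field_differentiable_bound[where S = "closed_segment w1 w2" and f = "\<lambda>z. g (z + of_nat k)" and f' = "\<lambda>z. g' (z + of_nat k)"])
      fix z assume z: "z \<in> closed_segment w1 w2"
      have "z + of_nat k \<in> rdom \<rho>" using rdom_add_nonneg[OF RD(1)[OF seg[OF z]], of "of_nat k"] by simp
      then have "((\<lambda>z. g (z + of_nat k)) has_field_derivative g' (z + of_nat k)) (at z)"
        using g DERIV_shift by blast
      then show "((\<lambda>z. g (z + of_nat k)) has_field_derivative g' (z + of_nat k)) (at z within closed_segment w1 w2)"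
        by (rule has_field_derivative_at_within)
    qed (use gd in auto)
    have "(\<lambda>k. exp I * (4 * K) * (2 * N) / (real (Suc k))\<^sup>2 * norm (w1 - w2)) \<longlonglongrightarrow> 0"
      by real_asymp
    then have "(\<lambda>k. g (w1 + of_nat k) - g (w2 + of_nat k)) \<longlonglongrightarrow> 0"
      by (rule Lim_null_comparison[rotated]) (use diff in auto)
    moreover have "(\<lambda>k. g (w2 + of_nat k)) \<longlonglongrightarrow> l"
      using LIMSEQ_ignore_initial_segment[OF l, of n0] by (simp add: w2_def add_ac)
    ultimately have "(\<lambda>k. (g (w1 + of_nat k) - g (w2 + of_nat k)) + g (w2 + of_nat k)) \<longlonglongrightarrow> 0 + l"
      by (rule tendsto_add)
    then have "(\<lambda>k. g (v + of_nat (k + n0))) \<longlonglongrightarrow> l" by (simp add: w1_def add_ac)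
    then show ?thesis by (rule LIMSEQ_offset)
  qed
  show ?thesis
  proof (rule that[of A B])
    fix v assume v: "v \<in> rdom \<rho>"
    have half: "e * \<phi>' * y' / 2 \<le> E * \<phi>' * y'" if "0 \<le> e" "e \<le> E" "\<phi>' \<ge> 0" "y' \<ge> 0" for e \<phi>' y' E :: real
    proof -
      have "e * \<phi>' * y' / 2 \<le> e * \<phi>' * y'" using that by simp
      also have "\<dots> \<le> E * \<phi>' * y'" using that by (intro mult_right_mono) auto
      finally show ?thesis .
    qed
    show "(\<lambda>n. a (v + of_nat n)) \<longlonglongrightarrow> A"
    proof (rule indep[OF v A da])
      fix w
      have "norm (\<i> / 2 * exp (- \<i> * w) * \<phi> w * y w) = exp (Im w) * norm (\<phi> w) * norm (y w) / 2"
        by (simp add: norm_mult)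
      also have "\<dots> \<le> exp \<bar>Im w\<bar> * norm (\<phi> w) * norm (y w)" by (rule half) auto
      finally show "norm (\<i> / 2 * exp (- \<i> * w) * \<phi> w * y w) \<le> exp \<bar>Im w\<bar> * norm (\<phi> w) * norm (y w)" .
    qed
    show "(\<lambda>n. b (v + of_nat n)) \<longlonglongrightarrow> B"
    proof (rule indep[OF v B db])
      fix w
      have "norm (- \<i> / 2 * exp (\<i> * w) * \<phi> w * y w) = exp (- Im w) * norm (\<phi> w) * norm (y w) / 2"
        by (simp add: norm_mult)
      also have "\<dots> \<le> exp \<bar>Im w\<bar> * norm (\<phi> w) * norm (y w)" by (rule half) auto
      finally show "norm (- \<i> / 2 * exp (\<i> * w) * \<phi> w * y w) \<le> exp \<bar>Im w\<bar> * norm (\<phi> w) * norm (y w)" .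
    qed
  qed
qed

text \<open>The bounds at the far end of a ray pass to the limit. The resulting error is relative to
  the weighted limiting coefficients: it is small compared with the larger exponential for every
  imaginary part, and a vanishing coefficient contributes nothing to it.\<close>

lemma asymptotics:
  obtains A B where "\<And>v. v \<in> rdom \<rho> \<Longrightarrow> (\<lambda>n. a (v + of_nat n)) \<longlonglongrightarrow> A"
    "\<And>v. v \<in> rdom \<rho> \<Longrightarrow> (\<lambda>n. b (v + of_nat n)) \<longlonglongrightarrow> B"
    "\<And>v. v \<in> rdom \<rho> \<Longrightarrow> Re v + \<bar>Im v\<bar> \<ge> 8 * K \<Longrightarrow>
       norm (y v - (A * exp (\<i> * v) + B * exp (- \<i> * v))) \<le>
         8 * K / (Re v + \<bar>Im v\<bar>) * (norm A * exp (- Im v) + norm B * exp (Im v))"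
proof -
  obtain A B where AB: "\<And>v. v \<in> rdom \<rho> \<Longrightarrow> (\<lambda>n. a (v + of_nat n)) \<longlonglongrightarrow> A"
    "\<And>v. v \<in> rdom \<rho> \<Longrightarrow> (\<lambda>n. b (v + of_nat n)) \<longlonglongrightarrow> B"
    using limits_exist by blast
  show ?thesis
  proof (rule that[OF AB])
    fix v assume v: "v \<in> rdom \<rho>" "Re v + \<bar>Im v\<bar> \<ge> 8 * K"
    define nI where "nI = norm A * exp (- Im v) + norm B * exp (Im v)"
    define c where "c = 4 * K / (Re v + \<bar>Im v\<bar>)"
    have "(\<lambda>n. norm (a (v + of_nat n)) * exp (- Im v) + norm (b (v + of_nat n)) * exp (Im v)) \<longlonglongrightarrow> nI"
      unfolding nI_def by (intro tendsto_intros AB v)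
    then have nl: "(\<lambda>n. c * nrm (v + of_nat n)) \<longlonglongrightarrow> c * nI"
      unfolding nrm_def by (intro tendsto_intros) simp
    have "norm (A - a v) * exp (- Im v) \<le> c * nI"
    proof (rule tendsto_le[OF _ nl])
      show "(\<lambda>n. norm (a (v + of_nat n) - a v) * exp (- Im v)) \<longlonglongrightarrow> norm (A - a v) * exp (- Im v)"
        by (intro tendsto_intros AB v)
      show "\<forall>\<^sub>F n in sequentially. norm (a (v + of_nat n) - a v) * exp (- Im v) \<le> c * nrm (v + of_nat n)"
        using ray_bounds(2)[OF v, of "of_nat _"] by (intro always_eventually allI) (simp add: c_def)
    qed auto
    moreover have "norm (B - b v) * exp (Im v) \<le> c * nI"
    proof (rule tendsto_le[OF _ nl])
      show "(\<lambda>n. norm (b (v + of_nat n) - b v) * exp (Im v)) \<longlonglongrightarrow> norm (B - b v) * exp (Im v)"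
        by (intro tendsto_intros AB v)
      show "\<forall>\<^sub>F n in sequentially. norm (b (v + of_nat n) - b v) * exp (Im v) \<le> c * nrm (v + of_nat n)"
        using ray_bounds(3)[OF v, of "of_nat _"] by (intro always_eventually allI) (simp add: c_def)
    qed auto
    moreover have "norm (y v - (A * exp (\<i> * v) + B * exp (- \<i> * v))) \<le>
        norm (A - a v) * exp (- Im v) + norm (B - b v) * exp (Im v)"
    proof -
      have "y v - (A * exp (\<i> * v) + B * exp (- \<i> * v)) = (a v - A) * exp (\<i> * v) + (b v - B) * exp (- \<i> * v)"
        unfolding y_eq[of v] by (simp add: algebra_simps)
      then have "norm (y v - (A * exp (\<i> * v) + B * exp (- \<i> * v))) \<le>
          norm ((a v - A) * exp (\<i> * v)) + norm ((b v - B) * exp (- \<i> * v))"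
        by (metis norm_triangle_ineq)
      then show ?thesis by (simp add: norm_mult norm_minus_commute)
    qed
    ultimately show "norm (y v - (A * exp (\<i> * v) + B * exp (- \<i> * v))) \<le>
         8 * K / (Re v + \<bar>Im v\<bar>) * (norm A * exp (- Im v) + norm B * exp (Im v))"
      unfolding nI_def c_def by linarith
  qed
qed

end

section \<open>The linear equation in the Liouville variable\<close>

text \<open>Two differentiations of \<open>p v ^ 4 = poly P (Z v)\<close>, where Z has derivative
  1/p^2. The quotient p''/p is minus the perturbation in the transformed equation, and here it
  becomes a rational function of Z alone, which can be estimated at infinity.\<close>

lemma liouville_chart_second_deriv:
  assumes ch: "liouville_chart P C \<rho> Z p \<theta>" and v: "v \<in> rdom \<rho>"
  shows "deriv p v = poly (pderiv P) (Z v) / (4 * p v ^ 5)"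
    and "deriv (deriv p) v = (poly (pderiv (pderiv P)) (Z v) / (4 * (poly P (Z v))\<^sup>2)
           - 5 * (poly (pderiv P) (Z v))\<^sup>2 / (16 * poly P (Z v) ^ 3)) * p v"
proof -
  have p: "(p has_field_derivative deriv p x) (at x)" "p x \<noteq> 0" "p x ^ 4 = poly P (Z x)"
    "(Z has_field_derivative 1 / (p x)\<^sup>2) (at x)" if "x \<in> rdom \<rho>" for x
    using ch that unfolding liouville_chart_def by (auto intro: holomorphic_derivI[OF _ open_rdom])
  have alg: "(q2 * (1 / t\<^sup>2) * (4 * t ^ 5) - q1 * (20 * t ^ 4 * (q1 / (4 * t ^ 5)))) / ((4 * t ^ 5) * (4 * t ^ 5))
      = (q2 / (4 * (t ^ 4)\<^sup>2) - 5 * q1\<^sup>2 / (16 * (t ^ 4) ^ 3)) * t" if "t \<noteq> 0" for q1 q2 t :: complex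
  proof -
    have 1: "q2 * (1 / t\<^sup>2) * (4 * t ^ 5) = 4 * q2 * t ^ 3"
      using that by (simp add: eval_nat_numeral)
    have 2: "q1 * (20 * t ^ 4 * (q1 / (4 * t ^ 5))) = 5 * q1\<^sup>2 / t"
      using that by (simp add: eval_nat_numeral)
    show ?thesis unfolding 1 2 using that by (simp add: field_simps eval_nat_numeral)
  qed
  have d1: "deriv p x = poly (pderiv P) (Z x) / (4 * p x ^ 5)" if x: "x \<in> rdom \<rho>" for x
  proof -
    have "((\<lambda>x. p x ^ 4) has_field_derivative 4 * p x ^ 3 * deriv p x) (at x)"
      using p(1)[OF x] by (auto intro!: derivative_eq_intros)
    moreover have "((\<lambda>x. poly P (Z x)) has_field_derivative poly (pderiv P) (Z x) * (1 / (p x)\<^sup>2)) (at x)"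
      using DERIV_chain2[OF poly_DERIV p(4)[OF x]] .
    then have "((\<lambda>x. p x ^ 4) has_field_derivative poly (pderiv P) (Z x) * (1 / (p x)\<^sup>2)) (at x)"
      by (rule has_field_derivative_transform_within_open[OF _ open_rdom x]) (simp add: p(3))
    ultimately have "4 * p x ^ 3 * deriv p x = poly (pderiv P) (Z x) * (1 / (p x)\<^sup>2)"
      by (rule DERIV_unique)
    then show ?thesis using p(2)[OF x] by (simp add: field_simps power_numeral_reduce)
  qed
  show "deriv p v = poly (pderiv P) (Z v) / (4 * p v ^ 5)" by (rule d1[OF v])
  have "((\<lambda>x. poly (pderiv P) (Z x)) has_field_derivative poly (pderiv (pderiv P)) (Z v) * (1 / (p v)\<^sup>2)) (at v)"
    using DERIV_chain2[OF poly_DERIV p(4)[OF v]] .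
  then have "((\<lambda>x. poly (pderiv P) (Z x) / (4 * p x ^ 5)) has_field_derivative
      (poly (pderiv (pderiv P)) (Z v) * (1 / (p v)\<^sup>2) * (4 * p v ^ 5) -
       poly (pderiv P) (Z v) * (20 * p v ^ 4 * deriv p v)) / ((4 * p v ^ 5) * (4 * p v ^ 5))) (at v)"
    by (rule DERIV_divide) (use p(1,2)[OF v] in \<open>auto intro!: derivative_eq_intros\<close>)
  then have "(deriv p has_field_derivative
      (poly (pderiv (pderiv P)) (Z v) * (1 / (p v)\<^sup>2) * (4 * p v ^ 5) -
       poly (pderiv P) (Z v) * (20 * p v ^ 4 * deriv p v)) / ((4 * p v ^ 5) * (4 * p v ^ 5))) (at v)"
    by (rule has_field_derivative_transform_within_open[OF _ open_rdom v]) (simp add: d1)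
  then have "deriv (deriv p) v = (poly (pderiv (pderiv P)) (Z v) * (1 / (p v)\<^sup>2) * (4 * p v ^ 5) -
       poly (pderiv P) (Z v) * (20 * p v ^ 4 * deriv p v)) / ((4 * p v ^ 5) * (4 * p v ^ 5))"
    by (rule DERIV_imp_deriv)
  also have "\<dots> = (poly (pderiv (pderiv P)) (Z v) / (4 * (p v ^ 4)\<^sup>2)
           - 5 * (poly (pderiv P) (Z v))\<^sup>2 / (16 * (p v ^ 4) ^ 3)) * p v"
    unfolding d1[OF v] by (rule alg[OF p(2)[OF v]])
  finally show "deriv (deriv p) v = (poly (pderiv (pderiv P)) (Z v) / (4 * (poly P (Z v))\<^sup>2)
           - 5 * (poly (pderiv P) (Z v))\<^sup>2 / (16 * poly P (Z v) ^ 3)) * p v"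
    unfolding p(3)[OF v] .
qed

text \<open>Each derivative of P costs one power of z, so both terms are O(z^(-(m+2))), which is the
  order of \<zeta>^(-2) and makes the perturbation integrable.\<close>

lemma liouville_potential_bound:
  fixes P :: "complex poly"
  assumes P: "P \<noteq> 0"
  obtains R K where "R \<ge> 1" "K > 0" "\<And>z. norm z \<ge> R \<Longrightarrow>
    norm (poly (pderiv (pderiv P)) z / (4 * (poly P z)\<^sup>2) - 5 * (poly (pderiv P) z)\<^sup>2 / (16 * poly P z ^ 3))
      \<le> K / norm z ^ (degree P + 2)"
proof -
  define m where "m = degree P"
  define a where "a = lead_coeff P"
  have a: "norm a > 0" using P by (simp add: a_def)
  \<comment> \<open>Multiplying the derivatives by z and z^2 restores the degree bound m uniformly,
    also when a derivative vanishes.\<close>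
  have deg1: "degree (pCons 0 (pderiv P)) \<le> m" 
    by (cases "pderiv P = 0") (auto simp: m_def degree_pderiv pderiv_eq_0_iff)
  have deg2: "degree (pCons 0 (pCons 0 (pderiv (pderiv P)))) \<le> m"
    by (cases "pderiv (pderiv P) = 0") (auto simp: m_def degree_pderiv pderiv_eq_0_iff)
  obtain C1 where C1: "C1 > 0" "\<And>z. norm z \<ge> 1 \<Longrightarrow> norm (poly (pCons 0 (pderiv P)) z) \<le> C1 * norm z ^ m"
    using poly_norm_le[OF deg1] by blast
  obtain C2 where C2: "C2 > 0" "\<And>z. norm z \<ge> 1 \<Longrightarrow> norm (poly (pCons 0 (pCons 0 (pderiv (pderiv P)))) z) \<le> C2 * norm z ^ m"
    using poly_norm_le[OF deg2] by blast
  obtain C3 where C3: "C3 > 0" "\<And>z. norm z \<ge> 1 \<Longrightarrow> norm (poly P z / (a * z ^ m) - 1) \<le> C3 / norm z"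
    using poly_asymp_lead[OF P] unfolding a_def m_def by blast
  define R where "R = max 1 (2 * C3)"
  define b where "b = norm a / 2"
  have b: "b > 0" using a by (simp add: b_def)
  define K where "K = C2 / (4 * b\<^sup>2) + 5 * C1\<^sup>2 / (16 * b ^ 3)"
  have K: "K > 0" unfolding K_def using C1 C2 b by (intro add_pos_pos divide_pos_pos) auto
  show thesis
  proof (rule that[of R K])
    fix z :: complex assume z: "norm z \<ge> R"
    define t where "t = norm z"
    have t: "t \<ge> 1" "t \<ge> 2 * C3" using z by (auto simp: R_def t_def)
    have z0: "z \<noteq> 0" using t by (auto simp: t_def)
    have "C3 / t \<le> 1 / 2" using t by (simp add: divide_le_eq)
    moreover have "norm (poly P z / (a * z ^ m) - 1) \<le> C3 / t" using C3(2)[of z] t by (simp add: t_def)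
    ultimately have "norm (poly P z / (a * z ^ m) - 1) \<le> 1 / 2" by linarith
    then have "norm (poly P z / (a * z ^ m)) \<ge> 1 / 2"
      using norm_triangle_ineq2[of 1 "poly P z / (a * z ^ m)"] by (simp only: norm_minus_commute[of 1] norm_one) 
    then have lb: "norm (poly P z) \<ge> b * t ^ m"
      using a z0 by (simp add: norm_divide norm_mult norm_power b_def t_def le_divide_eq)
    have bt: "b * t ^ m > 0" using b t by simp
    have u1: "norm (poly (pderiv P) z) \<le> C1 * t ^ m / t"
      using C1(2)[of z] t z0 by (simp add: norm_mult t_def le_divide_eq mult.commute)
    have u2: "norm (poly (pderiv (pderiv P)) z) \<le> C2 * t ^ m / t\<^sup>2"
      using C2(2)[of z] t z0 by (simp add: norm_mult t_def le_divide_eq power2_eq_square mult_ac)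
    have "norm (poly (pderiv (pderiv P)) z / (4 * (poly P z)\<^sup>2)) \<le> (C2 * t ^ m / t\<^sup>2) / (4 * (b * t ^ m)\<^sup>2)"
      unfolding norm_divide norm_mult norm_power norm_numeral
    proof (rule frac_le)
      show "4 * (b * t ^ m)\<^sup>2 \<le> 4 * (norm (poly P z))\<^sup>2"
        using power_mono[OF lb, of 2] bt by simp
    qed (use u2 bt t C2 in auto)
    also have "\<dots> = C2 / (4 * b\<^sup>2) / t ^ (m + 2)"
      using b t by (simp add: field_simps power2_eq_square)
    finally have 1: "norm (poly (pderiv (pderiv P)) z / (4 * (poly P z)\<^sup>2)) \<le> C2 / (4 * b\<^sup>2) / t ^ (m + 2)" .
    have "norm (5 * (poly (pderiv P) z)\<^sup>2 / (16 * poly P z ^ 3)) \<le> (5 * (C1 * t ^ m / t)\<^sup>2) / (16 * (b * t ^ m) ^ 3)"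
      unfolding norm_divide norm_mult norm_power norm_numeral
    proof (rule frac_le)
      show "16 * (b * t ^ m) ^ 3 \<le> 16 * norm (poly P z) ^ 3"
        using power_mono[OF lb, of 3] bt by simp
      show "5 * (norm (poly (pderiv P) z))\<^sup>2 \<le> 5 * (C1 * t ^ m / t)\<^sup>2"
        using power_mono[OF u1, of 2] by simp
    qed (use bt in auto)
    also have "\<dots> = 5 * C1\<^sup>2 / (16 * b ^ 3) / t ^ (m + 2)"
      using b t by (simp add: field_simps power2_eq_square power3_eq_cube)
    finally have 2: "norm (5 * (poly (pderiv P) z)\<^sup>2 / (16 * poly P z ^ 3)) \<le> 5 * C1\<^sup>2 / (16 * b ^ 3) / t ^ (m + 2)" .
    have "norm (poly (pderiv (pderiv P)) z / (4 * (poly P z)\<^sup>2) - 5 * (poly (pderiv P) z)\<^sup>2 / (16 * poly P z ^ 3))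
      \<le> C2 / (4 * b\<^sup>2) / t ^ (m + 2) + 5 * C1\<^sup>2 / (16 * b ^ 3) / t ^ (m + 2)"
      by (rule order_trans[OF norm_triangle_ineq4 add_mono[OF 1 2]])
    also have "\<dots> = K / t ^ (m + 2)" by (simp add: K_def add_divide_distrib)
    finally show "norm (poly (pderiv (pderiv P)) z / (4 * (poly P z)\<^sup>2) - 5 * (poly (pderiv P) z)\<^sup>2 / (16 * poly P z ^ 3))
      \<le> K / norm z ^ (degree P + 2)" by (simp add: t_def m_def)
  qed (use K in \<open>auto simp: R_def\<close>)
qed

text \<open>The Liouville transform. The weight \<open>p\<close> removes the first-order term that
  the change of variable creates, and it cancels in quotients, so the quotient of two pull-backs is
  the original quotient read in the chart.\<close>

definition pull_back :: "(complex \<Rightarrow> complex) \<Rightarrow> (complex \<Rightarrow> complex) \<Rightarrow> (complex \<Rightarrow> complex) \<Rightarrow> complex \<Rightarrow> complex" where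
  "pull_back Z p w v = w (Z v) * p v"

lemma pull_back_derivs:
  assumes ch: "liouville_chart P C \<rho> Z p \<theta>" and v: "v \<in> rdom \<rho>"
    and w: "w holomorphic_on UNIV" "\<And>z. deriv (deriv w) z = - poly P z * w z"
  shows "(pull_back Z p w has_field_derivative (deriv w (Z v) / p v + w (Z v) * deriv p v)) (at v)"
    and "deriv (deriv (pull_back Z p w)) v = - (1 + (- deriv (deriv p) v / p v)) * pull_back Z p w v"
proof -
  have ph: "p holomorphic_on rdom \<rho>" using ch unfolding liouville_chart_def by blast
  have p: "(p has_field_derivative deriv p x) (at x)" "(deriv p has_field_derivative deriv (deriv p) x) (at x)"
    "p x \<noteq> 0" "p x ^ 4 = poly P (Z x)"
    "(Z has_field_derivative 1 / (p x)\<^sup>2) (at x)" if "x \<in> rdom \<rho>" for x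
    using ch that ph unfolding liouville_chart_def
    by (auto intro: holomorphic_derivI[OF _ open_rdom] holomorphic_deriv open_rdom)
  have dw: "(w has_field_derivative deriv w x) (at x)" for x by (rule holomorphic_derivI[OF w(1)]) auto
  have ddw: "(deriv w has_field_derivative deriv (deriv w) x) (at x)" for x
    by (rule holomorphic_derivI[OF holomorphic_deriv[OF w(1)]]) auto
  have wZ: "((\<lambda>v. w (Z v)) has_field_derivative deriv w (Z x) * (1 / (p x)\<^sup>2)) (at x)" if "x \<in> rdom \<rho>" for x
    using DERIV_chain2[OF dw p(5)[OF that]] .
  have dwZ: "((\<lambda>v. deriv w (Z v)) has_field_derivative deriv (deriv w) (Z x) * (1 / (p x)\<^sup>2)) (at x)" if "x \<in> rdom \<rho>" for x
    using DERIV_chain2[OF ddw p(5)[OF that]] .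
  have d1: "(pull_back Z p w has_field_derivative (deriv w (Z x) / p x + w (Z x) * deriv p x)) (at x)" if x: "x \<in> rdom \<rho>" for x
  proof -
    have "((\<lambda>v. w (Z v) * p v) has_field_derivative (deriv w (Z x) * (1 / (p x)\<^sup>2)) * p x + deriv p x * w (Z x)) (at x)"
      by (rule DERIV_mult[OF wZ[OF x] p(1)[OF x]])
    also have "(deriv w (Z x) * (1 / (p x)\<^sup>2)) * p x + deriv p x * w (Z x) = deriv w (Z x) / p x + w (Z x) * deriv p x"
      using p(3)[OF x] by (simp add: power2_eq_square)
    finally show ?thesis unfolding pull_back_def[abs_def] .
  qed
  show "(pull_back Z p w has_field_derivative (deriv w (Z v) / p v + w (Z v) * deriv p v)) (at v)" by (rule d1[OF v])
  have "((\<lambda>v. deriv w (Z v) / p v + w (Z v) * deriv p v) has_field_derivative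
     ((deriv (deriv w) (Z v) * (1 / (p v)\<^sup>2)) * p v - deriv w (Z v) * deriv p v) / (p v * p v) +
     ((deriv w (Z v) * (1 / (p v)\<^sup>2)) * deriv p v + deriv (deriv p) v * w (Z v))) (at v)"
    by (intro DERIV_add DERIV_divide DERIV_mult wZ dwZ p v)
  then have "(deriv (pull_back Z p w) has_field_derivative
     ((deriv (deriv w) (Z v) * (1 / (p v)\<^sup>2)) * p v - deriv w (Z v) * deriv p v) / (p v * p v) +
     ((deriv w (Z v) * (1 / (p v)\<^sup>2)) * deriv p v + deriv (deriv p) v * w (Z v))) (at v)"
    by (rule has_field_derivative_transform_within_open[OF _ open_rdom v]) (simp add: DERIV_imp_deriv[OF d1])
  then have "deriv (deriv (pull_back Z p w)) v =
     ((deriv (deriv w) (Z v) * (1 / (p v)\<^sup>2)) * p v - deriv w (Z v) * deriv p v) / (p v * p v) +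
     ((deriv w (Z v) * (1 / (p v)\<^sup>2)) * deriv p v + deriv (deriv p) v * w (Z v))"
    by (rule DERIV_imp_deriv)
  also have "\<dots> = deriv (deriv w) (Z v) / p v ^ 3 + deriv (deriv p) v * w (Z v)"
    using p(3)[OF v] by (simp add: field_simps power2_eq_square power3_eq_cube)
  also have "deriv (deriv w) (Z v) / p v ^ 3 = - w (Z v) * p v"
    unfolding w(2) p(4)[OF v, symmetric] using p(3)[OF v] by (simp add: field_simps power_numeral_reduce)
  finally show "deriv (deriv (pull_back Z p w)) v = - (1 + (- deriv (deriv p) v / p v)) * pull_back Z p w v"
    using p(3)[OF v] by (simp only: pull_back_def[of Z p w v]) (simp add: field_simps)
qed

lemma liouville_chart_mono:
  assumes "liouville_chart P C \<rho> Z p \<theta>" "\<rho> \<le> \<rho>'"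
  shows "liouville_chart P C \<rho>' Z p \<theta>"
  using assms rdom_mono[OF assms(2)] unfolding liouville_chart_def
  by (meson holomorphic_on_subset subsetD)

text \<open>Only the bounds shared by the charts enter, so one threshold and one constant serve
  every chart and every solution.\<close>

lemma liouville_oscillator_exists:
  fixes P :: "complex poly"
  assumes P: "P \<noteq> 0" and C: "C > 0" and \<rho>: "\<rho> \<ge> 1"
  obtains \<rho>' K where "\<rho>' \<ge> \<rho>" "K > 0"
    "\<And>Z p \<theta> w. liouville_chart P C \<rho> Z p \<theta> \<Longrightarrow> w holomorphic_on UNIV \<Longrightarrow>
       (\<And>z. deriv (deriv w) z = - poly P z * w z) \<Longrightarrow>
       oscillator (pull_back Z p w) (\<lambda>v. - deriv (deriv p) v / p v) \<rho>' K"
proof -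
  define \<mu> where "\<mu> = real (degree P) + 2"
  have \<mu>: "\<mu> \<ge> 2" by (simp add: \<mu>_def)
  obtain R K where RK: "R \<ge> 1" "K > 0" "\<And>z. norm z \<ge> R \<Longrightarrow>
    norm (poly (pderiv (pderiv P)) z / (4 * (poly P z)\<^sup>2) - 5 * (poly (pderiv P) z)\<^sup>2 / (16 * poly P z ^ 3))
      \<le> K / norm z ^ (degree P + 2)"
    using liouville_potential_bound[OF P] by blast
  \<comment> \<open>Points of the region have |v| > \<rho>'/2, which puts Z v beyond the radius
    \<open>R\<close> where the potential bound holds. Note that \<mu> is m + 2 here, twice the
    exponent of the charts.\<close>
  define \<rho>' where "\<rho>' = max \<rho> (2 * (C * R) powr (\<mu> / 2))"
  define K' where "K' = K * C ^ (degree P + 2)"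
  show thesis
  proof (rule that[of \<rho>' K'])
    show "\<rho>' \<ge> \<rho>" "K' > 0" using RK C by (auto simp: \<rho>'_def K'_def)
    fix Z p \<theta> w assume ch: "liouville_chart P C \<rho> Z p \<theta>" and w: "w holomorphic_on UNIV"
       "\<And>z. deriv (deriv w) z = - poly P z * w z"
    have ch': "liouville_chart P C \<rho>' Z p \<theta>" by (rule liouville_chart_mono[OF ch]) (simp add: \<rho>'_def)
    show "oscillator (pull_back Z p w) (\<lambda>v. - deriv (deriv p) v / p v) \<rho>' K'"
    proof
      show "1 \<le> \<rho>'" using \<rho> by (simp add: \<rho>'_def)
      show "0 < K'" using RK C by (simp add: K'_def)
      show "pull_back Z p w holomorphic_on rdom \<rho>'"
        using pull_back_derivs(1)[OF ch' _ w] open_rdom by (auto simp: holomorphic_on_open)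
      fix v assume v: "v \<in> rdom \<rho>'"
      show "deriv (deriv (pull_back Z p w)) v = - (1 + - deriv (deriv p) v / p v) * pull_back Z p w v"
        using pull_back_derivs(2)[OF ch' v w] by simp
      have pv: "p v \<noteq> 0" and Zv: "norm v powr (2 / \<mu>) \<le> C * norm (Z v)"
        using ch' v unfolding liouville_chart_def \<mu>_def by auto
      have nv: "norm v > (C * R) powr (\<mu> / 2)" using rdom_norm[OF v] by (simp add: \<rho>'_def)
      have CR: "C * R > 0" using C RK by simp
      have "C * R = ((C * R) powr (\<mu> / 2)) powr (2 / \<mu>)" using CR \<mu> by (simp add: powr_powr)
      also have "\<dots> \<le> norm v powr (2 / \<mu>)" using nv \<mu> by (intro powr_mono2) auto
      finally have "norm (Z v) \<ge> R" using Zv C by (metis dual_order.trans mult_le_cancel_left_pos)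
      then have b: "norm (deriv (deriv p) v / p v) \<le> K / norm (Z v) ^ (degree P + 2)"
        unfolding liouville_chart_second_deriv(2)[OF ch' v] using RK(3)[of "Z v"] pv by simp
      have v0: "norm v > 0" using rdom_norm[OF v] \<rho> by (auto simp: \<rho>'_def)
      have "(norm v)\<^sup>2 = (norm v powr (2 / \<mu>)) ^ (degree P + 2)"
      proof -
        have "(norm v powr (2 / \<mu>)) ^ (degree P + 2) = (norm v powr (2 / \<mu>)) powr real (degree P + 2)"
          using v0 by (intro powr_realpow[symmetric]) simp
        also have "\<dots> = norm v powr (2 / \<mu> * real (degree P + 2))" by (rule powr_powr)
        also have "2 / \<mu> * real (degree P + 2) = 2" by (simp add: \<mu>_def divide_eq_eq)
        finally show ?thesis using v0 by simp
      qed
      also have "\<dots> \<le> (C * norm (Z v)) ^ (degree P + 2)" by (rule power_mono[OF Zv]) simp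
      finally have "(norm v)\<^sup>2 \<le> C ^ (degree P + 2) * norm (Z v) ^ (degree P + 2)" by (simp only: power_mult_distrib)
      then have "K' / (C ^ (degree P + 2) * norm (Z v) ^ (degree P + 2)) \<le> K' / (norm v)\<^sup>2"
      proof (rule divide_left_mono)
        have "norm (Z v) > 0" using \<open>norm (Z v) \<ge> R\<close> RK by linarith
        then show "0 < C ^ (degree P + 2) * norm (Z v) ^ (degree P + 2) * (norm v)\<^sup>2"
          using v0 C by (intro mult_pos_pos zero_less_power) auto
      qed (use RK C in \<open>auto simp: K'_def\<close>)
      moreover have "K / norm (Z v) ^ (degree P + 2) = K' / (C ^ (degree P + 2) * norm (Z v) ^ (degree P + 2))"
        using C by (simp add: K'_def)
      ultimately have "K / norm (Z v) ^ (degree P + 2) \<le> K' / (norm v)\<^sup>2" by simp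
      then show "norm (- deriv (deriv p) v / p v) \<le> K' / (norm v)\<^sup>2" using b by simp
    qed
  qed
qed

section \<open>Functions with polynomial Schwarzian derivative\<close>

text \<open>Otherwise f is constant on a small disc, then everywhere by the identity theorem, and a
  constant is rational.\<close>

lemma transcendental_deriv_frequently_nonzero:
  assumes "transcendental_meromorphic f"
  shows "\<exists>\<^sub>F w in at z. deriv f w \<noteq> 0"
proof (rule ccontr)
  assume "\<not> (\<exists>\<^sub>F w in at z. deriv f w \<noteq> 0)"
  then have ev: "\<forall>\<^sub>F w in at z. deriv f w = 0" by (simp add: not_frequently)
  have nm: "f nicely_meromorphic_on UNIV" using assms by (simp add: transcendental_meromorphic_def)
  then have "isolated_singularity_at f z"
    by (auto simp: nicely_meromorphic_on_def intro: meromorphic_on_isolated_singularity meromorphic_on_subset)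
  then have "\<forall>\<^sub>F w in at z. f analytic_on {w}" by (simp add: isolated_singularity_at_altdef)
  with ev have "\<forall>\<^sub>F w in at z. deriv f w = 0 \<and> f analytic_on {w}" by (rule eventually_conj)
  then obtain r where r: "r > 0" "\<And>w. w \<noteq> z \<Longrightarrow> dist w z < r \<Longrightarrow> deriv f w = 0 \<and> f analytic_on {w}"
    unfolding eventually_at by auto
  define z1 where "z1 = z + of_real (r / 2)"
  have ball: "w \<noteq> z \<and> dist w z < r" if "w \<in> ball z1 (r / 2)" for w
  proof -
    have d1: "dist z1 z = r / 2" using r by (simp add: z1_def dist_norm)
    then show ?thesis using that r dist_triangle[of w z z1] by (auto simp: dist_commute)
  qed
  have "(f has_field_derivative 0) (at w within ball z1 (r / 2))" if w: "w \<in> ball z1 (r / 2)" for w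
  proof -
    have "deriv f w = 0" "f analytic_on {w}" using r(2)[of w] ball[OF w] by auto
    then have "(f has_field_derivative 0) (at w)"
      by (metis analytic_on_imp_differentiable_at field_differentiable_derivI singletonI)
    then show ?thesis by (rule has_field_derivative_at_within)
  qed
  then obtain c where c: "\<And>w. w \<in> ball z1 (r / 2) \<Longrightarrow> f w = c"
    using has_field_derivative_zero_constant[of "ball z1 (r / 2)" f] by auto
  have "\<forall>\<^sub>F w in at z1. f w = c"
    using c eventually_at_in_open'[of "ball z1 (r/2)" z1] r(1) by (auto elim!: eventually_mono)
  then have "\<exists>\<^sub>F w in at z1. f w = c" by (rule eventually_frequently[rotated]) auto
  then have fc: "f w = c" for w by (rule frequently_eq_meromorphic_imp_constant[OF _ nm]) auto
  have "\<exists>p q. q \<noteq> 0 \<and> (\<forall>z. poly q z \<noteq> 0 \<longrightarrow> f z = poly p z / poly q z)"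
    by (intro exI[of _ "[:c:]"] exI[of _ 1]) (simp add: fc)
  then show False using assms unfolding transcendental_meromorphic_def by (elim conjE notE)
qed

text \<open>With f' = u (w - z)^n and u nonzero at z, the product of (w - z)^2 and the Schwarzian
  tends to -n(n+2)/2. So where the Schwarzian has no pole, only n = 0 and n = -2 remain: f has no
  critical points and only simple poles.\<close>

lemma zorder_deriv_if_schwarzian_bounded:
  assumes iso: "isolated_singularity_at (deriv f) z" and ness: "not_essential (deriv f) z"
    and nz: "\<exists>\<^sub>F w in at z. deriv f w \<noteq> 0"
    and lim: "((\<lambda>w. (w - z)\<^sup>2 * schwarzian f w) \<longlongrightarrow> 0) (at z)"
  shows "zorder (deriv f) z = 0 \<or> zorder (deriv f) z = -2"
proof -
  define n where "n = zorder (deriv f) z"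
  define u where "u = zor_poly (deriv f) z"
  obtain r where r: "r > 0" "u holomorphic_on cball z r"
     "\<And>w. w \<in> cball z r - {z} \<Longrightarrow> deriv f w = u w * (w - z) powi n \<and> u w \<noteq> 0" and uz: "u z \<noteq> 0"
    using zorder_exist[OF iso ness nz] unfolding u_def n_def by blast
  define B where "B = ball z r"
  have B: "open B" "z \<in> B" "B - {z} \<subseteq> cball z r - {z}" using r(1) by (auto simp: B_def)
  have uB: "u holomorphic_on B" by (rule holomorphic_on_subset[OF r(2)]) (auto simp: B_def)
  have unz: "u w \<noteq> 0" if "w \<in> B" for w using r(3)[of w] uz B(3) that by (cases "w = z") auto
  define q where "q w = deriv u w / u w" for w
  have qB: "q holomorphic_on B" unfolding q_def by (intro holomorphic_intros holomorphic_deriv uB B unz)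
  have op: "open (B - {z})" using B by auto
  have du: "(u has_field_derivative deriv u w) (at w)" if "w \<in> B" for w
    by (rule holomorphic_derivI[OF uB B(1) that])
  have T: "deriv (deriv f) w / deriv f w = q w + of_int n / (w - z)" if w: "w \<in> B - {z}" for w
  proof -
    have "((\<lambda>w. u w * (w - z) powi n) has_field_derivative
        (deriv u w * (w - z) powi n + of_int n * (w - z) powi (n - 1) * u w)) (at w)"
      using w du[of w] by (auto intro!: derivative_eq_intros)
    then have "(deriv f has_field_derivative
        (deriv u w * (w - z) powi n + of_int n * (w - z) powi (n - 1) * u w)) (at w)"
      by (rule has_field_derivative_transform_within_open[OF _ op w]) (use r(3) B(3) in auto)
    then have "deriv (deriv f) w = deriv u w * (w - z) powi n + of_int n * (w - z) powi (n - 1) * u w"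
      by (rule DERIV_imp_deriv)
    moreover have "deriv f w = u w * (w - z) powi n" using r(3) B(3) w by blast
    moreover have "(w - z) powi n = (w - z) powi (n - 1) * (w - z)"
      using w by (simp add: power_int_diff)
    moreover have "(u' * (e * d) + m * e * u0) / (u0 * (e * d)) = u' / u0 + m / d"
      if "e \<noteq> 0" "d \<noteq> 0" "u0 \<noteq> 0" for u' e d m u0 :: complex
      using that by (simp add: field_simps)
    ultimately show ?thesis using w unz[of w] by (simp add: q_def)
  qed
  have S: "schwarzian f w = deriv q w - of_int n / (w - z)\<^sup>2 - (q w + of_int n / (w - z))\<^sup>2 / 2"
    if w: "w \<in> B - {z}" for w
  proof -
    have "((\<lambda>w. q w + of_int n / (w - z)) has_field_derivative (deriv q w - of_int n / (w - z)\<^sup>2)) (at w)"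
      using w holomorphic_derivI[OF qB B(1), of w] by (auto intro!: derivative_eq_intros simp: power2_eq_square)
    then have "((\<lambda>w. deriv (deriv f) w / deriv f w) has_field_derivative (deriv q w - of_int n / (w - z)\<^sup>2)) (at w)"
      by (rule has_field_derivative_transform_within_open[OF _ op w]) (use T in auto)
    then show ?thesis unfolding schwarzian_def T[OF w] by (simp add: DERIV_imp_deriv)
  qed
  have S2: "(w - z)\<^sup>2 * schwarzian f w = (w - z)\<^sup>2 * deriv q w - of_int n - ((w - z) * q w + of_int n)\<^sup>2 / 2"
    if w: "w \<in> B - {z}" for w
  proof -
    have "w - z \<noteq> 0" using w by auto
    then have "(w - z)\<^sup>2 * (of_int n / (w - z)\<^sup>2) = of_int n"
      "(w - z)\<^sup>2 * (q w + of_int n / (w - z))\<^sup>2 = ((w - z) * q w + of_int n)\<^sup>2"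
      by (auto simp: power_mult_distrib[symmetric] distrib_left)
    then show ?thesis unfolding S[OF w] by (simp add: right_diff_distrib)
  qed
  have "isCont q z" "isCont (deriv q) z"
    using qB holomorphic_deriv[OF qB B(1)] B(1,2) by (auto simp: continuous_on_eq_continuous_at dest!: holomorphic_on_imp_continuous_on)
  then have "((\<lambda>w. (w - z)\<^sup>2 * deriv q w - of_int n - ((w - z) * q w + of_int n)\<^sup>2 / 2) \<longlongrightarrow>
      (z - z)\<^sup>2 * deriv q z - of_int n - ((z - z) * q z + of_int n)\<^sup>2 / 2) (at z)"
    unfolding isCont_def by (intro tendsto_intros) auto
  moreover have "\<forall>\<^sub>F w in at z. (w - z)\<^sup>2 * schwarzian f w =
      (w - z)\<^sup>2 * deriv q w - of_int n - ((w - z) * q w + of_int n)\<^sup>2 / 2"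
    using eventually_at_in_open[OF B(1,2)] by eventually_elim (rule S2)
  ultimately have "((\<lambda>w. (w - z)\<^sup>2 * schwarzian f w) \<longlongrightarrow> - of_int n - (of_int n)\<^sup>2 / 2) (at z)"
    by (subst tendsto_cong) auto
  then have "- of_int n - (of_int n)\<^sup>2 / 2 = (0 :: complex)"
    using lim by (rule LIM_unique)
  moreover have "of_int (n * (n + 2)) = - 2 * (- of_int n - (of_int n)\<^sup>2 / 2 :: complex)"
    by (simp add: algebra_simps power2_eq_square)
  ultimately have "of_int (n * (n + 2)) = (0 :: complex)" by (simp only: mult_zero_right)
  then have "n * (n + 2) = 0" by (simp only: of_int_eq_0_iff)
  then show ?thesis by (auto simp: n_def)
qed

lemma entire_eq_if_eventually_eq:
  assumes "g holomorphic_on UNIV" "h holomorphic_on UNIV" "\<forall>\<^sub>F w in at z. g w = h w"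
  shows "g z = (h z :: complex)"
proof -
  have "(g \<longlongrightarrow> g z) (at z)" "(h \<longlongrightarrow> h z) (at z)"
    using assms(1,2) by (auto simp: continuous_on_eq_continuous_at isCont_def dest!: holomorphic_on_imp_continuous_on)
  moreover from this(1) have "(h \<longlongrightarrow> g z) (at z)" using tendsto_cong[OF assms(3)] by blast
  ultimately show ?thesis by (blast intro: LIM_unique)
qed

text \<open>From f' = w^(-2) one gets f''/f' = -2 w'/w. In the Schwarzian the squares of w'/w
  cancel, which leaves -2 w''/w.\<close>

lemma schwarzian_quotient:
  assumes w: "w holomorphic_on UNIV" and "w z \<noteq> 0"
    and f: "\<And>x. w x \<noteq> 0 \<Longrightarrow> (f has_field_derivative 1 / (w x)\<^sup>2) (at x)"
  shows "schwarzian f z * w z = - 2 * deriv (deriv w) z"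
proof -
  define U where "U = {x. w x \<noteq> 0}"
  have "open U" unfolding U_def
    by (intro open_Collect_neq) (use w in \<open>auto intro: holomorphic_on_imp_continuous_on continuous_intros\<close>)
  have U: "open U" "z \<in> U" by (fact, use assms in \<open>simp add: U_def\<close>)
  have dw: "(w has_field_derivative deriv w x) (at x)" for x by (rule holomorphic_derivI[OF w]) auto
  have ddw: "(deriv w has_field_derivative deriv (deriv w) x) (at x)" for x
    by (rule holomorphic_derivI[OF holomorphic_deriv[OF w]]) auto
  have d1: "deriv f x = 1 / (w x)\<^sup>2" if "x \<in> U" for x using f that by (auto simp: U_def DERIV_imp_deriv)
  have d2: "deriv (deriv f) x = - 2 * deriv w x / (w x) ^ 3" if x: "x \<in> U" for x
  proof -
    have "((\<lambda>x. 1 / (w x)\<^sup>2) has_field_derivative - 2 * deriv w x / (w x) ^ 3) (at x)"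
      using x dw[of x] by (auto intro!: derivative_eq_intros simp: U_def field_simps power2_eq_square power3_eq_cube)
    then have "(deriv f has_field_derivative - 2 * deriv w x / (w x) ^ 3) (at x)"
      by (rule has_field_derivative_transform_within_open[OF _ U(1) x]) (simp add: d1)
    then show ?thesis by (rule DERIV_imp_deriv)
  qed
  have T: "deriv (deriv f) x / deriv f x = - 2 * deriv w x / w x" if x: "x \<in> U" for x
    using x unfolding d1[OF x] d2[OF x] by (simp add: U_def power2_eq_square power3_eq_cube)
  have "((\<lambda>x. - 2 * deriv w x / w x) has_field_derivative
      - ((deriv (deriv w) z * 2 * w z - 2 * deriv w z * deriv w z) / (w z * w z))) (at z)"
    using U(2) dw[of z] ddw[of z] by (auto intro!: derivative_eq_intros simp: U_def)
  then have "((\<lambda>x. deriv (deriv f) x / deriv f x) has_field_derivative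
      - ((deriv (deriv w) z * 2 * w z - 2 * deriv w z * deriv w z) / (w z * w z))) (at z)"
    by (rule has_field_derivative_transform_within_open[OF _ U]) (simp add: T)
  then have "schwarzian f z = - ((deriv (deriv w) z * 2 * w z - 2 * deriv w z * deriv w z) / (w z * w z)) - (- 2 * deriv w z / w z)\<^sup>2 / 2"
    unfolding schwarzian_def T[OF U(2)] by (simp add: DERIV_imp_deriv)
  then have "w z * w z * w z * (schwarzian f z * w z + 2 * deriv (deriv w) z) = 0"
    using U(2) by (simp add: U_def field_simps power2_eq_square)
  then show ?thesis using U(2) by (simp add: U_def add_eq_0_iff)
qed

text \<open>By Weierstrass factorisation f is a quotient of entire functions without common zeros.
  Their Wronskian has no zeros because f has no critical points and only simple poles, so it has an
  entire square root. Dividing numerator and denominator by that root makes the Wronskian 1, whence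
  f' = w2^(-2), and the linear equations follow from the Schwarzian.\<close>

lemma nevanlinna_quotient_of_solutions:
  fixes f :: "complex \<Rightarrow> complex" and S :: "complex poly"
  assumes tm: "transcendental_meromorphic f" and S: "\<forall>\<^sub>\<approx>z. schwarzian f z = poly S z"
  obtains w1 w2 where "w1 holomorphic_on UNIV" "w2 holomorphic_on UNIV"
    "\<And>z. deriv (deriv w1) z = - (poly S z / 2) * w1 z"
    "\<And>z. deriv (deriv w2) z = - (poly S z / 2) * w2 z"
    "\<And>z. is_pole f z \<longleftrightarrow> w2 z = 0" "\<And>z. w2 z \<noteq> 0 \<Longrightarrow> f z = w1 z / w2 z"
    "\<And>z. deriv w1 z * w2 z - w1 z * deriv w2 z = 1"
proof -
  have nm: "f nicely_meromorphic_on UNIV" using tm by (simp add: transcendental_meromorphic_def)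
  then have mer: "f meromorphic_on UNIV" by (simp add: nicely_meromorphic_on_def)
  have dmer: "deriv f meromorphic_on UNIV" by (intro meromorphic_intros mer)
  have ns: "isolated_singularity_at f z" "isolated_singularity_at (deriv f) z" "not_essential (deriv f) z" for z
    using meromorphic_on_subset[OF mer, of "{z}"] meromorphic_on_subset[OF dmer, of "{z}"]
    by (auto simp: meromorphic_at_iff)
  have Sev: "\<forall>\<^sub>F w in at z. schwarzian f w = poly S w" for z
    using S by (intro eventually_cosparse_imp_eventually_at) auto
  have zd: "zorder (deriv f) z = 0 \<or> zorder (deriv f) z = -2" for z
  proof (rule zorder_deriv_if_schwarzian_bounded[OF ns(2,3) transcendental_deriv_frequently_nonzero[OF tm]])
    have "((\<lambda>w. (w - z)\<^sup>2 * poly S w) \<longlongrightarrow> (z - z)\<^sup>2 * poly S z) (at z)"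
      by (intro tendsto_intros)
    then have "((\<lambda>w. (w - z)\<^sup>2 * poly S w) \<longlongrightarrow> 0) (at z)" by simp
    moreover have "\<forall>\<^sub>F w in at z. (w - z)\<^sup>2 * schwarzian f w = (w - z)\<^sup>2 * poly S w"
      using Sev[of z] by eventually_elim simp
    ultimately show "((\<lambda>w. (w - z)\<^sup>2 * schwarzian f w) \<longlongrightarrow> 0) (at z)" by (subst tendsto_cong) auto
  qed
  have df0: "deriv f z \<noteq> 0" if "\<not> is_pole f z" for z
  proof
    assume d0: "deriv f z = 0"
    have an: "deriv f analytic_on {z}"
      using nicely_meromorphic_on_imp_analytic_at[OF nm _ that] by (intro analytic_deriv) auto
    then have np: "\<not> is_pole (deriv f) z" by (rule analytic_at_imp_no_pole)
    have "isolated_zero (deriv f) z"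
      using an d0 transcendental_deriv_frequently_nonzero[OF tm, of z] non_isolated_zero_imp_eventually_zero'[of "deriv f" z]
      by (auto simp: frequently_def eventually_nhds_conv_at)
    then have "zorder (deriv f) z > 0"
      using ns by (intro zorder_isolated_zero_pos') auto
    then show False using zd[of z] by auto
  qed
  have zp: "zorder f z = -1" if "is_pole f z" for z
    using zorder_deriv[OF that ns(1)] zd[of z] isolated_pole_imp_neg_zorder[OF ns(1) that] by auto
  obtain h f1 f2 where fac:
    "h holomorphic_on UNIV" "f1 holomorphic_on UNIV" "f2 holomorphic_on UNIV"
    "\<forall>z. f1 z = 0 \<longleftrightarrow> \<not>is_pole f z \<and> f z = 0"
    "\<forall>z. f2 z = 0 \<longleftrightarrow> is_pole f z"
    "\<forall>z. is_pole f z \<longrightarrow> zorder f2 z = - zorder f z"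
    "\<forall>z. h z \<noteq> 0" "\<forall>z. f z = h z * f1 z / f2 z"
    by (rule weierstrass_factorization_meromorphic_UNIV[OF nm]) blast
  define g where "g z = h z * f1 z" for z
  have gh: "g holomorphic_on UNIV" unfolding g_def by (intro holomorphic_intros fac)
  define W where "W z = deriv g z * f2 z - g z * deriv f2 z" for z
  have Wh: "W holomorphic_on UNIV" unfolding W_def by (intro holomorphic_intros holomorphic_deriv gh fac) auto
  have dg: "(g has_field_derivative deriv g x) (at x)" for x by (rule holomorphic_derivI[OF gh]) auto
  have df2: "(f2 has_field_derivative deriv f2 x) (at x)" for x by (rule holomorphic_derivI[OF fac(3)]) auto
  have fd: "(f has_field_derivative W x / (f2 x)\<^sup>2) (at x)" if x: "f2 x \<noteq> 0" for x
  proof -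
    have "((\<lambda>x. g x / f2 x) has_field_derivative W x / (f2 x)\<^sup>2) (at x)"
      using x dg[of x] df2[of x] by (auto intro!: derivative_eq_intros simp: W_def power2_eq_square)
    moreover have "(\<lambda>x. g x / f2 x) = f" using fac(8) by (auto simp: g_def)
    ultimately show ?thesis by simp
  qed
  \<comment> \<open>At a regular point W is f' times f2^2. At a pole it reduces to -g f2', and f2'
    is nonzero because the pole is simple.\<close>
  have W0: "W z \<noteq> 0" for z
  proof (cases "is_pole f z")
    case False
    then have "f2 z \<noteq> 0" using fac(5) by simp
    then show ?thesis using df0[OF False] DERIV_imp_deriv[OF fd] by auto
  next
    case True
    then have f20: "f2 z = 0" and gz: "g z \<noteq> 0" using fac(4,5,7) by (auto simp: g_def)
    have "deriv f2 z \<noteq> 0"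
    proof
      assume d: "deriv f2 z = 0"
      have zo: "zorder f2 z = 1" using fac(6) zp[OF True] True by simp
      \<comment> \<open>If \<open>f2\<close> vanished identically, division by zero would make f the
        zero function, whose derivative vanishes everywhere.\<close>
      have nc: "\<exists>w\<in>UNIV. f2 w \<noteq> 0"
      proof (rule ccontr)
        assume "\<not> (\<exists>w\<in>UNIV. f2 w \<noteq> 0)"
        then have "\<And>w. f w = 0" using fac(8) by auto
        then have "deriv f w = 0" for w by (metis DERIV_const DERIV_imp_deriv ext)
        then show False using transcendental_deriv_frequently_nonzero[OF tm, of 0] by simp
      qed
      obtain r where r: "r > 0" "zor_poly f2 z holomorphic_on cball z r"
        "\<And>w. w \<in> cball z r \<Longrightarrow> f2 w = zor_poly f2 z w * (w - z) ^ nat (zorder f2 z) \<and> zor_poly f2 z w \<noteq> 0"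
        using zorder_exist_zero[OF fac(3) open_UNIV connected_UNIV UNIV_I nc] by blast
      have "zor_poly f2 z holomorphic_on ball z r" by (rule holomorphic_on_subset[OF r(2)]) auto
      then have "(zor_poly f2 z has_field_derivative deriv (zor_poly f2 z) z) (at z)"
        using r(1) by (intro holomorphic_derivI[of _ "ball z r"]) auto
      then have "((\<lambda>w. zor_poly f2 z w * (w - z)) has_field_derivative zor_poly f2 z z) (at z)"
        by (auto intro!: derivative_eq_intros)
      then have "(f2 has_field_derivative zor_poly f2 z z) (at z)"
        by (rule has_field_derivative_transform_within_open[of _ _ _ "ball z r"]) (use r zo in auto)
      then have "zor_poly f2 z z = 0" using d DERIV_imp_deriv by metis
      then show False using r(3)[of z] r(1) by auto
    qed
    then show ?thesis using f20 gz by (simp add: W_def)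
  qed
  obtain L where L: "L holomorphic_on UNIV" "\<And>z. exp (L z) = W z"
    using holomorphic_logarithm_exists[OF convex_UNIV open_UNIV Wh, of 0] W0 by auto
  define E where "E z = exp (- L z / 2)" for z
  have E: "E holomorphic_on UNIV" "E z \<noteq> 0" "(E z)\<^sup>2 * W z = 1" for z
  proof -
    show "E holomorphic_on UNIV" unfolding E_def by (intro holomorphic_intros L) auto
    show "E z \<noteq> 0" by (simp add: E_def)
    have "(E z)\<^sup>2 = exp (2 * (- L z / 2))" unfolding E_def by (rule exp_double[symmetric])
    then show "(E z)\<^sup>2 * W z = 1" by (simp add: L(2)[symmetric] exp_minus)
  qed
  define w1 where "w1 z = g z * E z" for z
  define w2 where "w2 z = f2 z * E z" for z
  have h1: "w1 holomorphic_on UNIV" and h2: "w2 holomorphic_on UNIV"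
    unfolding w1_def w2_def by (intro holomorphic_intros gh fac E)+
  have dE: "(E has_field_derivative deriv E x) (at x)" for x by (rule holomorphic_derivI[OF E(1)]) auto
  have wr: "deriv w1 z * w2 z - w1 z * deriv w2 z = 1" for z
  proof -
    have "deriv w1 z = deriv g z * E z + deriv E z * g z" "deriv w2 z = deriv f2 z * E z + deriv E z * f2 z"
      unfolding w1_def w2_def by (intro DERIV_imp_deriv DERIV_mult dg df2 dE)+
    then have "deriv w1 z * w2 z - w1 z * deriv w2 z = (E z)\<^sup>2 * W z"
      by (simp add: w1_def w2_def W_def algebra_simps power2_eq_square)
    then show ?thesis using E(3) by simp
  qed
  have pole: "is_pole f z \<longleftrightarrow> w2 z = 0" for z using fac(5) E(2) by (simp add: w2_def)
  have fw: "f z = w1 z / w2 z" for z using fac(8) E(2)[of z] by (simp add: w1_def w2_def g_def)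
  have fd2: "(f has_field_derivative 1 / (w2 x)\<^sup>2) (at x)" if "w2 x \<noteq> 0" for x
  proof -
    have "f2 x \<noteq> 0" using that by (simp add: w2_def)
    moreover have "W x / (f2 x)\<^sup>2 = 1 / (w2 x)\<^sup>2"
      using E(3)[of x] E(2)[of x] \<open>f2 x \<noteq> 0\<close> by (simp add: w2_def field_simps power_mult_distrib)
    ultimately show ?thesis using fd[of x] by simp
  qed
  have evw: "\<forall>\<^sub>F x in at z. w2 x \<noteq> 0" for z
  proof -
    have "\<forall>\<^sub>F x in at z. f analytic_on {x}" using ns(1) by (simp add: isolated_singularity_at_altdef)
    then show ?thesis by eventually_elim (use pole analytic_at_imp_no_pole in blast)
  qed
  have hd: "(\<lambda>z. deriv (deriv w) z) holomorphic_on UNIV" "(\<lambda>z. - (poly S z / 2) * w z) holomorphic_on UNIV"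
    if "w holomorphic_on UNIV" for w
    by (intro holomorphic_deriv that holomorphic_intros; simp)+
  have ode2: "deriv (deriv w2) z = - (poly S z / 2) * w2 z" for z
  proof (rule entire_eq_if_eventually_eq[OF hd[OF h2]])
    show "\<forall>\<^sub>F x in at z. deriv (deriv w2) x = - (poly S x / 2) * w2 x"
      using evw[of z] Sev[of z]
    proof eventually_elim
      case (elim x)
      show ?case using schwarzian_quotient[OF h2 elim(1) fd2] elim(2) by simp
    qed
  qed
  \<comment> \<open>The Schwarzian yields the equation of the denominator only; that of the
    numerator comes from differentiating the constant Wronskian.\<close>
  have ode1: "deriv (deriv w1) z = - (poly S z / 2) * w1 z" for z
  proof (rule entire_eq_if_eventually_eq[OF hd[OF h1]])
    show "\<forall>\<^sub>F x in at z. deriv (deriv w1) x = - (poly S x / 2) * w1 x"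
      using evw[of z]
    proof eventually_elim
      case (elim x)
      have d: "(w1 has_field_derivative deriv w1 x) (at x)" "(w2 has_field_derivative deriv w2 x) (at x)"
        "(deriv w1 has_field_derivative deriv (deriv w1) x) (at x)" "(deriv w2 has_field_derivative deriv (deriv w2) x) (at x)"
        by (intro holomorphic_derivI[where S = UNIV] holomorphic_deriv h1 h2; simp)+
      have "((\<lambda>x. deriv w1 x * w2 x - w1 x * deriv w2 x) has_field_derivative
          (deriv (deriv w1) x * w2 x - w1 x * deriv (deriv w2) x)) (at x)"
        using d by (auto intro!: derivative_eq_intros)
      moreover have "(\<lambda>x. deriv w1 x * w2 x - w1 x * deriv w2 x) = (\<lambda>x. 1)" using wr by auto
      ultimately have "deriv (deriv w1) x * w2 x - w1 x * deriv (deriv w2) x = 0"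
        using DERIV_unique DERIV_const by metis
      then have "(deriv (deriv w1) x + poly S x / 2 * w1 x) * w2 x = 0" by (simp add: ode2 algebra_simps)
      then show ?case using elim by (simp add: add_eq_0_iff)
    qed
  qed
  show thesis by (rule that[OF h1 h2 ode1 ode2 pole fw wr])
qed

text \<open>For S = 0 both solutions are affine and f is rational. The case has to be excluded
  because the Liouville variable is built from a nonzero polynomial.\<close>

lemma transcendental_schwarzian_nonzero:
  assumes tm: "transcendental_meromorphic f" and S: "\<forall>\<^sub>\<approx>z. schwarzian f z = poly S z"
  shows "S \<noteq> 0"
proof
  assume "S = 0"
  obtain w1 w2 where w: "w1 holomorphic_on UNIV" "w2 holomorphic_on UNIV"
    "\<And>z. deriv (deriv w1) z = - (poly S z / 2) * w1 z"
    "\<And>z. deriv (deriv w2) z = - (poly S z / 2) * w2 z"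
    "\<And>z. is_pole f z \<longleftrightarrow> w2 z = 0" "\<And>z. w2 z \<noteq> 0 \<Longrightarrow> f z = w1 z / w2 z"
    "\<And>z. deriv w1 z * w2 z - w1 z * deriv w2 z = 1"
    using nevanlinna_quotient_of_solutions[OF tm S] by blast
  have lin: "u z = poly [:u 0, deriv u 0:] z"
    if u: "u holomorphic_on UNIV" "\<And>z. deriv (deriv u) z = 0" for u z
  proof -
    have "(deriv u has_field_derivative 0) (at x)" for x
      using holomorphic_derivI[OF holomorphic_deriv[OF u(1)] open_UNIV, of x] u(2) by simp
    then have c: "deriv u x = deriv u 0" for x
      using has_field_derivative_zero_constant[of UNIV "deriv u"] by auto
    have "((\<lambda>x. u x - deriv u 0 * x) has_field_derivative 0) (at x)" for x
      using holomorphic_derivI[OF u(1) open_UNIV, of x] c[of x] by (auto intro!: derivative_eq_intros)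
    then obtain c where "\<And>x. u x - deriv u 0 * x = c"
      using has_field_derivative_zero_constant[of UNIV "\<lambda>x. u x - deriv u 0 * x"] by auto
    from this[of z] this[of 0] have "u z - deriv u 0 * z = u 0 - deriv u 0 * 0" by simp
    then show ?thesis by (simp add: algebra_simps)
  qed
  define p where "p = [:w1 0, deriv w1 0:]"
  define q where "q = [:w2 0, deriv w2 0:]"
  have pq: "w1 z = poly p z" "w2 z = poly q z" for z
    unfolding p_def q_def using w \<open>S = 0\<close> by (intro lin; simp)+
  have "q \<noteq> 0" using w(7)[of 0] by (auto simp: q_def)
  moreover have "\<forall>z. poly q z \<noteq> 0 \<longrightarrow> f z = poly p z / poly q z" using w(6) pq by simp
  ultimately show False using tm unfolding transcendental_meromorphic_def by blast
qed

section \<open>Poles along a critical ray\<close>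

text \<open>With x reduced modulo pi, the squared modulus is (sin x)^2 + (sinh y)^2. The comparison
  is with cosh, the size of the separate exponentials, so that an error relative to these can be
  absorbed.\<close>

lemma sin_ge_cosh:
  fixes w :: complex
  assumes r: "0 < r" "r \<le> 1" and far: "\<And>k::int. norm (w - of_real pi * of_int k) \<ge> r"
  shows "norm (sin w) \<ge> r / 4 * cosh (Im w)"
proof -
  define k where "k = round (Re w / pi)"
  define x where "x = Re w - pi * of_int k"
  define y where "y = Im w"
  have sq: "(norm (sin w))\<^sup>2 = (sin x)\<^sup>2 + (sinh y)\<^sup>2"
  proof -
    have "w = of_real x + \<i> * of_real y + of_real pi * of_int k"
      by (simp add: complex_eq_iff x_def y_def)
    then have "sin w = sin (of_real x + \<i> * of_real y) * cos (of_real pi * of_int k) + cos (of_real x + \<i> * of_real y) * sin (of_real pi * of_int k)"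
      by (metis sin_add)
    moreover have "sin (of_real pi * of_int k :: complex) = 0" "norm (cos (of_real pi * of_int k :: complex)) = 1"
    proof -
      have "(of_real pi * of_int k :: complex) = of_real (pi * of_int k)" by simp
      moreover have "sin (pi * of_int k) = 0" by (simp add: sin_integer_2pi sin_zero_iff_int2 mult.commute)
      moreover have "\<bar>cos (pi * of_int k)\<bar> = 1"
        using sin_cos_squared_add[of "pi * of_int k"] \<open>sin (pi * of_int k) = 0\<close> by (simp add: power2_eq_1_iff abs_if)
      ultimately show "sin (of_real pi * of_int k :: complex) = 0" "norm (cos (of_real pi * of_int k :: complex)) = 1"
        by (metis of_real_0 sin_of_real, metis cos_of_real norm_of_real)
    qed
    ultimately have "norm (sin w) = norm (sin (of_real x + \<i> * of_real y))" by (simp add: norm_mult)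
    then have "(norm (sin w))\<^sup>2 = (sin x * cosh y)\<^sup>2 + (cos x * sinh y)\<^sup>2"
      by (simp add: cmod_power2 Re_sin Im_sin cosh_def sinh_def field_simps)
    also have "\<dots> = (sin x)\<^sup>2 + (sinh y)\<^sup>2"
    proof -
      have "(cosh y)\<^sup>2 = 1 + (sinh y)\<^sup>2" "(cos x)\<^sup>2 = 1 - (sin x)\<^sup>2"
        using cosh_square_eq[of y] cos_squared_eq[of x] by simp_all
      then show ?thesis unfolding power_mult_distrib by (simp only:) (simp add: algebra_simps)
    qed
    finally show ?thesis .
  qed
  have xb: "\<bar>x\<bar> \<le> pi / 2"
  proof -
    have "\<bar>of_int k - Re w / pi\<bar> \<le> 1 / 2" unfolding k_def by (rule of_int_round_abs_le)
    moreover have "x = - pi * (of_int k - Re w / pi)" by (simp add: x_def field_simps)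
    then have "\<bar>x\<bar> = pi * \<bar>of_int k - Re w / pi\<bar>" by (simp add: abs_mult)
    ultimately show ?thesis using mult_left_mono[of "\<bar>of_int k - Re w / pi\<bar>" "1 / 2" pi] by simp
  qed
  have "r\<^sup>2 \<le> (norm (w - of_real pi * of_int k))\<^sup>2" using far[of k] r by (intro power_mono) auto
  then have rxy: "r\<^sup>2 \<le> x\<^sup>2 + y\<^sup>2" by (simp add: cmod_power2 x_def y_def)
  have r1: "r\<^sup>2 \<le> 1" using r by (simp add: power_le_one)
  have s1: "y\<^sup>2 \<le> (sinh y)\<^sup>2"
  proof -
    have "\<bar>y\<bar> \<le> sinh \<bar>y\<bar>" using real_le_x_sinh[of "\<bar>y\<bar>"] by (simp add: sinh_field_def exp_minus del: sinh_real_abs)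
    then have "\<bar>y\<bar>\<^sup>2 \<le> (sinh \<bar>y\<bar>)\<^sup>2" by (intro power_mono) auto
    then show ?thesis by (simp add: sinh_real_abs)
  qed
  have s2: "x\<^sup>2 / 4 \<le> (sin x)\<^sup>2"
  proof -
    have "\<bar>x\<bar> / 2 \<le> sin \<bar>x\<bar>"
    proof -
      \<comment> \<open>The chord of the concave sine gives 2|x|/pi \<le> sin |x|, and pi < 4 turns
        this into |x|/2.\<close>
      have "concave_on {0..pi} sin" 
        by (rule f''_le0_imp_concave[where f' = cos and f'' = "\<lambda>x. - sin x"])
           (auto intro!: derivative_eq_intros sin_ge_zero)
      then have "(1 - 2 * \<bar>x\<bar> / pi) * sin 0 + (2 * \<bar>x\<bar> / pi) * sin (pi / 2) \<le> sin ((1 - 2 * \<bar>x\<bar> / pi) *\<^sub>R 0 + (2 * \<bar>x\<bar> / pi) *\<^sub>R (pi / 2))"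
        by (intro concave_onD) (use xb in \<open>auto simp: field_simps\<close>)
      then have "2 * \<bar>x\<bar> / pi \<le> sin \<bar>x\<bar>" by simp
      moreover have "pi * \<bar>x\<bar> \<le> 4 * \<bar>x\<bar>" using pi_less_4 by (intro mult_right_mono) auto
      then have "\<bar>x\<bar> / 2 \<le> 2 * \<bar>x\<bar> / pi" by (simp add: field_simps)
      ultimately show ?thesis by linarith
    qed
    then have "(\<bar>x\<bar> / 2)\<^sup>2 \<le> (sin \<bar>x\<bar>)\<^sup>2" by (intro power_mono) auto
    then show ?thesis by (simp add: power_divide abs_if split: if_splits)
  qed
  have "(r / 4 * cosh (Im w))\<^sup>2 = r\<^sup>2 / 16 * (1 + (sinh y)\<^sup>2)"
    using cosh_square_eq[of y] by (simp add: power_mult_distrib power_divide y_def)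
  also have "\<dots> \<le> (sin x)\<^sup>2 + (sinh y)\<^sup>2"
  proof -
    have "r\<^sup>2 / 16 * (sinh y)\<^sup>2 \<le> 1 / 16 * (sinh y)\<^sup>2" using r1 by (intro mult_right_mono) auto
    moreover have "r\<^sup>2 / 16 * (1 + (sinh y)\<^sup>2) = r\<^sup>2 / 16 + r\<^sup>2 / 16 * (sinh y)\<^sup>2" by (simp add: algebra_simps)
    ultimately show ?thesis using rxy s1 s2 zero_le_power2[of "sinh y"] zero_le_power2[of x] zero_le_power2[of y] by linarith
  qed
  also have "\<dots> = (norm (sin w))\<^sup>2" by (rule sq[symmetric])
  finally show ?thesis by (rule power2_le_imp_le) simp
qed

locale exponential_pair =
  fixes y1 y2 :: "complex \<Rightarrow> complex" and \<rho> K :: real and A1 B1 A2 B2 :: complex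
  assumes \<rho>: "\<rho> \<ge> 1" and K: "K > 0"
    and holo: "y1 holomorphic_on rdom \<rho>" "y2 holomorphic_on rdom \<rho>"
    and asym1: "\<And>v. v \<in> rdom \<rho> \<Longrightarrow> norm (y1 v - (A1 * exp (\<i> * v) + B1 * exp (- \<i> * v))) \<le>
         K / (Re v + \<bar>Im v\<bar>) * (norm A1 * exp (- Im v) + norm B1 * exp (Im v))"
    and asym2: "\<And>v. v \<in> rdom \<rho> \<Longrightarrow> norm (y2 v - (A2 * exp (\<i> * v) + B2 * exp (- \<i> * v))) \<le>
         K / (Re v + \<bar>Im v\<bar>) * (norm A2 * exp (- Im v) + norm B2 * exp (Im v))"
    and wronskian: "A1 * B2 \<noteq> A2 * B1"
begin

lemma dominant_growth:
  assumes "(b::real) > 0"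
  shows "eventually (\<lambda>t. M * ((1 + K) * (c * exp (- t))) < b * exp t - a * exp (- t) - K / (1 + t) * (a * exp (- t) + b * exp t)) at_top"
proof -
  have "((\<lambda>t. b - a * exp (- 2 * t) - K / (1 + t) * (a * exp (- 2 * t) + b) - M * ((1 + K) * c) * exp (- 2 * t)) \<longlongrightarrow> b) at_top"
    by real_asymp
  then have "eventually (\<lambda>t. b - a * exp (- 2 * t) - K / (1 + t) * (a * exp (- 2 * t) + b) - M * ((1 + K) * c) * exp (- 2 * t) > 0) at_top"
    using assms by (rule order_tendstoD)
  then show ?thesis
  proof eventually_elim
    case (elim t)
    have e: "exp (- 2 * t) * exp t = exp (- t)" by (simp add: exp_add[symmetric])
    have "0 < (b - a * exp (- 2 * t) - K / (1 + t) * (a * exp (- 2 * t) + b) - M * ((1 + K) * c) * exp (- 2 * t)) * exp t"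
      using elim by simp
    also have "\<dots> = b * exp t - a * (exp (- 2 * t) * exp t) - K / (1 + t) * (a * (exp (- 2 * t) * exp t) + b * exp t) - M * ((1 + K) * c) * (exp (- 2 * t) * exp t)"
      by (simp add: algebra_simps)
    finally show ?case unfolding e by (simp add: algebra_simps)
  qed
qed

text \<open>The exponential missing in y2 grows along one of the two vertical rays. On that ray y2
  decays, since its error is relative to the surviving term, while the nonzero determinant forces y1
  to contain the growing exponential. Hence y1/y2 tends to infinity there.\<close>

lemma quotient_unbounded_if_degenerate:
  assumes "A2 = 0 \<or> B2 = 0"
  obtains v :: "real \<Rightarrow> complex" where "continuous_on {0..} v" "\<And>t. t \<ge> 0 \<Longrightarrow> v t \<in> rdom \<rho>"
    "\<And>t. t \<ge> 0 \<Longrightarrow> norm (v t) \<ge> t"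
    "\<And>M. eventually (\<lambda>t. M * norm (y2 (v t)) < norm (y1 (v t))) at_top"
proof -
  note result = that
  \<comment> \<open>\<sigma> selects the upper or the lower ray; b and a are the moduli of the
    growing and the decaying coefficient of y1, and c is that of the only coefficient of y2.\<close>
  have main: thesis
    if sg: "\<sigma> = 1 \<or> \<sigma> = (-1::real)"
      and b: "b > 0" and a: "a \<ge> 0" and c: "c \<ge> 0"
      and vt: "\<And>t v. t \<ge> 0 \<Longrightarrow> v = of_real (\<rho> + 1) + \<i> * of_real (\<sigma> * t) \<Longrightarrow>
         norm (y1 v) \<ge> b * exp t - a * exp (- t) - K / (\<rho> + 1 + t) * (a * exp (- t) + b * exp t) \<and>
         norm (y2 v) \<le> c * exp (- t) + K / (\<rho> + 1 + t) * (c * exp (- t))"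
    for \<sigma> a b c
  proof (rule result[of "\<lambda>t. of_real (\<rho> + 1) + \<i> * of_real (\<sigma> * t)"])
    show "continuous_on {0..} (\<lambda>t. of_real (\<rho> + 1) + \<i> * of_real (\<sigma> * t) :: complex)"
      by (intro continuous_intros)
    fix t :: real assume "t \<ge> 0"
    then show "of_real (\<rho> + 1) + \<i> * of_real (\<sigma> * t) \<in> rdom \<rho>" by (simp add: rdom_def)
    have "\<bar>Im (of_real (\<rho> + 1) + \<i> * of_real (\<sigma> * t))\<bar> = t" using sg \<open>t \<ge> 0\<close> by auto
    then show "norm (of_real (\<rho> + 1) + \<i> * of_real (\<sigma> * t) :: complex) \<ge> t" by (metis abs_Im_le_cmod)
  next
    fix M :: real
    show "eventually (\<lambda>t. M * norm (y2 (of_real (\<rho> + 1) + \<i> * of_real (\<sigma> * t))) < norm (y1 (of_real (\<rho> + 1) + \<i> * of_real (\<sigma> * t)))) at_top"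
      using dominant_growth[OF b, of "\<bar>M\<bar>" c a] eventually_ge_at_top[of 0]
    proof eventually_elim
      case (elim t)
      define v where "v = complex_of_real (\<rho> + 1) + \<i> * of_real (\<sigma> * t)"
      note vv = vt[OF elim(2) v_def]
      have Kt: "K / (\<rho> + 1 + t) \<le> K / (1 + t)" "K / (1 + t) \<le> K" "K / (1 + t) \<ge> 0"
      proof -
        show "K / (\<rho> + 1 + t) \<le> K / (1 + t)" by (rule divide_left_mono) (use \<rho> K elim(2) in auto)
        have "K * 1 \<le> K * (1 + t)" using K elim(2) by (intro mult_left_mono) auto
        then show "K / (1 + t) \<le> K" using elim(2) by (simp add: divide_le_eq)
        show "K / (1 + t) \<ge> 0" using K elim(2) by simp
      qed
      have "norm (y2 v) \<le> c * exp (- t) + K / (\<rho> + 1 + t) * (c * exp (- t))" using vv by simp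
      also have "\<dots> \<le> c * exp (- t) + K * (c * exp (- t))"
        using Kt c by (intro add_left_mono mult_right_mono) auto
      finally have 1: "norm (y2 v) \<le> (1 + K) * (c * exp (- t))" by (simp add: algebra_simps)
      have "K / (\<rho> + 1 + t) * (a * exp (- t) + b * exp t) \<le> K / (1 + t) * (a * exp (- t) + b * exp t)"
        using Kt a b by (intro mult_right_mono) auto
      then have 2: "norm (y1 v) \<ge> b * exp t - a * exp (- t) - K / (1 + t) * (a * exp (- t) + b * exp t)"
        using vv by linarith
      have "M * norm (y2 v) \<le> \<bar>M\<bar> * norm (y2 v)" by (intro mult_right_mono) auto
      also have "\<dots> \<le> \<bar>M\<bar> * ((1 + K) * (c * exp (- t)))" by (intro mult_left_mono 1) auto
      finally show ?case using 2 elim(1) unfolding v_def by linarith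
    qed
  qed
  show thesis
  proof (cases "B2 = 0")
    case True
    then have nz: "B1 \<noteq> 0" "A2 \<noteq> 0" using wronskian by auto
    show thesis
    proof (rule main[where \<sigma> = 1 and b = "norm B1" and a = "norm A1" and c = "norm A2"])
      fix t v assume t: "t \<ge> (0::real)" and v: "v = of_real (\<rho> + 1) + \<i> * of_real (1 * t)"
      have vD: "v \<in> rdom \<rho>" "Re v + \<bar>Im v\<bar> = \<rho> + 1 + t" "Im v = t" using t by (auto simp: v rdom_def)
      have 1: "norm (A1 * exp (\<i> * v)) = norm A1 * exp (- t)" "norm (B1 * exp (- \<i> * v)) = norm B1 * exp t"
        "norm (A2 * exp (\<i> * v)) = norm A2 * exp (- t)" using vD by (auto simp: norm_mult)
      have "norm B1 * exp t \<le> norm (y1 v) + norm (A1 * exp (\<i> * v)) + norm (y1 v - (A1 * exp (\<i> * v) + B1 * exp (- \<i> * v)))"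
      proof -
        have "B1 * exp (- \<i> * v) = y1 v - A1 * exp (\<i> * v) - (y1 v - (A1 * exp (\<i> * v) + B1 * exp (- \<i> * v)))" by simp
        then show ?thesis unfolding 1(2)[symmetric] using norm_triangle_ineq4 norm_triangle_le_diff order_trans
          by (smt (verit))
      qed
      moreover have "norm (y2 v) \<le> norm (A2 * exp (\<i> * v)) + norm (y2 v - (A2 * exp (\<i> * v) + B2 * exp (- \<i> * v)))"
        using norm_triangle_sub[of "y2 v" "A2 * exp (\<i> * v)"] True by simp
      ultimately show "norm (y1 v) \<ge> norm B1 * exp t - norm A1 * exp (- t) - K / (\<rho> + 1 + t) * (norm A1 * exp (- t) + norm B1 * exp t) \<and>
         norm (y2 v) \<le> norm A2 * exp (- t) + K / (\<rho> + 1 + t) * (norm A2 * exp (- t))"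
        using asym1[OF vD(1), unfolded vD(2), unfolded vD(3)] asym2[OF vD(1), unfolded vD(2), unfolded vD(3)] True
        unfolding 1 by simp
    qed (use nz in auto)
  next
    case False
    then have A20: "A2 = 0" using assms by simp
    then have nz: "A1 \<noteq> 0" "B2 \<noteq> 0" using wronskian False by auto
    show thesis
    proof (rule main[where \<sigma> = "-1" and b = "norm A1" and a = "norm B1" and c = "norm B2"])
      fix t v assume t: "t \<ge> (0::real)" and v: "v = of_real (\<rho> + 1) + \<i> * of_real (- 1 * t)"
      have vD: "v \<in> rdom \<rho>" "Re v + \<bar>Im v\<bar> = \<rho> + 1 + t" "Im v = - t" using t by (auto simp: v rdom_def)
      have 1: "norm (A1 * exp (\<i> * v)) = norm A1 * exp t" "norm (B1 * exp (- \<i> * v)) = norm B1 * exp (- t)"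
        "norm (B2 * exp (- \<i> * v)) = norm B2 * exp (- t)" using vD by (auto simp: norm_mult)
      have "norm A1 * exp t \<le> norm (y1 v) + norm (B1 * exp (- \<i> * v)) + norm (y1 v - (A1 * exp (\<i> * v) + B1 * exp (- \<i> * v)))"
      proof -
        have "A1 * exp (\<i> * v) = y1 v - B1 * exp (- \<i> * v) - (y1 v - (A1 * exp (\<i> * v) + B1 * exp (- \<i> * v)))" by simp
        then show ?thesis unfolding 1(1)[symmetric] using norm_triangle_ineq4 norm_triangle_le_diff order_trans
          by (smt (verit))
      qed
      moreover have "norm (y2 v) \<le> norm (B2 * exp (- \<i> * v)) + norm (y2 v - (A2 * exp (\<i> * v) + B2 * exp (- \<i> * v)))"
        using norm_triangle_sub[of "y2 v" "B2 * exp (- \<i> * v)"] A20 by simp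
      ultimately show "norm (y1 v) \<ge> norm A1 * exp t - norm B1 * exp (- t) - K / (\<rho> + 1 + t) * (norm B1 * exp (- t) + norm A1 * exp t) \<and>
         norm (y2 v) \<le> norm B2 * exp (- t) + K / (\<rho> + 1 + t) * (norm B2 * exp (- t))"
        using asym1[OF vD(1), unfolded vD(2), unfolded vD(3)] asym2[OF vD(1), unfolded vD(2), unfolded vD(3)] A20
        unfolding 1 by (simp add: add.commute)
    qed (use nz in auto)
  qed
qed

text \<open>The quotient \<open>G0\<close> of the leading terms is pi-periodic with simple zeros at
  c + pi k, so its derivative there is one number \<Lambda>. Far to the right y2/y1 is uniformly
  close to \<open>G0\<close>, and Cauchy's inequality transfers this to derivatives. The last clause
  is the converse localisation: away from the lattice, y2 is comparable to its larger exponential,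
  so y1/y2 is bounded.\<close>

lemma zeros_on_lattice:
  assumes nz: "A2 \<noteq> 0" "B2 \<noteq> 0"
  obtains c \<Lambda> :: complex and r M U :: real and k0 :: nat where
    "r > 0" "r \<le> 1" "\<Lambda> \<noteq> 0" "M > 0"
    "\<And>k x. k \<ge> k0 \<Longrightarrow> x \<in> cball (c + of_real (pi * real k)) r \<Longrightarrow>
       x \<in> rdom \<rho> \<and> y1 x \<noteq> 0 \<and> (\<lambda>v. y2 v / y1 v) field_differentiable (at x) \<and>
       norm (deriv (\<lambda>v. y2 v / y1 v) x - \<Lambda>) \<le> norm \<Lambda> / 2"
    "\<And>k. k \<ge> k0 \<Longrightarrow> norm (y2 (c + of_real (pi * real k)) / y1 (c + of_real (pi * real k))) \<le> norm \<Lambda> * r / 8"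
    "\<And>v. v \<in> rdom \<rho> \<Longrightarrow> Re v + \<bar>Im v\<bar> \<ge> U \<Longrightarrow> M * norm (y2 v) < norm (y1 v) \<Longrightarrow>
       \<exists>k \<ge> k0. v \<in> cball (c + of_real (pi * real k)) r"
proof -
  \<comment> \<open>A zero of the leading part of y2, that is, a solution of exp(2 \<i> c) = -B2/A2;
    it exists because both coefficients are nonzero.\<close>
  define c where "c = Ln (- B2 / A2) / (2 * \<i>)"
  define n1 where "n1 v = A1 * exp (\<i> * v) + B1 * exp (- \<i> * v)" for v
  define n2 where "n2 v = A2 * exp (\<i> * v) + B2 * exp (- \<i> * v)" for v
  define N1 where "N1 v = norm A1 * exp (- Im v) + norm B1 * exp (Im v)" for v
  define N2 where "N2 v = norm A2 * exp (- Im v) + norm B2 * exp (Im v)" for v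
  define \<kappa> where "\<kappa> = A2 * exp (\<i> * c)"
  have \<kappa>: "\<kappa> \<noteq> 0" using nz by (simp add: \<kappa>_def)
  have "exp (2 * (\<i> * c)) = - B2 / A2"
  proof -
    have "2 * (\<i> * c) = Ln (- B2 / A2)" by (simp add: c_def)
    then show ?thesis using nz by simp
  qed
  then have ec: "A2 * (exp (\<i> * c))\<^sup>2 = - B2" using nz by (simp add: exp_double)
  have n2c: "B2 * exp (- \<i> * c) = - \<kappa>"
  proof -
    have "B2 * exp (- \<i> * c) = - A2 * exp (\<i> * c) * (exp (\<i> * c) * exp (- \<i> * c))"
      using ec by algebra
    also have "exp (\<i> * c) * exp (- \<i> * c) = 1" by (simp add: exp_add[symmetric])
    finally show ?thesis by (simp add: \<kappa>_def)
  qed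
  have n2_sin: "n2 v = 2 * \<i> * \<kappa> * sin (v - c)" for v
  proof -
    have e: "exp (\<i> * v) = exp (\<i> * c) * exp (\<i> * (v - c))" "exp (- \<i> * v) = exp (- \<i> * c) * exp (- (\<i> * (v - c)))"
      by (simp_all only: exp_add[symmetric]) (simp_all add: algebra_simps)
    have "n2 v = A2 * exp (\<i> * c) * exp (\<i> * (v - c)) + B2 * exp (- \<i> * c) * exp (- (\<i> * (v - c)))"
      unfolding n2_def e by (simp only: mult.assoc)
    also have "\<dots> = \<kappa> * (exp (\<i> * (v - c)) - exp (- (\<i> * (v - c))))"
      unfolding n2c by (simp add: \<kappa>_def algebra_simps)
    also have "exp (\<i> * (v - c)) - exp (- (\<i> * (v - c))) = 2 * \<i> * sin (v - c)"
      by (simp add: sin_exp_eq)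
    finally show ?thesis by simp
  qed
  have N2_cosh: "N2 v = 2 * norm \<kappa> * cosh (Im (v - c))" for v
  proof -
    have a: "norm A2 = norm \<kappa> * exp (Im c)" by (simp add: \<kappa>_def norm_mult exp_add[symmetric])
    have "norm (B2 * exp (- \<i> * c)) = norm \<kappa>" unfolding n2c by simp
    then have "norm B2 * exp (Im c) = norm \<kappa>" by (simp add: norm_mult)
    then have b: "norm B2 = norm \<kappa> * exp (- Im c)" by (simp add: exp_minus field_simps)
    show ?thesis unfolding N2_def a b
      by (simp add: cosh_field_def exp_add[symmetric] exp_diff exp_minus field_simps)
  qed
  have dn: "(n1 has_field_derivative \<i> * (A1 * exp (\<i> * v) - B1 * exp (- \<i> * v))) (at v)"
    "(n2 has_field_derivative \<i> * (A2 * exp (\<i> * v) - B2 * exp (- \<i> * v))) (at v)" for v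
    unfolding n1_def n2_def by (auto intro!: derivative_eq_intros simp: algebra_simps)
  have cn: "continuous_on UNIV n1" "continuous_on UNIV n2"
    using dn by (auto intro!: continuous_at_imp_continuous_on DERIV_isCont)
  have n2c0: "n2 c = 0" by (simp add: n2_sin)
  have n1c: "n1 c \<noteq> 0"
  proof
    assume "n1 c = 0"
    then have "A1 * exp (\<i> * c) = - (B1 * exp (- \<i> * c))" "A2 * exp (\<i> * c) = - (B2 * exp (- \<i> * c))"
      using n2c0 by (simp_all add: n1_def n2_def add_eq_0_iff2)
    then have "(A1 * B2) * (exp (\<i> * c) * exp (- \<i> * c)) = (A2 * B1) * (exp (\<i> * c) * exp (- \<i> * c))"
      by algebra
    then show False using wronskian by (simp add: exp_add[symmetric])
  qed
  define V where "V = {v. n1 v \<noteq> 0}"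
  have V: "open V" "c \<in> V" unfolding V_def using n1c cn(1) by (auto intro!: open_Collect_neq continuous_intros)
  define G0 where "G0 v = n2 v / n1 v" for v
  have G0h: "G0 holomorphic_on V"
    unfolding G0_def V_def using dn by (intro holomorphic_intros) (auto simp: holomorphic_on_def field_differentiable_def intro: has_field_derivative_at_within)
  define \<Lambda> where "\<Lambda> = deriv G0 c"
  have "(G0 has_field_derivative ((\<i> * (A2 * exp (\<i> * c) - B2 * exp (- \<i> * c))) * n1 c - n2 c * (\<i> * (A1 * exp (\<i> * c) - B1 * exp (- \<i> * c)))) / (n1 c * n1 c)) (at c)"
    unfolding G0_def by (intro DERIV_divide dn n1c)
  then have "\<Lambda> = ((\<i> * (A2 * exp (\<i> * c) - B2 * exp (- \<i> * c))) * n1 c - n2 c * (\<i> * (A1 * exp (\<i> * c) - B1 * exp (- \<i> * c)))) / (n1 c * n1 c)"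
    unfolding \<Lambda>_def by (rule DERIV_imp_deriv)
  then have \<Lambda>: "\<Lambda> \<noteq> 0" using n1c \<kappa> unfolding n2c n2c0 \<kappa>_def[symmetric] by simp
  have "isCont (deriv G0) c"
    using holomorphic_deriv[OF G0h V(1)] V by (auto simp: continuous_on_eq_continuous_at dest!: holomorphic_on_imp_continuous_on)
  then have "\<forall>\<^sub>F v in nhds c. dist (deriv G0 v) \<Lambda> < norm \<Lambda> / 4"
    using \<Lambda> unfolding \<Lambda>_def by (intro tendstoD) (auto simp: isCont_def tendsto_at_iff_tendsto_nhds)
  moreover have "\<forall>\<^sub>F v in nhds c. v \<in> V" using V by (rule eventually_nhds_in_open)
  ultimately have "\<forall>\<^sub>F v in nhds c. v \<in> V \<and> dist (deriv G0 v) \<Lambda> < norm \<Lambda> / 4" by eventually_elim auto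
  then obtain r1 where r1: "r1 > 0" "\<And>v. dist v c < r1 \<Longrightarrow> v \<in> V \<and> dist (deriv G0 v) \<Lambda> < norm \<Lambda> / 4"
    unfolding eventually_nhds_metric by blast
  \<comment> \<open>The estimates hold on the larger disc of radius 2r, which leaves room for
    Cauchy's inequality on circles of radius r/2 around points of the disc of radius r.\<close>
  define r where "r = min 1 (r1 / 4)"
  have r: "r > 0" "r \<le> 1" "2 * r < r1" using r1(1) by (auto simp: r_def)
  have r2: "v \<in> V \<and> norm (deriv G0 v - \<Lambda>) \<le> norm \<Lambda> / 4" if "v \<in> cball c (2 * r)" for v
    using r1(2)[of v] that r(3) by (auto simp: dist_norm norm_minus_commute)
  have "\<exists>x\<in>cball c (2 * r). \<forall>y\<in>cball c (2 * r). norm (n1 x) \<le> norm (n1 y)"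
    by (rule continuous_attains_inf) (use r cn in \<open>auto intro!: continuous_intros intro: continuous_on_subset\<close>)
  then obtain x0 where x0: "x0 \<in> cball c (2 * r)" "\<And>y. y \<in> cball c (2 * r) \<Longrightarrow> norm (n1 x0) \<le> norm (n1 y)" by blast
  define \<nu> where "\<nu> = norm (n1 x0)"
  have \<nu>: "\<nu> > 0" using r2[OF x0(1)] by (simp add: \<nu>_def V_def)
  define Nb where "Nb = (norm A1 + norm B1 + norm A2 + norm B2) * exp (norm c + 2)"
  have Nb: "N1 v \<le> Nb" "N2 v \<le> Nb" if "\<bar>Im v\<bar> \<le> norm c + 2" for v
  proof -
    have e: "exp (- Im v) \<le> exp (norm c + 2)" "exp (Im v) \<le> exp (norm c + 2)" using that by auto
    have "N1 v \<le> norm A1 * exp (norm c + 2) + norm B1 * exp (norm c + 2)"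
      unfolding N1_def by (intro add_mono mult_left_mono e) auto
    also have "\<dots> \<le> Nb" by (simp add: Nb_def algebra_simps)
    finally show "N1 v \<le> Nb" .
    have "N2 v \<le> norm A2 * exp (norm c + 2) + norm B2 * exp (norm c + 2)"
      unfolding N2_def by (intro add_mono mult_left_mono e) auto
    also have "\<dots> \<le> Nb" by (simp add: Nb_def algebra_simps)
    finally show "N2 v \<le> Nb" .
  qed
  have Nb0: "Nb > 0" unfolding Nb_def using nz by (intro mult_pos_pos add_nonneg_pos) auto
  have n_le: "norm (n1 v) \<le> N1 v" "norm (n2 v) \<le> N2 v" for v
    unfolding n1_def n2_def N1_def N2_def by (rule order_trans[OF norm_triangle_ineq]; simp add: norm_mult)+
  \<comment> \<open>Divided by the Cauchy radius r/2 this tolerance becomes |\<Lambda>|/4. It is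
    also the value allowed at the centre of a disc when equations G x = w are solved there.\<close>
  define E where "E = norm \<Lambda> * r / 8"
  have E: "E > 0" using \<Lambda> r by (simp add: E_def)
  \<comment> \<open>The first entry keeps the discs in the domain, the second keeps |y1| above half
    the minimum \<nu> of |n1|, and the third brings the two quotients within \<open>E\<close> of
    each other.\<close>
  define X where "X = max (\<rho> + 1) (max (2 * K * Nb / \<nu>) (4 * K * Nb\<^sup>2 / (\<nu>\<^sup>2 * E)))"
  define k0 where "k0 = nat \<lceil>X + norm c + 3\<rceil>"
  have X0: "X > 0" using \<rho> by (simp add: X_def)
  have shift: "x - of_real (pi * real k) \<in> cball c R" if "x \<in> cball (c + of_real (pi * real k)) R" for x k R
    using that by (simp add: dist_norm algebra_simps)
  have per: "n1 (x - of_real (pi * real k)) = (- 1) ^ k * n1 x" "n2 (x - of_real (pi * real k)) = (- 1) ^ k * n2 x" for x k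
  proof -
    have e1: "exp (- (\<i> * of_real (pi * real k))) = (- 1) ^ k"
    proof (induction k)
      case (Suc k)
      have "exp (- (\<i> * of_real (pi * real (Suc k)))) = exp (- (\<i> * of_real (pi * real k))) * exp (- (\<i> * of_real pi))"
        by (simp only: exp_add[symmetric]) (simp add: algebra_simps)
      also have "exp (- (\<i> * of_real pi)) = - 1" by (simp add: exp_minus)
      finally show ?case using Suc by simp
    qed simp
    have "exp (\<i> * of_real (pi * real k)) = inverse (exp (- (\<i> * of_real (pi * real k))))" by (simp add: exp_minus)
    then have e2: "exp (\<i> * of_real (pi * real k)) = (- 1) ^ k" unfolding e1 by (simp add: power_inverse[symmetric])
    have "exp (\<i> * (x - of_real (pi * real k))) = exp (\<i> * x) * (- 1) ^ k"
      unfolding e1[symmetric] exp_add[symmetric] by (simp add: algebra_simps)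
    moreover have "exp (- \<i> * (x - of_real (pi * real k))) = exp (- \<i> * x) * (- 1) ^ k"
      unfolding e2[symmetric] exp_add[symmetric] by (simp add: algebra_simps)
    ultimately show "n1 (x - of_real (pi * real k)) = (- 1) ^ k * n1 x" "n2 (x - of_real (pi * real k)) = (- 1) ^ k * n2 x"
      unfolding n1_def n2_def by (simp_all add: algebra_simps)
  qed
  have G0per: "G0 (x - of_real (pi * real k)) = G0 x" for x k unfolding G0_def per by simp
  have loc: "x \<in> rdom \<rho>" "norm (y1 x - n1 x) \<le> K * Nb / X" "norm (y2 x - n2 x) \<le> K * Nb / X"
      "norm (n1 x) \<ge> \<nu>" "norm (n1 x) \<le> Nb" "norm (n2 x) \<le> Nb" "n1 x \<noteq> 0"
    if k: "k \<ge> k0" and x: "x \<in> cball (c + of_real (pi * real k)) (2 * r)" for k x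
  proof -
    define d where "d = x - of_real (pi * real k) - c"
    have d: "norm d \<le> 2" using shift[OF x] r by (simp add: d_def dist_norm norm_minus_commute algebra_simps)
    have xd: "x = c + d + of_real (pi * real k)" by (simp add: d_def)
    have Imx: "\<bar>Im x\<bar> \<le> norm c + 2" using abs_Im_le_cmod[of c] abs_Im_le_cmod[of d] d by (simp add: xd)
    have "real k \<ge> X + norm c + 3" using k unfolding k0_def by linarith
    moreover have "pi * real k \<ge> 1 * real k" using pi_gt3 by (intro mult_right_mono) auto
    ultimately have Rex: "Re x \<ge> X + 1" using abs_Re_le_cmod[of c] abs_Re_le_cmod[of d] d by (simp add: xd)
    have u: "Re x + \<bar>Im x\<bar> \<ge> X" using Rex by simp
    show xr: "x \<in> rdom \<rho>" using u by (simp add: rdom_def X_def)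
    have Kb: "K / (Re x + \<bar>Im x\<bar>) * N \<le> K * Nb / X" if "N \<le> Nb" "N \<ge> 0" for N
    proof -
      have "K / (Re x + \<bar>Im x\<bar>) * N \<le> K / X * Nb"
        using u X0 K that by (intro mult_mono divide_left_mono) auto
      then show ?thesis by simp
    qed
    show "norm (y1 x - n1 x) \<le> K * Nb / X"
      using asym1[OF xr] Kb[OF Nb(1)[OF Imx]] by (simp add: n1_def N1_def)
    show "norm (y2 x - n2 x) \<le> K * Nb / X"
      using asym2[OF xr] Kb[OF Nb(2)[OF Imx]] by (simp add: n2_def N2_def)
    have "norm (n1 (x - of_real (pi * real k))) = norm (n1 x)" unfolding per by (simp add: norm_mult norm_power)
    then show "norm (n1 x) \<ge> \<nu>" using x0(2)[OF shift[OF x]] by (simp add: \<nu>_def)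
    then show "n1 x \<noteq> 0" using \<nu> by auto
    show "norm (n1 x) \<le> Nb" "norm (n2 x) \<le> Nb" using n_le[of x] Nb[OF Imx] by linarith+
  qed
  have KX: "K * Nb / X \<le> \<nu> / 2" "4 * (K * Nb / X) * Nb / \<nu>\<^sup>2 \<le> E"
  proof -
    have "2 * K * Nb / \<nu> \<le> X" "4 * K * Nb\<^sup>2 / (\<nu>\<^sup>2 * E) \<le> X" by (simp_all add: X_def)
    then have "2 * K * Nb \<le> X * \<nu>" "4 * K * Nb\<^sup>2 \<le> X * (\<nu>\<^sup>2 * E)"
      using \<nu> E by (simp_all only: pos_divide_le_eq mult_pos_pos zero_less_power)
    then show "K * Nb / X \<le> \<nu> / 2" "4 * (K * Nb / X) * Nb / \<nu>\<^sup>2 \<le> E"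
      using X0 \<nu> by (simp_all add: divide_le_eq power2_eq_square mult_ac)
  qed
  define G where "G v = y2 v / y1 v" for v
  have y1nz: "norm (y1 x) \<ge> \<nu> / 2" "y1 x \<noteq> 0" if "k \<ge> k0" "x \<in> cball (c + of_real (pi * real k)) (2 * r)" for k x
  proof -
    show "norm (y1 x) \<ge> \<nu> / 2"
      using loc(2,4)[OF that] KX(1) norm_triangle_ineq2[of "n1 x" "y1 x"] norm_minus_commute[of "y1 x" "n1 x"] by linarith
    then show "y1 x \<noteq> 0" using \<nu> by auto
  qed
  have GG0: "norm (G x - G0 x) \<le> E" if "k \<ge> k0" "x \<in> cball (c + of_real (pi * real k)) (2 * r)" for k x
  proof -
    note l = loc[OF that] and n = y1nz[OF that]
    have "G x - G0 x = ((y2 x - n2 x) * n1 x - n2 x * (y1 x - n1 x)) / (y1 x * n1 x)"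
      unfolding G_def G0_def using n(2) l(7) by (simp add: field_simps)
    then have "norm (G x - G0 x) = norm ((y2 x - n2 x) * n1 x - n2 x * (y1 x - n1 x)) / (norm (y1 x) * norm (n1 x))"
      by (simp add: norm_divide norm_mult)
    also have "\<dots> \<le> ((K * Nb / X) * Nb + Nb * (K * Nb / X)) / (\<nu> / 2 * \<nu>)"
    proof (rule frac_le)
      have "norm ((y2 x - n2 x) * n1 x) \<le> (K * Nb / X) * Nb" "norm (n2 x * (y1 x - n1 x)) \<le> Nb * (K * Nb / X)"
        unfolding norm_mult using l Nb0 K X0 by (intro mult_mono; simp)+
      then show "norm ((y2 x - n2 x) * n1 x - n2 x * (y1 x - n1 x)) \<le> (K * Nb / X) * Nb + Nb * (K * Nb / X)"
        using norm_triangle_ineq4[of "(y2 x - n2 x) * n1 x" "n2 x * (y1 x - n1 x)"] by linarith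
      show "\<nu> / 2 * \<nu> \<le> norm (y1 x) * norm (n1 x)" using l n \<nu> by (intro mult_mono) auto
    qed (use \<nu> Nb0 K X0 in auto)
    also have "\<dots> = 4 * (K * Nb / X) * Nb / \<nu>\<^sup>2" using \<nu> by (simp add: field_simps power2_eq_square)
    finally show ?thesis using KX(2) by linarith
  qed
  have G0d: "(G0 has_field_derivative deriv G0 (x - of_real (pi * real k))) (at x)"
    if "x \<in> cball (c + of_real (pi * real k)) (2 * r)" for k x
  proof -
    have "x - of_real (pi * real k) \<in> V" using r2[OF shift[OF that]] by simp
    then have d: "(G0 has_field_derivative deriv G0 (x - of_real (pi * real k))) (at (x - of_real (pi * real k)))"
      by (rule holomorphic_derivI[OF G0h V(1)])
    have "((\<lambda>x. x - of_real (pi * real k)) has_field_derivative 1) (at x)" by (auto intro!: derivative_eq_intros)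
    from DERIV_chain2[OF d this] show ?thesis by (simp only: G0per mult_1_right)
  qed
  have Gd: "(G has_field_derivative deriv G x) (at x)" if "k \<ge> k0" "x \<in> cball (c + of_real (pi * real k)) (2 * r)" for k x
  proof -
    have "y1 field_differentiable (at x)" "y2 field_differentiable (at x)"
      using holomorphic_on_imp_differentiable_at[OF _ open_rdom loc(1)[OF that]] holo by blast+
    then have "(\<lambda>v. y2 v / y1 v) field_differentiable (at x)"
      by (intro field_differentiable_divide y1nz(2)[OF that])
    then show ?thesis unfolding G_def by (simp add: field_differentiable_derivI)
  qed
  have dG: "norm (deriv G x - \<Lambda>) \<le> norm \<Lambda> / 2"
    if k: "k \<ge> k0" and x: "x \<in> cball (c + of_real (pi * real k)) r" for k x
  proof -
    have sub: "cball x (r / 2) \<subseteq> cball (c + of_real (pi * real k)) (2 * r)"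
    proof
      fix y assume "y \<in> cball x (r / 2)"
      then show "y \<in> cball (c + of_real (pi * real k)) (2 * r)"
        using x r dist_triangle[of "c + of_real (pi * real k)" y x] by auto
    qed
    have x2: "x \<in> cball (c + of_real (pi * real k)) (2 * r)" using x r by simp
    have "norm ((deriv ^^ 1) (\<lambda>v. G v - G0 v) x) \<le> fact 1 * E / (r / 2) ^ 1"
    proof (rule Cauchy_inequality)
      have "(\<lambda>v. G v - G0 v) field_differentiable (at v)" if "v \<in> cball x (r / 2)" for v
        using Gd[OF k subsetD[OF sub that]] G0d[OF subsetD[OF sub that]] field_differentiable_diff
        unfolding field_differentiable_def by blast
      then have "(\<lambda>v. G v - G0 v) holomorphic_on cball x (r / 2)"
        by (auto simp: holomorphic_on_def intro: field_differentiable_at_within)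
      then show "(\<lambda>v. G v - G0 v) holomorphic_on ball x (r / 2)" "continuous_on (cball x (r / 2)) (\<lambda>v. G v - G0 v)"
        by (auto intro: holomorphic_on_subset holomorphic_on_imp_continuous_on)
      show "norm (G v - G0 v) \<le> E" if "norm (x - v) = r / 2" for v
        by (rule GG0[OF k subsetD[OF sub]]) (use that in \<open>simp add: dist_norm\<close>)
    qed (use r in auto)
    moreover have "deriv (\<lambda>v. G v - G0 v) x = deriv G x - deriv G0 (x - of_real (pi * real k))"
      by (intro DERIV_imp_deriv DERIV_diff Gd[OF k x2] G0d x2)
    ultimately have "norm (deriv G x - deriv G0 (x - of_real (pi * real k))) \<le> E / (r / 2)" by simp
    also have "\<dots> = norm \<Lambda> / 4" using r by (simp add: E_def)
    finally have "norm (deriv G x - deriv G0 (x - of_real (pi * real k))) \<le> norm \<Lambda> / 4" .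
    moreover have "norm (deriv G0 (x - of_real (pi * real k)) - \<Lambda>) \<le> norm \<Lambda> / 4"
      using r2[OF shift[OF x2]] by simp
    ultimately show ?thesis
      using norm_triangle_ineq[of "deriv G x - deriv G0 (x - of_real (pi * real k))" "deriv G0 (x - of_real (pi * real k)) - \<Lambda>"] by simp
  qed
  define C1 where "C1 = 2 * (norm A1 + norm B1) * exp (norm c)"
  have N1c: "N1 v \<le> C1 * cosh (Im (v - c))" for v
  proof -
    define h where "h = cosh (Im (v - c))"
    have h: "exp (Im (v - c)) \<le> 2 * h" "exp (- Im (v - c)) \<le> 2 * h"
      by (simp_all add: h_def cosh_field_def)
    have "exp (Im v) = exp (Im c) * exp (Im (v - c))" "exp (- Im v) = exp (- Im c) * exp (- Im (v - c))"
      by (simp_all add: exp_add[symmetric])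
    moreover have "exp (Im c) \<le> exp (norm c)" "exp (- Im c) \<le> exp (norm c)"
      using abs_Im_le_cmod[of c] by auto
    ultimately have e: "exp (Im v) \<le> exp (norm c) * (2 * h)" "exp (- Im v) \<le> exp (norm c) * (2 * h)"
      using h by (auto intro!: mult_mono)
    have "N1 v \<le> norm A1 * (exp (norm c) * (2 * h)) + norm B1 * (exp (norm c) * (2 * h))"
      unfolding N1_def by (intro add_mono mult_left_mono e) auto
    then show ?thesis by (simp add: C1_def h_def algebra_simps)
  qed
  have C1: "C1 > 0"
  proof -
    have "A1 \<noteq> 0 \<or> B1 \<noteq> 0" using wronskian by auto
    then have "norm A1 + norm B1 > 0" by (auto intro: add_pos_nonneg add_nonneg_pos)
    then show ?thesis by (simp add: C1_def)
  qed
  \<comment> \<open>With this factor the lower bound for M |y2| away from the lattice becomes 2 C1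
    cosh(Im(v - c)), which is the upper bound for |y1|.\<close>
  define M where "M = 8 * C1 / (norm \<kappa> * r)"
  have M: "M > 0" using C1 \<kappa> r by (simp add: M_def)
  \<comment> \<open>The terms with K make K/u at most 1 and at most r/8; the others push the lattice
    index past \<open>k0\<close>, with 4 standing for an upper bound of pi.\<close>
  define U where "U = K + 8 * K / r + 4 * real k0 + 2 * norm c + 3"
  show thesis
  proof (rule that[of r \<Lambda> M k0 c U])
    fix k x assume k: "k \<ge> k0" and x: "x \<in> cball (c + of_real (pi * real k)) r"
    have x2: "x \<in> cball (c + of_real (pi * real k)) (2 * r)" using x r by auto
    show "x \<in> rdom \<rho> \<and> y1 x \<noteq> 0 \<and> (\<lambda>v. y2 v / y1 v) field_differentiable (at x) \<and>
       norm (deriv (\<lambda>v. y2 v / y1 v) x - \<Lambda>) \<le> norm \<Lambda> / 2"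
      using loc(1)[OF k x2] y1nz(2)[OF k x2] Gd[OF k x2] dG[OF k x] unfolding G_def field_differentiable_def by blast
  next
    fix k assume k: "k \<ge> k0"
    have "G0 (c + of_real (pi * real k)) = 0" using G0per[of "c + of_real (pi * real k)" k] n2c0 by (simp add: G0_def)
    then show "norm (y2 (c + of_real (pi * real k)) / y1 (c + of_real (pi * real k))) \<le> norm \<Lambda> * r / 8"
      using GG0[OF k, of "c + of_real (pi * real k)"] r by (simp add: G_def E_def)
  next
    fix v assume v: "v \<in> rdom \<rho>" "Re v + \<bar>Im v\<bar> \<ge> U" "M * norm (y2 v) < norm (y1 v)"
    define u where "u = Re v + \<bar>Im v\<bar>"
    have u: "u \<ge> K + 8 * K / r + 4 * real k0 + 2 * norm c + 3" using v(2) by (simp add: u_def U_def)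
    have Kr: "8 * K / r > 0" using K r by simp
    have u0: "u > 0" "u \<ge> K" "u \<ge> 8 * K / r" using u K Kr norm_ge_zero[of c] by linarith+
    define h where "h = cosh (Im (v - c))"
    have h: "h > 0" by (simp add: h_def)
    have Ku: "K / u \<le> 1" "K / u \<le> r / 8" using u0 K r by (simp_all add: divide_le_eq field_simps)
    have "\<exists>k::int. norm ((v - c) - of_real pi * of_int k) < r"
    proof (rule ccontr)
      assume "\<not> (\<exists>k::int. norm ((v - c) - of_real pi * of_int k) < r)"
      then have "norm (sin (v - c)) \<ge> r / 4 * h"
        unfolding h_def by (intro sin_ge_cosh r) (auto simp: not_less)
      then have "2 * norm \<kappa> * (r / 4 * h) \<le> 2 * norm \<kappa> * norm (sin (v - c))"
        by (intro mult_left_mono) auto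
      also have "\<dots> = norm (n2 v)" unfolding n2_sin by (simp add: norm_mult)
      finally have "norm (n2 v) \<ge> 2 * norm \<kappa> * (r / 4 * h)" .
      moreover have "norm (y2 v - n2 v) \<le> r / 8 * (2 * norm \<kappa> * h)"
      proof -
        have "norm (y2 v - n2 v) \<le> K / u * N2 v" using asym2[OF v(1)] by (simp add: n2_def N2_def u_def)
        also have "\<dots> \<le> r / 8 * N2 v" by (intro mult_right_mono Ku) (simp add: N2_def)
        finally show ?thesis by (simp add: N2_cosh h_def)
      qed
      ultimately have "norm (y2 v) \<ge> norm \<kappa> * r / 4 * h"
        using norm_triangle_ineq2[of "n2 v" "y2 v"] norm_minus_commute[of "n2 v" "y2 v"] by (simp add: algebra_simps)
      then have "M * norm (y2 v) \<ge> M * (norm \<kappa> * r / 4 * h)" using M by (intro mult_left_mono) auto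
      also have "M * (norm \<kappa> * r / 4 * h) = 2 * C1 * h" using \<kappa> r by (simp add: M_def)
      finally have 1: "2 * C1 * h \<le> M * norm (y2 v)" .
      have "norm (y1 v - n1 v) \<le> K / u * N1 v" using asym1[OF v(1)] by (simp add: n1_def N1_def u_def)
      also have "\<dots> \<le> 1 * N1 v" by (intro mult_right_mono Ku) (simp add: N1_def)
      finally have "norm (y1 v) \<le> 2 * N1 v" using n_le(1)[of v] norm_triangle_sub[of "y1 v" "n1 v"] by linarith
      then have "norm (y1 v) \<le> 2 * C1 * h" using N1c[of v] by (simp add: h_def)
      then show False using 1 v(3) by linarith
    qed
    then obtain k :: int where k: "norm ((v - c) - of_real pi * of_int k) < r" by blast
    define d where "d = (v - c) - of_real pi * of_int k"
    have d: "norm d \<le> 1" using k r by (simp add: d_def)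
    have vd: "v = c + d + of_real (pi * of_int k)" by (simp add: d_def)
    have "u \<le> 2 * norm c + 2 + pi * of_int k"
      using abs_Re_le_cmod[of c] abs_Re_le_cmod[of d] abs_Im_le_cmod[of c] abs_Im_le_cmod[of d] d
      unfolding u_def by (simp add: vd)
    then have pk: "pi * of_int k > 4 * real k0" using u Kr K by linarith
    have "k \<ge> int k0"
    proof (rule ccontr)
      assume "\<not> k \<ge> int k0"
      then have "real_of_int k \<le> real k0" by linarith
      then have "pi * of_int k \<le> pi * real k0" by (intro mult_left_mono) auto
      also have "\<dots> \<le> 4 * real k0" using pi_less_4 by (intro mult_right_mono) auto
      finally show False using pk by linarith
    qed
    then obtain k' where k': "k = int k'" "k' \<ge> k0" by (metis nat_0_le of_nat_0_le_iff order_trans zero_le_imp_eq_int of_nat_le_iff)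
    show "\<exists>k\<ge>k0. v \<in> cball (c + of_real (pi * real k)) r"
      using k k' by (intro exI[of _ k']) (auto simp: dist_norm norm_minus_commute algebra_simps)
  qed (use r \<Lambda> M in auto)
qed

end

section \<open>From the lattice in a chart to the poles in the plane\<close>

text \<open>The value \<open>None\<close> belongs to every neighbourhood of infinity, so a curve may
  run through poles and only the finite values have to be estimated.\<close>

lemma limitin_Alexandroff_None:
  fixes g :: "'b \<Rightarrow> 'a::metric_space option"
  assumes "\<And>M. \<forall>\<^sub>F t in F. \<forall>w. g t = Some w \<longrightarrow> dist w a > M"
  shows "limitin (Alexandroff_compactification euclidean) g None F"
  unfolding limitin_def
proof (intro conjI allI impI)
  fix U :: "'a option set"
  assume U: "openin (Alexandroff_compactification euclidean) U \<and> None \<in> U"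
  then obtain C where C: "compact C" "U = insert None (Some ` (- C))"
    by (auto simp: openin_Alexandroff_compactification compactin_euclidean_iff)
  obtain M where M: "\<And>w. w \<in> C \<Longrightarrow> dist a w \<le> M"
    using compact_imp_bounded[OF C(1)] unfolding bounded_any_center[of C a] by blast
  show "\<forall>\<^sub>F t in F. g t \<in> U"
    using assms[of M]
  proof eventually_elim
    case (elim t)
    show ?case
    proof (cases "g t")
      case (Some w)
      then have "w \<notin> C" using elim M[of w] by (force simp: dist_commute)
      then show ?thesis using Some C(2) by auto
    qed (use C in auto)
  qed
qed auto

text \<open>On such a box |v| is comparable to N and the argument of the derivative of Z is nearly
  constant, so Z is bi-Lipschitz with factor N^(\<alpha>-1). The number 18 is 9, from |v| \<le> 9N,
  times 2, from the half in the argument condition. The range up to 8N accommodates lattice indices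
  up to 2N at spacing pi.\<close>

lemma liouville_chart_box:
  fixes P :: "complex poly" and B :: real
  defines "\<alpha> \<equiv> 2 / (real (degree P) + 2)"
  assumes ch: "liouville_chart P C \<rho> Z p \<theta>" and C: "C > 0" and B: "B \<ge> 0"
  obtains k1 :: nat where "k1 > 0"
    "\<And>N u v. k1 \<le> N \<Longrightarrow> real N \<le> Re u \<Longrightarrow> Re u \<le> 8 * real N \<Longrightarrow> \<bar>Im u\<bar> \<le> B \<Longrightarrow>
       real N \<le> Re v \<Longrightarrow> Re v \<le> 8 * real N \<Longrightarrow> \<bar>Im v\<bar> \<le> B \<Longrightarrow>
       real N powr \<alpha> \<le> 18 * C * norm (Z u) \<and> norm (Z u) \<le> 18 * C * real N powr \<alpha> \<and>
       norm (Z u - Z v) \<le> 18 * C * real N powr (\<alpha> - 1) * norm (u - v) \<and>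
       real N powr (\<alpha> - 1) * norm (u - v) \<le> 18 * C * norm (Z u - Z v)"
proof -
  have \<alpha>: "0 < \<alpha>" "\<alpha> \<le> 1" by (auto simp: \<alpha>_def divide_le_eq)
  obtain N0 where N0: "\<And>v. v \<in> rdom \<rho> \<Longrightarrow> Re v \<ge> N0 \<Longrightarrow> \<bar>Im v\<bar> \<le> B \<Longrightarrow>
        norm (1 / (p v)\<^sup>2) / 2 \<le> Re (cis \<theta> * (1 / (p v)\<^sup>2))"
    using ch unfolding liouville_chart_def by blast
  define k1 where "k1 = nat \<lceil>max N0 (max B (max \<rho> 0)) + 1\<rceil>"
  have k1: "real k1 \<ge> N0" "real k1 \<ge> B" "real k1 > \<rho>" "real k1 \<ge> 1" unfolding k1_def by linarith+
  show thesis
  proof (rule that[of k1])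
    show "k1 > 0" using k1(4) by auto
    fix N u v assume N: "k1 \<le> N" and u: "real N \<le> Re u" "Re u \<le> 8 * real N" "\<bar>Im u\<bar> \<le> B"
      and v: "real N \<le> Re v" "Re v \<le> 8 * real N" "\<bar>Im v\<bar> \<le> B"
    have Nk: "real N \<ge> real k1" using N by simp
    have N1: "real N \<ge> 1" "real N > 0" using Nk k1 by linarith+
    define Box where "Box = {x. real N \<le> Re x} \<inter> {x. Re x \<le> 8 * real N} \<inter> {x. - B \<le> Im x} \<inter> {x. Im x \<le> B}"
    have cB: "convex Box" unfolding Box_def
      by (intro convex_Int convex_halfspace_Re_ge convex_halfspace_Re_le convex_halfspace_Im_ge convex_halfspace_Im_le)
    have uv: "u \<in> Box" "v \<in> Box" using u v by (auto simp: Box_def abs_le_iff)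
    have D: "x \<in> rdom \<rho>" "Re x \<ge> N0" "\<bar>Im x\<bar> \<le> B" "real N \<le> norm x" "norm x \<le> 9 * real N" if "x \<in> Box" for x
    proof -
      show "x \<in> rdom \<rho>" "Re x \<ge> N0" "\<bar>Im x\<bar> \<le> B" using that Nk k1 by (auto simp: Box_def rdom_def)
      show "real N \<le> norm x" using that complex_Re_le_cmod[of x] by (auto simp: Box_def)
      show "norm x \<le> 9 * real N" using cmod_le[of x] that Nk k1 by (auto simp: Box_def)
    qed
    have pw: "real N powr \<alpha> \<le> norm x powr \<alpha>" "norm x powr \<alpha> \<le> 9 * real N powr \<alpha>"
      "norm x powr (\<alpha> - 1) \<le> real N powr (\<alpha> - 1)" "real N powr (\<alpha> - 1) / 9 \<le> norm x powr (\<alpha> - 1)" if "x \<in> Box" for x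
    proof -
      note d = D(4,5)[OF that]
      show "real N powr \<alpha> \<le> norm x powr \<alpha>" using d \<alpha> by (intro powr_mono2) auto
      have "norm x powr \<alpha> \<le> (9 * real N) powr \<alpha>" using d \<alpha> by (intro powr_mono2) auto
      also have "\<dots> = 9 powr \<alpha> * real N powr \<alpha>" by (rule powr_mult) 
      also have "\<dots> \<le> 9 powr 1 * real N powr \<alpha>" using \<alpha> by (intro mult_right_mono powr_mono) auto
      finally show "norm x powr \<alpha> \<le> 9 * real N powr \<alpha>" by simp
      show "norm x powr (\<alpha> - 1) \<le> real N powr (\<alpha> - 1)" using d \<alpha> N1 by (intro powr_mono2') auto
      have "9 powr (-1) = (1 / 9 :: real)" by (simp add: powr_minus_divide)
      then have "real N powr (\<alpha> - 1) / 9 = 9 powr (-1) * real N powr (\<alpha> - 1)" by simp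
      also have "\<dots> \<le> 9 powr (\<alpha> - 1) * real N powr (\<alpha> - 1)" using \<alpha> by (intro mult_right_mono powr_mono) auto
      also have "\<dots> = (9 * real N) powr (\<alpha> - 1)" by (rule powr_mult[symmetric])
      also have "\<dots> \<le> norm x powr (\<alpha> - 1)" using d \<alpha> N1 by (intro powr_mono2') auto
      finally show "real N powr (\<alpha> - 1) / 9 \<le> norm x powr (\<alpha> - 1)" .
    qed
    have Zb: "(Z has_field_derivative 1 / (p x)\<^sup>2) (at x)" "norm x powr \<alpha> \<le> C * norm (Z x)" "norm (Z x) \<le> C * norm x powr \<alpha>"
      "norm x powr (\<alpha> - 1) \<le> C * norm (1 / (p x)\<^sup>2)" "norm (1 / (p x)\<^sup>2) \<le> C * norm x powr (\<alpha> - 1)" if "x \<in> Box" for x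
      using ch D(1)[OF that] unfolding liouville_chart_def \<alpha>_def by auto
    have Npos: "real N powr \<alpha> \<ge> 0" "real N powr (\<alpha> - 1) \<ge> 0" by auto
    have 1: "real N powr \<alpha> \<le> C * norm (Z u)" using pw(1)[OF uv(1)] Zb(2)[OF uv(1)] by linarith
    have "C * norm u powr \<alpha> \<le> C * (9 * real N powr \<alpha>)" using pw(2)[OF uv(1)] C by (intro mult_left_mono) auto
    then have 2: "norm (Z u) \<le> 9 * (C * real N powr \<alpha>)" using Zb(3)[OF uv(1)] by simp
    have 3: "norm (Z u - Z v) \<le> C * real N powr (\<alpha> - 1) * norm (u - v)"
    proof (rule field_differentiable_bound[OF cB])
      fix x assume x: "x \<in> Box"
      show "(Z has_field_derivative 1 / (p x)\<^sup>2) (at x within Box)"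
        by (rule has_field_derivative_at_within[OF Zb(1)[OF x]])
      have "C * norm x powr (\<alpha> - 1) \<le> C * real N powr (\<alpha> - 1)" using pw(3)[OF x] C by (intro mult_left_mono) auto
      then show "norm (1 / (p x)\<^sup>2) \<le> C * real N powr (\<alpha> - 1)" using Zb(5)[OF x] by linarith
    qed (use uv in auto)
    have "real N powr (\<alpha> - 1) / (18 * C) * norm (u - v) \<le> norm (Z u - Z v)"
    proof (rule expanding_if_Re_deriv_ge[OF cB Zb(1), where c = "cis \<theta>"])
      fix x assume x: "x \<in> Box"
      have "real N powr (\<alpha> - 1) / 9 \<le> C * norm (1 / (p x)\<^sup>2)" using pw(4)[OF x] Zb(4)[OF x] by linarith
      then have "real N powr (\<alpha> - 1) / (18 * C) \<le> norm (1 / (p x)\<^sup>2) / 2" using C by (simp add: field_simps)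
      also have "\<dots> \<le> Re (cis \<theta> * (1 / (p x)\<^sup>2))" by (rule N0) (use D[OF x] in auto)
      finally show "real N powr (\<alpha> - 1) / (18 * C) \<le> Re (cis \<theta> * (1 / (p x)\<^sup>2))" .
    qed (use uv in auto)
    then have 4: "real N powr (\<alpha> - 1) * norm (u - v) \<le> 18 * C * norm (Z u - Z v)" using C by (simp add: field_simps)
    have "C * norm (Z u) \<ge> 0" "C * real N powr \<alpha> \<ge> 0" "C * real N powr (\<alpha> - 1) * norm (u - v) \<ge> 0" using C by auto
    then show "real N powr \<alpha> \<le> 18 * C * norm (Z u) \<and> norm (Z u) \<le> 18 * C * real N powr \<alpha> \<and>
       norm (Z u - Z v) \<le> 18 * C * real N powr (\<alpha> - 1) * norm (u - v) \<and>
       real N powr (\<alpha> - 1) * norm (u - v) \<le> 18 * C * norm (Z u - Z v)"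
      using 1 2 3 4 by (intro conjI; linarith)
  qed
qed

text \<open>Multiplied by the conjugate of L/|L|, the derivative has real part at least |L|/2, which
  gives the lower bound. For solvability \<open>e\<close> is the deviation from the linear model:
  r/2 from the derivative and r/4 from the values of G at the centre and of w, together less than
  r.\<close>

lemma near_linear_bounds:
  fixes G :: "complex \<Rightarrow> complex"
  assumes r: "r > 0" and L: "L \<noteq> 0"
    and G: "\<And>x. x \<in> cball a r \<Longrightarrow> G field_differentiable (at x) \<and> norm (deriv G x - L) \<le> norm L / 2"
  shows "\<And>u v. u \<in> cball a r \<Longrightarrow> v \<in> cball a r \<Longrightarrow> norm L / 2 * norm (u - v) \<le> norm (G u - G v)"
    and "\<And>u v. u \<in> cball a r \<Longrightarrow> v \<in> cball a r \<Longrightarrow> norm (G u - G v) \<le> 2 * norm L * norm (u - v)"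
    and "norm (G a) \<le> norm L * r / 8 \<Longrightarrow> norm w \<le> norm L * r / 8 \<Longrightarrow> \<exists>x \<in> cball a r. G x = w"
proof -
  have d: "(G has_field_derivative deriv G x) (at x)" if "x \<in> cball a r" for x
    using G[OF that] by (simp add: field_differentiable_derivI)
  fix u v assume uv: "u \<in> cball a r" "v \<in> cball a r"
  show "norm L / 2 * norm (u - v) \<le> norm (G u - G v)"
  proof (rule expanding_if_Re_deriv_ge[OF convex_cball d, where c = "cnj L / of_real (norm L)"])
    fix x assume x: "x \<in> cball a r"
    define q where "q = cnj L / of_real (norm L) * (deriv G x - L)"
    have "cnj L / of_real (norm L) * L = (L * cnj L) / of_real (norm L)" by simp
    also have "\<dots> = of_real ((norm L)\<^sup>2) / of_real (norm L)" by (simp only: complex_norm_square)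
    also have "\<dots> = of_real (norm L)" using L by (simp add: power2_eq_square)
    finally have "cnj L / of_real (norm L) * deriv G x = of_real (norm L) + q"
      unfolding q_def by (simp only: right_diff_distrib) simp
    then have "Re (cnj L / of_real (norm L) * deriv G x) = norm L + Re q" by (simp only: plus_complex.sel Re_complex_of_real)
    moreover have "norm q \<le> norm L / 2"
      using G[OF x] L by (simp add: q_def norm_mult norm_divide)
    ultimately show "norm L / 2 \<le> Re (cnj L / of_real (norm L) * deriv G x)"
      using abs_Re_le_cmod[of q] by linarith
  qed (use uv L in \<open>auto simp: norm_divide\<close>)
  show "norm (G u - G v) \<le> 2 * norm L * norm (u - v)"
  proof (rule field_differentiable_bound[OF convex_cball has_field_derivative_at_within[OF d]])
    fix x assume "x \<in> cball a r"
    then have "norm (deriv G x - L) \<le> norm L / 2" using G by blast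
    then show "norm (deriv G x) \<le> 2 * norm L" using norm_triangle_sub[of "deriv G x" L] norm_ge_zero[of L] by linarith
  qed (use uv in auto)
next
  assume Ga: "norm (G a) \<le> norm L * r / 8" and w: "norm w \<le> norm L * r / 8"
  have d: "(G has_field_derivative deriv G x) (at x)" if "x \<in> cball a r" for x
    using G[OF that] by (simp add: field_differentiable_derivI)
  define e where "e x = (G x - w) / L - (x - a)" for x
  obtain x where x: "x \<in> cball a r" "x + e x = a"
  proof (rule perturbed_identity_attains[of r a e])
    have "continuous_on (cball a r) G" using d by (auto intro!: continuous_at_imp_continuous_on DERIV_isCont)
    then show "continuous_on (cball a r) e" unfolding e_def using L by (intro continuous_intros) auto
    fix x assume x: "x \<in> cball a r"
    have "norm ((G x - L * x) - (G a - L * a)) \<le> norm L / 2 * norm (x - a)"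
    proof (rule field_differentiable_bound[OF convex_cball, where f = "\<lambda>x. G x - L * x" and f' = "\<lambda>x. deriv G x - L"])
      fix z assume z: "z \<in> cball a r"
      have "((\<lambda>x. G x - L * x) has_field_derivative deriv G z - L) (at z)"
        using d[OF z] by (auto intro!: derivative_eq_intros)
      then show "((\<lambda>x. G x - L * x) has_field_derivative deriv G z - L) (at z within cball a r)"
        by (rule has_field_derivative_at_within)
      show "norm (deriv G z - L) \<le> norm L / 2" using G[OF z] by blast
    qed (use x r in auto)
    also have "\<dots> \<le> norm L / 2 * r" using x by (intro mult_left_mono) (auto simp: dist_norm norm_minus_commute)
    finally have 1: "norm ((G x - L * x) - (G a - L * a)) \<le> norm L * (r / 2)" by simp
    have "L * ((G x - w) / L) = G x - w" using L by simp
    then have "L * e x = ((G x - L * x) - (G a - L * a)) + (G a - w)" unfolding e_def right_diff_distrib by simp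
    then have "norm L * norm (e x) = norm (((G x - L * x) - (G a - L * a)) + (G a - w))" by (metis norm_mult)
    also have "\<dots> \<le> norm L * (r / 2) + norm (G a - w)" by (rule norm_triangle_le) (use 1 in simp)
    also have "norm (G a - w) \<le> norm L * r / 4" using norm_triangle_ineq4[of "G a" w] Ga w by simp
    finally have "norm L * norm (e x) \<le> norm L * (3 / 4 * r)" by (simp add: algebra_simps)
    then have "norm (e x) \<le> 3 / 4 * r" using L by simp
    then show "norm (e x) \<le> r" using r by linarith
  qed (use r in auto)
  then have "G x = w" using L by (simp add: e_def)
  then show "\<exists>x \<in> cball a r. G x = w" using x by blast
qed

text \<open>\<open>W k\<close> is a neighbourhood of the \<open>k\<close>-th pole on a critical ray. The reciprocal of \<open>f\<close> is used because
  it is bi-Lipschitz on all of \<open>W k\<close>; at the pole itself \<open>f\<close> has the dummy value 0.\<close>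

definition pole_lattice :: "(complex \<Rightarrow> complex) \<Rightarrow> real \<Rightarrow> (nat \<Rightarrow> complex set) \<Rightarrow> nat \<Rightarrow> real \<Rightarrow> bool" where
  "pole_lattice f \<alpha> W k1 C \<longleftrightarrow>
     (\<forall>k\<ge>k1. compact (W k) \<and>
        (\<forall>z\<in>W k. real k powr \<alpha> \<le> C * norm z \<and> norm z \<le> C * real k powr \<alpha>) \<and>
        (\<forall>z\<in>W k. \<forall>z'\<in>W k. norm (z - z') \<le> C * real k powr (\<alpha> - 1)) \<and>
        (\<forall>z\<in>W k. \<forall>z'\<in>W k. \<not> is_pole f z \<longrightarrow> \<not> is_pole f z' \<longrightarrow> f z \<noteq> 0 \<and>
            norm (z - z') \<le> C * real k powr (\<alpha> - 1) * norm (1 / f z - 1 / f z') \<and>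
            real k powr (\<alpha> - 1) * norm (1 / f z - 1 / f z') \<le> C * norm (z - z')) \<and>
        (\<forall>w. norm w \<ge> C \<longrightarrow> (\<exists>z\<in>W k. \<not> is_pole f z \<and> f z = w))) \<and>
     (\<forall>N\<ge>k1. \<forall>k k'. N \<le> k \<longrightarrow> k \<le> 2 * N \<longrightarrow> N \<le> k' \<longrightarrow> k' \<le> 2 * N \<longrightarrow> k \<noteq> k' \<longrightarrow>
        (\<forall>z\<in>W k. \<forall>z'\<in>W k'. \<bar>real k - real k'\<bar> * real N powr (\<alpha> - 1) \<le> C * norm (z - z')))"

locale nevanlinna_pair =
  fixes f w1 w2 :: "complex \<Rightarrow> complex" and P :: "complex poly"
  assumes P: "P \<noteq> 0"
    and w: "w1 holomorphic_on UNIV" "w2 holomorphic_on UNIV"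
    and ode: "\<And>z. deriv (deriv w1) z = - poly P z * w1 z" "\<And>z. deriv (deriv w2) z = - poly P z * w2 z"
    and pole: "\<And>z. is_pole f z \<longleftrightarrow> w2 z = 0" and quot: "\<And>z. w2 z \<noteq> 0 \<Longrightarrow> f z = w1 z / w2 z"
    and wronskian: "\<And>z. deriv w1 z * w2 z - w1 z * deriv w2 z = 1"
    and no_asymp: "\<not> asymptotic_value f None"
begin

definition "\<alpha> = 2 / (real (degree P) + 2)"

lemma \<alpha>_bounds: "0 < \<alpha>" "\<alpha> \<le> 1" by (auto simp: \<alpha>_def divide_le_eq)

text \<open>Zeros of the pulled back denominator are the poles of f in the chart, because the weight
  p has no zeros. The assumption on asymptotic values enters here: it excludes a degenerate
  denominator, and then the lattice of zeros exists. The sets \<open>W k\<close> are the images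
  under Z of discs about the lattice points.\<close>

lemma chart_lattice:
  assumes ch: "liouville_chart P C \<rho> Z p \<theta>" and C: "C > 0"
    and o1: "oscillator (pull_back Z p w1) \<phi> \<rho> K" and o2: "oscillator (pull_back Z p w2) \<phi> \<rho> K"
  obtains W k1 C' R where "k1 > 0" "C' > 0" "pole_lattice f \<alpha> W k1 C'"
    "\<And>v. v \<in> rdom \<rho> \<Longrightarrow> Re v \<ge> 0 \<Longrightarrow> norm (Z v) > R \<Longrightarrow> \<not> is_pole f (Z v) \<Longrightarrow> norm (f (Z v)) > R \<Longrightarrow>
       \<exists>k\<ge>k1. Z v \<in> W k"
proof -
  define y1 where "y1 = pull_back Z p w1"
  define y2 where "y2 = pull_back Z p w2"
  have \<rho>K: "\<rho> \<ge> 1" "K > 0" using o1 by (auto simp: oscillator_def)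
  define \<rho>1 where "\<rho>1 = max \<rho> (8 * K)"
  have sub: "rdom \<rho>1 \<subseteq> rdom \<rho>" by (rule rdom_mono) (simp add: \<rho>1_def)
  have chb: "(Z has_field_derivative 1 / (p v)\<^sup>2) (at v)" "p v \<noteq> 0"
    "norm v powr \<alpha> \<le> C * norm (Z v)" "norm (Z v) \<le> C * norm v powr \<alpha>" if "v \<in> rdom \<rho>" for v
    using ch that unfolding liouville_chart_def \<alpha>_def by auto
  have y2_0: "is_pole f (Z v) \<longleftrightarrow> y2 v = 0" if "v \<in> rdom \<rho>" for v
    using chb(2)[OF that] by (simp add: pole y2_def pull_back_def)
  have fy: "f (Z v) = y1 v / y2 v" if "v \<in> rdom \<rho>" "y2 v \<noteq> 0" for v
    using that chb(2)[OF that(1)] quot[of "Z v"] by (simp add: y1_def y2_def pull_back_def)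
  obtain A1 B1 where 1: "\<And>v. v \<in> rdom \<rho> \<Longrightarrow> (\<lambda>n. oscillator.a y1 (v + of_nat n)) \<longlonglongrightarrow> A1"
    "\<And>v. v \<in> rdom \<rho> \<Longrightarrow> (\<lambda>n. oscillator.b y1 (v + of_nat n)) \<longlonglongrightarrow> B1"
    "\<And>v. v \<in> rdom \<rho> \<Longrightarrow> Re v + \<bar>Im v\<bar> \<ge> 8 * K \<Longrightarrow>
       norm (y1 v - (A1 * exp (\<i> * v) + B1 * exp (- \<i> * v))) \<le>
         8 * K / (Re v + \<bar>Im v\<bar>) * (norm A1 * exp (- Im v) + norm B1 * exp (Im v))"
    using oscillator.asymptotics[OF o1] unfolding y1_def by blast
  obtain A2 B2 where 2: "\<And>v. v \<in> rdom \<rho> \<Longrightarrow> (\<lambda>n. oscillator.a y2 (v + of_nat n)) \<longlonglongrightarrow> A2"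
    "\<And>v. v \<in> rdom \<rho> \<Longrightarrow> (\<lambda>n. oscillator.b y2 (v + of_nat n)) \<longlonglongrightarrow> B2"
    "\<And>v. v \<in> rdom \<rho> \<Longrightarrow> Re v + \<bar>Im v\<bar> \<ge> 8 * K \<Longrightarrow>
       norm (y2 v - (A2 * exp (\<i> * v) + B2 * exp (- \<i> * v))) \<le>
         8 * K / (Re v + \<bar>Im v\<bar>) * (norm A2 * exp (- Im v) + norm B2 * exp (Im v))"
    using oscillator.asymptotics[OF o2] unfolding y2_def by blast
  \<comment> \<open>The Wronskian is invariant under the Liouville transform. In terms of a and b it
    is a constant determinant, which therefore survives in the limiting coefficients.\<close>
  have wr: "oscillator.a y1 v * oscillator.b y2 v - oscillator.b y1 v * oscillator.a y2 v = - \<i> / 2"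
    if v: "v \<in> rdom \<rho>" for v
  proof -
    note a = oscillator.a_def[OF o1] oscillator.a_def[OF o2] oscillator.b_def[OF o1] oscillator.b_def[OF o2]
    have d: "deriv y1 v = deriv w1 (Z v) / p v + w1 (Z v) * deriv p v" "deriv y2 v = deriv w2 (Z v) / p v + w2 (Z v) * deriv p v"
      unfolding y1_def y2_def by (intro DERIV_imp_deriv pull_back_derivs(1)[OF ch v] w ode)+
    have "deriv y1 v * y2 v - y1 v * deriv y2 v = deriv w1 (Z v) * w2 (Z v) - w1 (Z v) * deriv w2 (Z v)"
      unfolding d using chb(2)[OF v] by (simp add: y1_def y2_def pull_back_def field_simps)
    then have W1: "deriv y1 v * y2 v - y1 v * deriv y2 v = 1" using wronskian by simp
    have e: "exp (- \<i> * v) * exp (\<i> * v) = 1" by (simp add: exp_add[symmetric])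
    have "oscillator.a y1 v * oscillator.b y2 v - oscillator.b y1 v * oscillator.a y2 v =
       (exp (- \<i> * v) * exp (\<i> * v)) * (\<i> / 2 * (y1 v * deriv y2 v - deriv y1 v * y2 v))"
      unfolding a[folded y1_def y2_def] by (simp add: field_simps)
    also have "y1 v * deriv y2 v - deriv y1 v * y2 v = - 1" using W1 by (simp add: algebra_simps)
    finally show ?thesis unfolding e by simp
  qed
  define v0 where "v0 = complex_of_real (\<rho> + 1)"
  have v0: "v0 \<in> rdom \<rho>" using \<rho>K by (simp add: v0_def rdom_def)
  have "(\<lambda>n. oscillator.a y1 (v0 + of_nat n) * oscillator.b y2 (v0 + of_nat n) - oscillator.b y1 (v0 + of_nat n) * oscillator.a y2 (v0 + of_nat n))
      \<longlonglongrightarrow> A1 * B2 - B1 * A2"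
    by (intro tendsto_intros 1 2 v0)
  moreover have "v0 + of_nat n \<in> rdom \<rho>" for n using rdom_add_nonneg[OF v0, of "real n"] by simp
  ultimately have "(\<lambda>n::nat. - \<i> / 2) \<longlonglongrightarrow> A1 * B2 - B1 * A2" by (simp add: wr)
  then have W2: "A1 * B2 - B1 * A2 = - \<i> / 2" by (simp add: LIMSEQ_const_iff)
  interpret ep: exponential_pair y1 y2 \<rho>1 "8 * K" A1 B1 A2 B2
  proof
    show "1 \<le> \<rho>1" "0 < 8 * K" using \<rho>K by (auto simp: \<rho>1_def)
    show "y1 holomorphic_on rdom \<rho>1" "y2 holomorphic_on rdom \<rho>1"
      using o1 o2 sub unfolding oscillator_def y1_def y2_def by (blast intro: holomorphic_on_subset)+
    show "A1 * B2 \<noteq> A2 * B1" using W2 by (auto simp: mult.commute)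
    fix v assume v: "v \<in> rdom \<rho>1"
    then have "Re v + \<bar>Im v\<bar> \<ge> 8 * K" by (simp add: rdom_def \<rho>1_def)
    then show "norm (y1 v - (A1 * exp (\<i> * v) + B1 * exp (- \<i> * v))) \<le>
         8 * K / (Re v + \<bar>Im v\<bar>) * (norm A1 * exp (- Im v) + norm B1 * exp (Im v))"
      "norm (y2 v - (A2 * exp (\<i> * v) + B2 * exp (- \<i> * v))) \<le>
         8 * K / (Re v + \<bar>Im v\<bar>) * (norm A2 * exp (- Im v) + norm B2 * exp (Im v))"
      using 1(3) 2(3) sub v by auto
  qed
  have nz: "A2 \<noteq> 0" "B2 \<noteq> 0"
  proof -
    have "\<not> (A2 = 0 \<or> B2 = 0)"
    proof
      assume "A2 = 0 \<or> B2 = 0"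
      then obtain u :: "real \<Rightarrow> complex" where u: "continuous_on {0..} u" "\<And>t. t \<ge> 0 \<Longrightarrow> u t \<in> rdom \<rho>1"
        "\<And>t. t \<ge> 0 \<Longrightarrow> norm (u t) \<ge> t" "\<And>M. eventually (\<lambda>t. M * norm (y2 (u t)) < norm (y1 (u t))) at_top"
        using ep.quotient_unbounded_if_degenerate by blast
      have uD: "u t \<in> rdom \<rho>" if "t \<ge> 0" for t using u(2)[OF that] sub by blast
      \<comment> \<open>The image under Z of a degenerate ray is a curve to infinity on which f
        tends to infinity or meets poles.\<close>
      have "asymptotic_value f None"
        unfolding asymptotic_value_def
      proof (intro exI[of _ "\<lambda>t. Z (u t)"] conjI)
        show "continuous_on {0..} (\<lambda>t. Z (u t))"
        proof (rule continuous_on_compose2[OF _ u(1)])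
          show "continuous_on (rdom \<rho>) Z"
            using chb(1) by (auto intro!: continuous_at_imp_continuous_on DERIV_isCont)
        qed (use uD in auto)
        have lim: "filterlim (\<lambda>t::real. t powr \<alpha> / C) at_top at_top"
          using \<alpha>_bounds C by real_asymp
        show "filterlim (\<lambda>t. Z (u t)) at_infinity at_top"
        proof (rule filterlim_norm_at_top_imp_at_infinity, rule filterlim_at_top_mono[OF lim])
          show "\<forall>\<^sub>F t in at_top. t powr \<alpha> / C \<le> norm (Z (u t))"
            using eventually_ge_at_top[of 0]
          proof eventually_elim
            case (elim t)
            have "t powr \<alpha> \<le> norm (u t) powr \<alpha>" using elim u(3) \<alpha>_bounds by (intro powr_mono2) auto
            then show ?case using chb(3)[OF uD[OF elim]] C by (simp add: divide_le_eq mult.commute)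
          qed
        qed
        show "limitin (Alexandroff_compactification euclidean) (\<lambda>t. to_sphere f (Z (u t))) None at_top"
        proof (rule limitin_Alexandroff_None[where a = 0])
          fix M
          show "\<forall>\<^sub>F t in at_top. \<forall>w. to_sphere f (Z (u t)) = Some w \<longrightarrow> dist w 0 > M"
            using u(4)[of M] eventually_ge_at_top[of 0]
          proof eventually_elim
            case (elim t)
            show ?case
            proof (intro allI impI)
              fix w assume "to_sphere f (Z (u t)) = Some w"
              then have np: "\<not> is_pole f (Z (u t))" and w: "w = f (Z (u t))"
                by (auto simp: to_sphere_def split: if_splits)
              have "y2 (u t) \<noteq> 0" using np y2_0[OF uD[OF elim(2)]] by simp
              then show "dist w 0 > M" unfolding w using fy[OF uD[OF elim(2)]] elim(1)
                by (simp add: norm_divide less_divide_eq)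
            qed
          qed
        qed
      qed
      then show False using no_asymp by blast
    qed
    then show "A2 \<noteq> 0" "B2 \<noteq> 0" by auto
  qed
  obtain c \<Lambda> :: complex and r M U :: real and k0 :: nat where lat:
    "r > 0" "r \<le> 1" "\<Lambda> \<noteq> 0" "M > 0"
    "\<And>k x. k \<ge> k0 \<Longrightarrow> x \<in> cball (c + of_real (pi * real k)) r \<Longrightarrow>
       x \<in> rdom \<rho>1 \<and> y1 x \<noteq> 0 \<and> (\<lambda>v. y2 v / y1 v) field_differentiable (at x) \<and>
       norm (deriv (\<lambda>v. y2 v / y1 v) x - \<Lambda>) \<le> norm \<Lambda> / 2"
    "\<And>k. k \<ge> k0 \<Longrightarrow> norm (y2 (c + of_real (pi * real k)) / y1 (c + of_real (pi * real k))) \<le> norm \<Lambda> * r / 8"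
    "\<And>v. v \<in> rdom \<rho>1 \<Longrightarrow> Re v + \<bar>Im v\<bar> \<ge> U \<Longrightarrow> M * norm (y2 v) < norm (y1 v) \<Longrightarrow>
       \<exists>k \<ge> k0. v \<in> cball (c + of_real (pi * real k)) r"
    by (rule ep.zeros_on_lattice[OF nz]) (rule that; assumption)
  define G where "G v = y2 v / y1 v" for v
  define B where "B = norm c + r"
  have B: "B \<ge> 0" using lat(1) by (simp add: B_def)
  obtain k2 :: nat where k2: "k2 > 0"
    "\<And>N u v. k2 \<le> N \<Longrightarrow> real N \<le> Re u \<Longrightarrow> Re u \<le> 8 * real N \<Longrightarrow> \<bar>Im u\<bar> \<le> B \<Longrightarrow>
       real N \<le> Re v \<Longrightarrow> Re v \<le> 8 * real N \<Longrightarrow> \<bar>Im v\<bar> \<le> B \<Longrightarrow>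
       real N powr \<alpha> \<le> 18 * C * norm (Z u) \<and> norm (Z u) \<le> 18 * C * real N powr \<alpha> \<and>
       norm (Z u - Z v) \<le> 18 * C * real N powr (\<alpha> - 1) * norm (u - v) \<and>
       real N powr (\<alpha> - 1) * norm (u - v) \<le> 18 * C * norm (Z u - Z v)"
    by (rule liouville_chart_box[OF ch C B, folded \<alpha>_def]) (rule that; assumption)
  define k1 where "k1 = max k0 (max k2 (nat \<lceil>B\<rceil>))"
  have k1: "k1 \<ge> k0" "k1 \<ge> k2" "k1 > 0" "real k1 \<ge> B"
    using k2(1) by (auto simp: k1_def) linarith
  define W where "W k = Z ` cball (c + of_real (pi * real k)) r" for k
  have box: "real N \<le> Re v" "Re v \<le> 8 * real N" "\<bar>Im v\<bar> \<le> B"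
    if N: "k1 \<le> N" "N \<le> k" "k \<le> 2 * N" and v: "v \<in> cball (c + of_real (pi * real k)) r" for N k v
  proof -
    define d where "d = v - c - of_real (pi * real k)"
    have d: "norm d \<le> r" using v by (simp add: d_def dist_norm norm_minus_commute algebra_simps)
    have vd: "v = c + d + of_real (pi * real k)" by (simp add: d_def)
    have NB: "real N \<ge> B" using N(1) k1(4) by linarith
    \<comment> \<open>Since pi lies between 3 and 3.2, indices between N and 2N stay in the box from
      N to 8N, with \<open>B\<close> at most N as slack.\<close>
    have "pi * real k \<le> 3.2 * real k" using pi_approx(2) by (intro mult_right_mono) auto
    moreover have "pi * real k \<ge> 3 * real k" using pi_gt3 by (intro mult_right_mono) auto
    moreover have "real N \<le> real k" "real k \<le> 2 * real N" using N by auto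
    ultimately show "real N \<le> Re v" "Re v \<le> 8 * real N" "\<bar>Im v\<bar> \<le> B"
      using abs_Re_le_cmod[of c] abs_Re_le_cmod[of d] abs_Im_le_cmod[of c] abs_Im_le_cmod[of d] d NB
      unfolding B_def by (simp_all add: vd)
  qed
  have Db: "v \<in> rdom \<rho>1" "v \<in> rdom \<rho>" "y1 v \<noteq> 0" if "k \<ge> k1" "v \<in> cball (c + of_real (pi * real k)) r" for k v
    using lat(5)[of k v] that k1(1) sub by auto
  have Gd: "G field_differentiable (at x) \<and> norm (deriv G x - \<Lambda>) \<le> norm \<Lambda> / 2"
    if "k \<ge> k1" "x \<in> cball (c + of_real (pi * real k)) r" for k x
    using lat(5)[of k x] that k1(1) unfolding G_def by auto
  have Gf: "\<not> is_pole f (Z v) \<Longrightarrow> f (Z v) \<noteq> 0 \<and> 1 / f (Z v) = G v" if "k \<ge> k1" "v \<in> cball (c + of_real (pi * real k)) r" for k v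
    using Db[OF that] y2_0[of v] fy[of v] by (simp add: G_def)
  define L where "L = norm \<Lambda>"
  have L: "L > 0" using lat(3) by (simp add: L_def)
  define C' where "C' = 18 * C * (1 + 2 * r + 2 / L + 2 * L) + 8 / (L * r)"
  have C': "C' \<ge> 18 * C" "C' \<ge> 18 * C * (2 * r)" "C' \<ge> 18 * C * (2 / L)" "C' \<ge> 18 * C * (2 * L)" "C' \<ge> 8 / (L * r)" "C' > 0"
  proof -
    have p: "18 * C > 0" "18 * C * (2 * r) > 0" "18 * C * (2 / L) > 0" "18 * C * (2 * L) > 0" "8 / (L * r) > 0"
      using C lat(1) L by simp_all
    have "C' = 18 * C + 18 * C * (2 * r) + 18 * C * (2 / L) + 18 * C * (2 * L) + 8 / (L * r)"
      by (simp add: C'_def algebra_simps)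
    then show "C' \<ge> 18 * C" "C' \<ge> 18 * C * (2 * r)" "C' \<ge> 18 * C * (2 / L)" "C' \<ge> 18 * C * (2 * L)" "C' \<ge> 8 / (L * r)" "C' > 0"
      using p by linarith+
  qed
  have pl: "pole_lattice f \<alpha> W k1 C'"
    unfolding pole_lattice_def
  proof (intro conjI allI impI ballI)
    fix k assume k: "k1 \<le> k"
    note bx = box[OF k order_refl]
    have kk: "k \<le> 2 * k" by simp
    have kp: "real k powr \<alpha> \<ge> 0" "real k powr (\<alpha> - 1) \<ge> 0" by auto
    have "continuous_on (cball (c + of_real (pi * real k)) r) Z"
      by (intro continuous_at_imp_continuous_on ballI DERIV_isCont[OF chb(1)[OF Db(2)[OF k]]])
    then show "compact (W k)" unfolding W_def by (intro compact_continuous_image compact_cball)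
    have Zb: "real k powr \<alpha> \<le> 18 * C * norm (Z u)" "norm (Z u) \<le> 18 * C * real k powr \<alpha>"
       "norm (Z u - Z v) \<le> 18 * C * real k powr (\<alpha> - 1) * norm (u - v)"
       "real k powr (\<alpha> - 1) * norm (u - v) \<le> 18 * C * norm (Z u - Z v)"
      if "u \<in> cball (c + of_real (pi * real k)) r" "v \<in> cball (c + of_real (pi * real k)) r" for u v
      using k2(2)[OF order_trans[OF k1(2) k] bx[OF kk that(1)] bx[OF kk that(2)]] by auto
    fix z assume "z \<in> W k"
    then obtain u where u: "u \<in> cball (c + of_real (pi * real k)) r" "z = Z u" by (auto simp: W_def)
    show "real k powr \<alpha> \<le> C' * norm z"
      using Zb(1)[OF u(1) u(1)] mult_right_mono[OF C'(1), of "norm z"] u(2) by simp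
    show "norm z \<le> C' * real k powr \<alpha>"
      using Zb(2)[OF u(1) u(1)] mult_right_mono[OF C'(1) kp(1)] u(2) by simp
    fix z' assume "z' \<in> W k"
    then obtain v where v: "v \<in> cball (c + of_real (pi * real k)) r" "z' = Z v" by (auto simp: W_def)
    have uv: "norm (u - v) \<le> 2 * r"
    proof -
      have "dist u v \<le> dist u (c + of_real (pi * real k)) + dist (c + of_real (pi * real k)) v" by (rule dist_triangle)
      also have "\<dots> \<le> r + r" using u(1) v(1) by (intro add_mono) (simp_all add: dist_commute)
      finally show ?thesis by (simp add: dist_norm)
    qed
    have "norm (z - z') \<le> 18 * C * real k powr (\<alpha> - 1) * (2 * r)"
    proof -
      have "18 * C * real k powr (\<alpha> - 1) * norm (u - v) \<le> 18 * C * real k powr (\<alpha> - 1) * (2 * r)"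
        using C by (intro mult_left_mono uv) auto
      then show ?thesis using Zb(3)[OF u(1) v(1)] unfolding u(2) v(2) by linarith
    qed
    also have "\<dots> = 18 * C * (2 * r) * real k powr (\<alpha> - 1)" by simp
    also have "\<dots> \<le> C' * real k powr (\<alpha> - 1)" by (rule mult_right_mono[OF C'(2) kp(2)])
    finally show "norm (z - z') \<le> C' * real k powr (\<alpha> - 1)" .
    assume np: "\<not> is_pole f z" "\<not> is_pole f z'"
    have fz: "f z \<noteq> 0" "1 / f z = G u" "1 / f z' = G v" using Gf[OF k u(1)] Gf[OF k v(1)] np u(2) v(2) by auto
    show "f z \<noteq> 0" by (rule fz)
    have nb: "L / 2 * norm (u - v) \<le> norm (G u - G v)" "norm (G u - G v) \<le> 2 * L * norm (u - v)"
      using near_linear_bounds(1,2)[OF lat(1,3) Gd[OF k] u(1) v(1)] unfolding L_def by auto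
    have "norm (u - v) \<le> 2 / L * norm (G u - G v)" using nb(1) L by (simp add: field_simps)
    then have "18 * C * real k powr (\<alpha> - 1) * norm (u - v) \<le> 18 * C * real k powr (\<alpha> - 1) * (2 / L * norm (G u - G v))"
      using C by (intro mult_left_mono) auto
    also have "\<dots> = 18 * C * (2 / L) * (real k powr (\<alpha> - 1) * norm (G u - G v))" by simp
    also have "\<dots> \<le> C' * (real k powr (\<alpha> - 1) * norm (G u - G v))" by (intro mult_right_mono C') auto
    finally show "norm (z - z') \<le> C' * real k powr (\<alpha> - 1) * norm (1 / f z - 1 / f z')"
      using Zb(3)[OF u(1) v(1)] u(2) v(2) unfolding fz by (simp add: mult.assoc)
    have "real k powr (\<alpha> - 1) * norm (G u - G v) \<le> real k powr (\<alpha> - 1) * (2 * L * norm (u - v))"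
      by (intro mult_left_mono nb) auto
    also have "\<dots> = 2 * L * (real k powr (\<alpha> - 1) * norm (u - v))" by simp
    also have "\<dots> \<le> 2 * L * (18 * C * norm (Z u - Z v))" using L by (intro mult_left_mono Zb(4)[OF u(1) v(1)]) auto
    also have "\<dots> = 18 * C * (2 * L) * norm (Z u - Z v)" by simp
    also have "\<dots> \<le> C' * norm (Z u - Z v)" by (intro mult_right_mono C') auto
    finally show "real k powr (\<alpha> - 1) * norm (1 / f z - 1 / f z') \<le> C' * norm (z - z')"
      unfolding fz using u(2) v(2) by simp
  next
    fix k and w :: complex assume k: "k1 \<le> k" and w: "C' \<le> norm w"
    have w0: "norm w > 0" using w C'(6) by linarith
    have "8 / (L * r) \<le> norm w" using w C'(5) by linarith
    then have "norm (1 / w) \<le> norm \<Lambda> * r / 8"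
      using w0 L lat(1) unfolding norm_divide norm_one L_def[symmetric] by (simp add: field_simps)
    moreover have "norm (G (c + of_real (pi * real k))) \<le> norm \<Lambda> * r / 8"
      using lat(6)[of k] k k1(1) by (simp add: G_def)
    ultimately obtain u where u: "u \<in> cball (c + of_real (pi * real k)) r" "G u = 1 / w"
      using near_linear_bounds(3)[OF lat(1,3) Gd[OF k]] by blast
    have "y2 u \<noteq> 0" using u(2) w0 by (auto simp: G_def)
    then have np: "\<not> is_pole f (Z u)" using y2_0[OF Db(2)[OF k u(1)]] by simp
    moreover have "f (Z u) = w"
      using Gf[OF k u(1) np] u(2) w0 by (auto simp: field_simps)
    ultimately show "\<exists>z\<in>W k. \<not> is_pole f z \<and> f z = w" using u(1) by (auto simp: W_def)
  next
    fix N k k' z z'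
    assume N: "k1 \<le> N" and kN: "N \<le> k" "k \<le> 2 * N" "N \<le> k'" "k' \<le> 2 * N" "k \<noteq> k'" and z: "z \<in> W k" "z' \<in> W k'"
    obtain u where u: "u \<in> cball (c + of_real (pi * real k)) r" "z = Z u" using z by (auto simp: W_def)
    obtain v where v: "v \<in> cball (c + of_real (pi * real k')) r" "z' = Z v" using z by (auto simp: W_def)
    have Zb: "real N powr (\<alpha> - 1) * norm (u - v) \<le> 18 * C * norm (Z u - Z v)"
      using k2(2)[OF order_trans[OF k1(2) N] box[OF N kN(1,2) u(1)] box[OF N kN(3,4) v(1)]] by auto
    \<comment> \<open>The centres are pi |d| apart and the radii at most 1, and 3|d| - 2 \<ge> |d|
      since |d| \<ge> 1.\<close>
    have "norm (u - v) \<ge> \<bar>real k - real k'\<bar>"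
    proof -
      define d where "d = real k - real k'"
      have d: "\<bar>d\<bar> \<ge> 1" using kN(5) by (auto simp: d_def abs_if)
      have "of_real (pi * d) = (u - v) - (u - (c + of_real (pi * real k))) + (v - (c + of_real (pi * real k')))"
        by (simp add: d_def algebra_simps)
      then have "norm (of_real (pi * d) :: complex) \<le> norm (u - v) + norm (u - (c + of_real (pi * real k))) + norm (v - (c + of_real (pi * real k')))"
        by (metis norm_triangle_ineq norm_triangle_ineq4 add_right_mono order_trans)
      moreover have "norm (u - (c + of_real (pi * real k))) \<le> 1" "norm (v - (c + of_real (pi * real k'))) \<le> 1"
        using u(1) v(1) lat(2) by (auto simp: dist_norm norm_minus_commute)
      moreover have "norm (of_real (pi * d) :: complex) = pi * \<bar>d\<bar>" by (simp add: norm_mult)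
      ultimately have "pi * \<bar>d\<bar> \<le> norm (u - v) + 2" by linarith
      moreover have "pi * \<bar>d\<bar> \<ge> 3 * \<bar>d\<bar>" using pi_gt3 by (intro mult_right_mono) auto
      ultimately show ?thesis using d unfolding d_def[symmetric] by linarith
    qed
    then have "real N powr (\<alpha> - 1) * \<bar>real k - real k'\<bar> \<le> real N powr (\<alpha> - 1) * norm (u - v)"
      by (intro mult_left_mono) auto
    also have "\<dots> \<le> 18 * C * norm (Z u - Z v)" by (rule Zb)
    also have "\<dots> \<le> C' * norm (Z u - Z v)" by (intro mult_right_mono C') auto
    finally show "\<bar>real k - real k'\<bar> * real N powr (\<alpha> - 1) \<le> C' * norm (z - z')"
      using u(2) v(2) by (simp add: mult.commute)
  qed
  define U' where "U' = max U (max \<rho>1 (4 * real k1 + norm c + 2))"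
  have U': "U' \<ge> U" "U' \<ge> \<rho>1" "U' \<ge> 4 * real k1 + norm c + 2" "U' > 0"
    using ep.\<rho> by (auto simp: U'_def)
  \<comment> \<open>A value beyond \<open>M\<close> puts v near the lattice, and a point beyond the
    second entry has |v| > U', so that the lattice index is large.\<close>
  define R where "R = max M (C * U' powr \<alpha>)"
  show thesis
  proof (rule that[OF k1(3) C'(6) pl])
    fix v assume v: "v \<in> rdom \<rho>" "Re v \<ge> 0" "norm (Z v) > R" "\<not> is_pole f (Z v)" "norm (f (Z v)) > R"
    have "norm v > U'"
    proof (rule ccontr)
      assume "\<not> norm v > U'"
      then have "norm v powr \<alpha> \<le> U' powr \<alpha>" using \<alpha>_bounds by (intro powr_mono2) auto
      then have "C * norm v powr \<alpha> \<le> C * U' powr \<alpha>" using C by (intro mult_left_mono) auto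
      then show False using chb(4)[OF v(1)] v(3) by (simp add: R_def)
    qed
    then have u: "Re v + \<bar>Im v\<bar> > U'" using cmod_le[of v] v(2) by simp
    have y20: "y2 v \<noteq> 0" using v(4) y2_0[OF v(1)] by simp
    have "norm (f (Z v)) > M" using v(5) by (simp add: R_def)
    then have "M * norm (y2 v) < norm (y1 v)"
      using y20 fy[OF v(1) y20] by (simp add: norm_divide less_divide_eq)
    moreover have "v \<in> rdom \<rho>1" using u U' by (simp add: rdom_def)
    ultimately obtain k where k: "k \<ge> k0" "v \<in> cball (c + of_real (pi * real k)) r"
      using lat(7)[of v] u U' by auto
    have "k \<ge> k1"
    proof -
      have "norm v \<le> norm (c + of_real (pi * real k)) + r"
        using k(2) norm_triangle_sub[of v "c + of_real (pi * real k)"] by (simp add: dist_norm norm_minus_commute)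
      also have "norm (c + of_real (pi * real k)) \<le> norm c + pi * real k"
        using norm_triangle_ineq[of c "of_real (pi * real k)"] by (simp add: norm_mult)
      also have "pi * real k \<le> 4 * real k" using pi_less_4 by (intro mult_right_mono) auto
      finally have "norm v \<le> norm c + 4 * real k + r" by simp
      then have "real k1 < real k" using \<open>norm v > U'\<close> U'(3) lat(2) by linarith
      then show ?thesis by simp
    qed
    then show "\<exists>k\<ge>k1. Z v \<in> W k" using k(2) by (auto simp: W_def)
  qed
qed

end

section \<open>The upper bound\<close>

text \<open>Lets finitely many lattices share one constant; the covering clause also weakens as the
  constant grows.\<close>

lemma pole_lattice_mono:
  assumes pl: "pole_lattice f \<alpha> W k1 C" and C: "C \<le> C'"
  shows "pole_lattice f \<alpha> W k1 C'"
proof -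
  have m: "C * x \<le> C' * x" if "x \<ge> 0" for x using C that by (rule mult_right_mono)
  have m2: "C * a * b \<le> C' * a * b" if "a \<ge> 0" "b \<ge> 0" for a b
    using C that by (intro mult_right_mono) auto
  have e: "x \<le> C * y \<Longrightarrow> y \<ge> 0 \<Longrightarrow> x \<le> C' * y" for x y using m[of y] by linarith
  have e2: "x \<le> C * a * b \<Longrightarrow> a \<ge> 0 \<Longrightarrow> b \<ge> 0 \<Longrightarrow> x \<le> C' * a * b" for x a b using m2[of a b] by linarith
  note h = pl[unfolded pole_lattice_def]
  have h1: "compact (W k)" "\<And>z. z \<in> W k \<Longrightarrow> real k powr \<alpha> \<le> C * norm z" "\<And>z. z \<in> W k \<Longrightarrow> norm z \<le> C * real k powr \<alpha>"
    "\<And>z z'. z \<in> W k \<Longrightarrow> z' \<in> W k \<Longrightarrow> norm (z - z') \<le> C * real k powr (\<alpha> - 1)"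
    "\<And>z z'. z \<in> W k \<Longrightarrow> z' \<in> W k \<Longrightarrow> \<not> is_pole f z \<Longrightarrow> \<not> is_pole f z' \<Longrightarrow> f z \<noteq> 0"
    "\<And>z z'. z \<in> W k \<Longrightarrow> z' \<in> W k \<Longrightarrow> \<not> is_pole f z \<Longrightarrow> \<not> is_pole f z' \<Longrightarrow>
       norm (z - z') \<le> C * real k powr (\<alpha> - 1) * norm (1 / f z - 1 / f z')"
    "\<And>z z'. z \<in> W k \<Longrightarrow> z' \<in> W k \<Longrightarrow> \<not> is_pole f z \<Longrightarrow> \<not> is_pole f z' \<Longrightarrow>
       real k powr (\<alpha> - 1) * norm (1 / f z - 1 / f z') \<le> C * norm (z - z')"
    "\<And>w. norm w \<ge> C \<Longrightarrow> \<exists>z\<in>W k. \<not> is_pole f z \<and> f z = w" if "k \<ge> k1" for k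
    using h that by simp_all
  have h2: "\<bar>real k - real k'\<bar> * real N powr (\<alpha> - 1) \<le> C * norm (z - z')"
    if "N \<ge> k1" "N \<le> k" "k \<le> 2 * N" "N \<le> k'" "k' \<le> 2 * N" "k \<noteq> k'" "z \<in> W k" "z' \<in> W k'" for N k k' z z'
    using h that by simp
  show ?thesis unfolding pole_lattice_def
  proof (intro conjI allI impI ballI)
    fix k assume k: "k1 \<le> k"
    show "compact (W k)" by (rule h1(1)[OF k])
    show "\<exists>z\<in>W k. \<not> is_pole f z \<and> f z = w" if "C' \<le> norm w" for w
      using h1(8)[OF k] that C by simp
    fix z assume z: "z \<in> W k"
    show "real k powr \<alpha> \<le> C' * norm z" by (rule e[OF h1(2)[OF k z]]) simp
    show "norm z \<le> C' * real k powr \<alpha>" by (rule e[OF h1(3)[OF k z]]) simp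
    fix z' assume z': "z' \<in> W k"
    show "norm (z - z') \<le> C' * real k powr (\<alpha> - 1)" by (rule e[OF h1(4)[OF k z z']]) simp
    assume np: "\<not> is_pole f z" "\<not> is_pole f z'"
    show "f z \<noteq> 0" by (rule h1(5)[OF k z z' np])
    show "norm (z - z') \<le> C' * real k powr (\<alpha> - 1) * norm (1 / f z - 1 / f z')"
      by (rule e2[OF h1(6)[OF k z z' np]]) auto
    show "real k powr (\<alpha> - 1) * norm (1 / f z - 1 / f z') \<le> C' * norm (z - z')"
      by (rule e[OF h1(7)[OF k z z' np]]) simp
  next
    fix N k k' z z'
    assume a: "k1 \<le> N" "N \<le> k" "k \<le> 2 * N" "N \<le> k'" "k' \<le> 2 * N" "k \<noteq> k'" "z \<in> W k" "z' \<in> W k'"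
    show "\<bar>real k - real k'\<bar> * real N powr (\<alpha> - 1) \<le> C' * norm (z - z')"
      by (rule e[OF h2[OF a]]) simp
  qed
qed

context nevanlinna_pair begin

text \<open>The finitely many charts are merged under common constants. The last clause is the form
  in which boundedness of f away from its poles is used: a large point with a large image lies near
  a pole of large index.\<close>

lemma lattice_system:
  obtains J W k1 C R where "J > (0::nat)" "C > 0" "R > 0"
    "\<And>j. j < J \<Longrightarrow> k1 j > 0 \<and> pole_lattice f \<alpha> (W j) (k1 j) C"
    "\<And>z. norm z > R \<Longrightarrow> \<not> is_pole f z \<Longrightarrow> norm (f z) > R \<Longrightarrow> \<exists>j<J. \<exists>k\<ge>k1 j. z \<in> W j k"
proof -
  obtain J :: nat and Z p \<theta> C \<rho> r where ch:
    "C > 0" "\<rho> \<ge> 1" "\<And>j. j < J \<Longrightarrow> liouville_chart P C \<rho> (Z j) (p j) (\<theta> j)"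
    "\<And>z. norm z > r \<Longrightarrow> \<exists>j<J. \<exists>v \<in> rdom \<rho>. Re v \<ge> 0 \<and> Z j v = z"
    by (rule liouville_charts_exist[OF P]) (rule that; assumption)
  have "\<exists>\<rho>' K. \<rho>' \<ge> \<rho> \<and> K > 0 \<and> (\<forall>Z p \<theta>. liouville_chart P C \<rho> Z p \<theta> \<longrightarrow>
      oscillator (pull_back Z p w1) (\<lambda>v. - deriv (deriv p) v / p v) \<rho>' K \<and>
      oscillator (pull_back Z p w2) (\<lambda>v. - deriv (deriv p) v / p v) \<rho>' K)"
  proof (rule liouville_oscillator_exists[OF P ch(1,2)])
    fix \<rho>' K assume a: "\<rho>' \<ge> \<rho>" "K > 0"
      "\<And>Z p \<theta> w. liouville_chart P C \<rho> Z p \<theta> \<Longrightarrow> w holomorphic_on UNIV \<Longrightarrow>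
       (\<And>z. deriv (deriv w) z = - poly P z * w z) \<Longrightarrow>
       oscillator (pull_back Z p w) (\<lambda>v. - deriv (deriv p) v / p v) \<rho>' K"
    show ?thesis
      by (intro exI[of _ \<rho>'] exI[of _ K] conjI allI impI a w ode)
  qed
  then obtain \<rho>' K where osc: "\<rho>' \<ge> \<rho>" "K > 0"
    "\<And>Z p \<theta>. liouville_chart P C \<rho> Z p \<theta> \<Longrightarrow> oscillator (pull_back Z p w1) (\<lambda>v. - deriv (deriv p) v / p v) \<rho>' K"
    "\<And>Z p \<theta>. liouville_chart P C \<rho> Z p \<theta> \<Longrightarrow> oscillator (pull_back Z p w2) (\<lambda>v. - deriv (deriv p) v / p v) \<rho>' K"
    by blast
  define Q where "Q j W k1 C' R \<longleftrightarrow> k1 > 0 \<and> C' > 0 \<and> pole_lattice f \<alpha> W k1 C' \<and>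
    (\<forall>v. v \<in> rdom \<rho>' \<longrightarrow> Re v \<ge> 0 \<longrightarrow> norm (Z j v) > R \<longrightarrow> \<not> is_pole f (Z j v) \<longrightarrow> norm (f (Z j v)) > R \<longrightarrow>
       (\<exists>k\<ge>k1. Z j v \<in> W k))" for j and W :: "nat \<Rightarrow> complex set" and k1 C' R
  have "\<exists>W k1 C' R. Q j W k1 C' R" if j: "j < J" for j
  proof -
    note c = ch(3)[OF j]
    show ?thesis
    proof (rule chart_lattice[OF liouville_chart_mono[OF c osc(1)] ch(1) osc(3)[OF c] osc(4)[OF c]])
      fix W k1 C' R assume a: "(k1::nat) > 0" "C' > 0" "pole_lattice f \<alpha> W k1 C'"
        "\<And>v. v \<in> rdom \<rho>' \<Longrightarrow> Re v \<ge> 0 \<Longrightarrow> norm (Z j v) > R \<Longrightarrow> \<not> is_pole f (Z j v) \<Longrightarrow>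
           norm (f (Z j v)) > R \<Longrightarrow> \<exists>k\<ge>k1. Z j v \<in> W k"
      have "Q j W k1 C' R" unfolding Q_def by (intro conjI allI impI a)
      then show ?thesis by blast
    qed
  qed
  then obtain W k1 C' R where "\<And>j. j < J \<Longrightarrow> Q j (W j) (k1 j) (C' j) (R j)" by metis
  then have sys: "k1 j > 0" "C' j > 0" "pole_lattice f \<alpha> (W j) (k1 j) (C' j)"
    "\<And>v. v \<in> rdom \<rho>' \<Longrightarrow> Re v \<ge> 0 \<Longrightarrow> norm (Z j v) > R j \<Longrightarrow> \<not> is_pole f (Z j v) \<Longrightarrow> norm (f (Z j v)) > R j \<Longrightarrow>
       \<exists>k\<ge>k1 j. Z j v \<in> W j k" if "j < J" for j
    using that unfolding Q_def by auto
  define C0 where "C0 = 1 + (\<Sum>j<J. C' j)"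
  define R0 where "R0 = 1 + \<bar>r\<bar> + (\<Sum>j<J. \<bar>R j\<bar>) + C * \<rho>' powr \<alpha>"
  have sumR: "(\<Sum>j<J. \<bar>R j\<bar>) \<ge> 0" "C * \<rho>' powr \<alpha> \<ge> 0" using ch(1) by (auto intro: sum_nonneg)
  have Cj: "C' j \<le> C0" if "j < J" for j
    using member_le_sum[of j "{..<J}" C'] sys(2) that by (simp add: C0_def less_imp_le)
  have Rj: "R j \<le> R0" if "j < J" for j
    using member_le_sum[of j "{..<J}" "\<lambda>j. \<bar>R j\<bar>"] that sumR by (simp add: R0_def)
  \<comment> \<open>Some large point has to be covered by a chart, so there is at least one
    chart.\<close>
  obtain z0 :: complex where "norm z0 > r" 
    by (rule that[of "of_real (\<bar>r\<bar> + 1)"]) simp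
  then have J: "J > 0" using ch(4) by fastforce
  show thesis
  proof (rule that[OF J])
    have "(\<Sum>j<J. C' j) \<ge> 0" using sys(2) by (auto intro!: sum_nonneg simp: less_imp_le)
    then show "C0 > 0" by (simp add: C0_def)
    show "R0 > 0" using sumR unfolding R0_def by linarith
    show "k1 j > 0 \<and> pole_lattice f \<alpha> (W j) (k1 j) C0" if "j < J" for j
      using sys(1)[OF that] pole_lattice_mono[OF sys(3)[OF that] Cj[OF that]] by blast
    fix z assume z: "norm z > R0" "\<not> is_pole f z" "norm (f z) > R0"
    have "norm z > r" using z(1) sumR unfolding R0_def by linarith
    then obtain j v where j: "j < J" "v \<in> rdom \<rho>" "Re v \<ge> 0" "Z j v = z" using ch(4) by blast
    have "norm v > \<rho>'"
    proof (rule ccontr)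
      assume "\<not> norm v > \<rho>'"
      then have "norm v powr \<alpha> \<le> \<rho>' powr \<alpha>" using \<alpha>_bounds by (intro powr_mono2) auto
      then have "C * norm v powr \<alpha> \<le> C * \<rho>' powr \<alpha>" using ch(1) by (intro mult_left_mono) auto
      moreover have "norm z \<le> C * norm v powr \<alpha>"
        using ch(3)[OF j(1)] j(2,4) unfolding liouville_chart_def \<alpha>_def by auto
      ultimately show False using z(1) sumR unfolding R0_def by linarith
    qed
    then have "v \<in> rdom \<rho>'" using cmod_le[of v] j(3) by (simp add: rdom_def)
    then show "\<exists>j<J. \<exists>k\<ge>k1 j. z \<in> W j k"
      using sys(4)[OF j(1), of v] j z Rj[OF j(1)] by (intro exI[of _ j]) auto
  qed
qed

section \<open>Null sets, preimages and the escaping set\<close>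

lemma f_deriv: "w2 z \<noteq> 0 \<Longrightarrow> (f has_field_derivative 1 / (w2 z)\<^sup>2) (at z)"
proof -
  assume z: "w2 z \<noteq> 0"
  have d: "(w1 has_field_derivative deriv w1 z) (at z)" "(w2 has_field_derivative deriv w2 z) (at z)"
    using w by (auto intro: holomorphic_derivI[OF _ open_UNIV])
  have "((\<lambda>z. w1 z / w2 z) has_field_derivative (deriv w1 z * w2 z - w1 z * deriv w2 z) / (w2 z * w2 z)) (at z)"
    by (rule DERIV_divide[OF d z])
  then have "((\<lambda>z. w1 z / w2 z) has_field_derivative 1 / (w2 z)\<^sup>2) (at z)"
    by (simp add: wronskian power2_eq_square)
  moreover have "open {z. w2 z \<noteq> 0}"
    using w(2) by (intro open_Collect_neq) (auto intro: holomorphic_on_imp_continuous_on)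
  ultimately show ?thesis
    by (rule has_field_derivative_transform_within_open) (use z quot in auto)
qed

text \<open>Off the poles the derivative w2^(-2) never vanishes, so f has local inverses that are
  Lipschitz. Lindelof's theorem reduces the preimage to countably many such pieces.\<close>

lemma hausdorff_content_preimage_eq_0:
  assumes s: "s > 0" and A: "hausdorff_content s A = 0"
  shows "hausdorff_content s {z. \<not> is_pole f z \<and> f z \<in> A} = 0"
proof -
  have loc: "\<exists>r>0. \<exists>L>0. \<forall>u\<in>ball z r. \<forall>v\<in>ball z r. dist u v \<le> L * dist (f u) (f v)" if z: "w2 z \<noteq> 0" for z
  proof -
    define L where "L = 1 / (w2 z)\<^sup>2"
    have L: "L \<noteq> 0" using z by (simp add: L_def)
    have c2: "isCont w2 z" using w(2) by (auto simp: continuous_on_eq_continuous_at dest!: holomorphic_on_imp_continuous_on)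
    then have "((\<lambda>x. 1 / (w2 x)\<^sup>2) \<longlongrightarrow> L) (at z)"
      unfolding L_def isCont_def using z by (intro tendsto_intros) auto
    then have "\<forall>\<^sub>F x in at z. dist (1 / (w2 x)\<^sup>2) L < norm L / 2" using L by (intro tendstoD) auto
    then have "\<forall>\<^sub>F x in nhds z. dist (1 / (w2 x)\<^sup>2) L < norm L / 2"
      using L by (simp add: eventually_nhds_conv_at L_def)
    moreover have "\<forall>\<^sub>F x in nhds z. w2 x \<noteq> 0"
    proof -
      have "open {z. w2 z \<noteq> 0}"
        using w(2) by (intro open_Collect_neq) (auto intro: holomorphic_on_imp_continuous_on)
      then show ?thesis using z eventually_nhds_in_open[of "{z. w2 z \<noteq> 0}" z] by simp
    qed
    ultimately have "\<forall>\<^sub>F x in nhds z. dist (1 / (w2 x)\<^sup>2) L < norm L / 2 \<and> w2 x \<noteq> 0" by (rule eventually_conj)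
    then obtain r where r: "r > 0" "\<And>x. dist x z < r \<Longrightarrow> dist (1 / (w2 x)\<^sup>2) L < norm L / 2 \<and> w2 x \<noteq> 0"
      unfolding eventually_nhds_metric by blast
    have G: "f field_differentiable (at x) \<and> norm (deriv f x - L) \<le> norm L / 2" if "x \<in> cball z (r / 2)" for x
    proof -
      have "dist x z < r" using that r(1) by (auto simp: dist_commute)
      then have "dist (1 / (w2 x)\<^sup>2) L < norm L / 2" "w2 x \<noteq> 0" using r(2) by auto
      then show ?thesis using f_deriv[of x] DERIV_imp_deriv[OF f_deriv[of x]]
        by (auto simp: field_differentiable_def dist_norm)
    qed
    have "dist u v \<le> 2 / norm L * dist (f u) (f v)" if "u \<in> ball z (r / 2)" "v \<in> ball z (r / 2)" for u v
    proof -
      have "norm L / 2 * norm (u - v) \<le> norm (f u - f v)"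
        by (rule near_linear_bounds(1)[of "r / 2" L z f]) (use r L G that in auto)
      then show ?thesis using L by (simp add: dist_norm field_simps)
    qed
    then show ?thesis using r(1) L by (intro exI[of _ "r / 2"] conjI exI[of _ "2 / norm L"]) auto
  qed
  then obtain r L where rL: "\<And>z. w2 z \<noteq> 0 \<Longrightarrow> r z > 0 \<and> L z > 0 \<and> (\<forall>u\<in>ball z (r z). \<forall>v\<in>ball z (r z). dist u v \<le> L z * dist (f u) (f v))"
    by metis
  define F where "F = (\<lambda>z. ball z (r z)) ` {z. w2 z \<noteq> 0}"
  obtain F' where F': "F' \<subseteq> F" "countable F'" "\<Union>F' = \<Union>F"
    using Lindelof[of F] unfolding F_def by auto
  have sub: "{z. \<not> is_pole f z \<and> f z \<in> A} \<subseteq> (\<Union>B\<in>F'. {z \<in> B. f z \<in> A})"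
  proof
    fix z assume z: "z \<in> {z. \<not> is_pole f z \<and> f z \<in> A}"
    then have "w2 z \<noteq> 0" by (simp add: pole)
    then have "z \<in> \<Union>F" using rL[of z] unfolding F_def by force
    then show "z \<in> (\<Union>B\<in>F'. {z \<in> B. f z \<in> A})" using z F'(3) by auto
  qed
  have "hausdorff_content s (\<Union>B\<in>F'. {z \<in> B. f z \<in> A}) = 0"
  proof (rule hausdorff_content_countable_UN_eq_0[OF F'(2)])
    fix B assume "B \<in> F'"
    then obtain z where z: "w2 z \<noteq> 0" "B = ball z (r z)" using F'(1) by (auto simp: F_def)
    have "hausdorff_content s {z \<in> B. f z \<in> A} \<le> ennreal (L z powr s) * hausdorff_content s (f ` {z \<in> B. f z \<in> A})"
      by (rule hausdorff_content_expanding) (use s rL[OF z(1)] z(2) in auto)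
    moreover have "hausdorff_content s (f ` {z \<in> B. f z \<in> A}) \<le> hausdorff_content s A"
      by (rule hausdorff_content_mono) auto
    ultimately show "hausdorff_content s {z \<in> B. f z \<in> A} = 0" using A by simp
  qed
  then show ?thesis using hausdorff_content_mono[OF sub, of s] by simp
qed

text \<open>An escaping orbit eventually lies in J_R, so the escaping set is covered by the iterated
  preimages of J_R, and taking preimages keeps sets null.\<close>

lemma hausdorff_content_escaping_eq_0:
  assumes s: "s > 0" and A: "hausdorff_content s (stay_outside_set R f) = 0"
  shows "hausdorff_content s (escaping_set f) = 0"
proof -
  define E where "E n = {z. iterates_defined f z \<and> (f ^^ n) z \<in> stay_outside_set R f}" for n
  have "hausdorff_content s (E n) = 0" for n
  proof (induction n)
    case 0
    have "hausdorff_content s (E 0) \<le> hausdorff_content s (stay_outside_set R f)"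
      by (rule hausdorff_content_mono) (auto simp: E_def)
    then show ?case using A by simp
  next
    case (Suc n)
    have "E (Suc n) \<subseteq> {z. \<not> is_pole f z \<and> f z \<in> E n}"
    proof
      fix z assume "z \<in> E (Suc n)"
      then have z: "iterates_defined f z" "(f ^^ n) (f z) \<in> stay_outside_set R f"
        by (auto simp: E_def funpow_swap1)
      have "\<not> is_pole f ((f ^^ k) (f z))" for k
        using z(1) unfolding iterates_defined_def by (metis funpow_Suc_right o_apply)
      moreover have "\<not> is_pole f z" using z(1) unfolding iterates_defined_def by (metis funpow_0)
      ultimately show "z \<in> {z. \<not> is_pole f z \<and> f z \<in> E n}" using z by (auto simp: E_def iterates_defined_def)
    qed
    then have "hausdorff_content s (E (Suc n)) \<le> hausdorff_content s {z. \<not> is_pole f z \<and> f z \<in> E n}"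
      by (rule hausdorff_content_mono)
    then show ?case using hausdorff_content_preimage_eq_0[OF s Suc] by simp
  qed
  then have "hausdorff_content s (\<Union>n\<in>UNIV. E n) = 0"
    by (intro hausdorff_content_countable_UN_eq_0) auto
  moreover have "escaping_set f \<subseteq> (\<Union>n\<in>UNIV. E n)"
  proof
    fix z assume z: "z \<in> escaping_set f"
    then have "filterlim (\<lambda>n. norm ((f ^^ n) z)) at_top sequentially"
      by (simp add: escaping_set_def filterlim_at_infinity_conv_norm_at_top)
    then have "\<forall>\<^sub>F n in sequentially. norm ((f ^^ n) z) > R" by (simp add: filterlim_at_top_dense)
    then obtain N where N: "\<And>n. n \<ge> N \<Longrightarrow> norm ((f ^^ n) z) > R" unfolding eventually_sequentially by blast
    have "(f ^^ n) ((f ^^ N) z) = (f ^^ (n + N)) z" for n by (simp add: funpow_add)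
    then have "(f ^^ N) z \<in> stay_outside_set R f"
      using z N unfolding stay_outside_set_def escaping_set_def iterates_defined_def by auto
    then show "z \<in> (\<Union>n\<in>UNIV. E n)" using z by (auto simp: E_def escaping_set_def)
  qed
  ultimately show ?thesis using hausdorff_content_mono by (metis le_zero_eq)
qed

lemma hausdorff_content_finite_UN_le:
  fixes A :: "nat \<Rightarrow> 'a::metric_space set"
  shows "hausdorff_content s (\<Union>j<J. A j) \<le> (\<Sum>j<J. hausdorff_content s (A j))"
proof -
  have e: "hausdorff_content s ({}::'a set) = 0"
    using hausdorff_content_countable_UN_eq_0[of "{}" s "\<lambda>_. {}"] by simp
  have "(\<Union>j<J. A j) = (\<Union>n. if n < J then A n else {})" by auto
  then have "hausdorff_content s (\<Union>j<J. A j) \<le> (\<Sum>n. hausdorff_content s (if n < J then A n else {}))"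
    using hausdorff_content_UN_le by metis
  also have "\<dots> = (\<Sum>n<J. hausdorff_content s (if n < J then A n else {}))"
    by (rule suminf_finite) (auto simp: e)
  finally show ?thesis by simp
qed

lemma stay_outside_step:
  assumes "z \<in> stay_outside_set R f"
  shows "norm z > R" "\<not> is_pole f z" "f z \<in> stay_outside_set R f" "norm (f z) > R"
proof -
  have d: "\<not> is_pole f ((f ^^ k) z)" "norm ((f ^^ k) z) > R" for k
    using assms unfolding stay_outside_set_def iterates_defined_def by auto
  show "norm z > R" "\<not> is_pole f z" using d[of 0] by auto
  show "norm (f z) > R" using d(2)[of 1] by simp
  have "(f ^^ k) (f z) = (f ^^ Suc k) z" for k by (simp add: funpow_swap1)
  then show "f z \<in> stay_outside_set R f"
    using d unfolding stay_outside_set_def iterates_defined_def by (simp del: funpow.simps)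
qed

text \<open>The contents of the pieces of \<open>J\<^sub>R\<close> near the poles satisfy a linear system of inequalities whose
  operator has norm at most 1/2 once \<open>R\<close> is large, so they all vanish.\<close>

lemma hausdorff_content_stay_outside_eq_0:
  assumes s: "s > 0" "s * (1 + \<alpha>) > 1"
  obtains R1 where "\<And>R. R \<ge> R1 \<Longrightarrow> hausdorff_content s (stay_outside_set R f) = 0"
proof -
  obtain J W k1 C R0 where sys: "J > (0::nat)" "C > 0" "R0 > 0"
    "\<And>j. j < J \<Longrightarrow> k1 j > 0 \<and> pole_lattice f \<alpha> (W j) (k1 j) C"
    "\<And>z. norm z > R0 \<Longrightarrow> \<not> is_pole f z \<Longrightarrow> norm (f z) > R0 \<Longrightarrow> \<exists>j<J. \<exists>k\<ge>k1 j. z \<in> W j k"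
    by (rule lattice_system) (rule that; assumption)
  \<comment> \<open>J lattices can be the target of a step, and C^3 is the constant in the
    contraction of an inverse branch.\<close>
  define D where "D = real J * C powr (3 * s)"
  have D: "D > 0" using sys by (simp add: D_def)
  have summ: "summable (\<lambda>k. real k powr (- (s * (1 + \<alpha>))))" using s by (simp add: summable_real_powr_iff)
  obtain K0 where K0: "\<And>n. n \<ge> K0 \<Longrightarrow> norm (\<Sum>i. real (i + n) powr (- (s * (1 + \<alpha>)))) < 1 / (2 * D)"
    using suminf_exist_split[OF _ summ, of "1 / (2 * D)"] D by auto
  define K where "K = max K0 1"
  \<comment> \<open>The tail of a convergent series. The starting index \<open>K\<close> makes D
    times its sum at most 1/2.\<close>
  define t where "t i = real (i + K) powr (- (s * (1 + \<alpha>)))" for i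
  have ts: "summable t" unfolding t_def using summ by (rule summable_ignore_initial_segment)
  have t0: "t i \<ge> 0" for i by (simp add: t_def)
  have tsum: "suminf t < 1 / (2 * D)" using K0[of K] unfolding t_def K_def by (simp add: abs_less_iff)
  define R1 where "R1 = max R0 (C * real K powr \<alpha>)"
  show thesis
  proof (rule that[of R1])
    fix R assume R: "R \<ge> R1"
    define E where "E = stay_outside_set R f"
    \<comment> \<open>Indices below \<open>k1 j\<close> carry no estimates and receive the value
      0.\<close>
    define q where "q j k = (if k1 j \<le> k then hausdorff_content s (E \<inter> W j k) else 0)" for j k
    have pl: "pole_lattice f \<alpha> (W j) (k1 j) C" "k1 j > 0" if "j < J" for j using sys(4)[OF that] by auto
    have cover: "\<exists>j<J. \<exists>k\<ge>k1 j. k \<ge> K \<and> z \<in> E \<inter> W j k" if z: "z \<in> E" for z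
    proof -
      note st = stay_outside_step[OF z[unfolded E_def]]
      have "norm z > R0" "norm (f z) > R0" using st R by (auto simp: R1_def)
      then obtain j k where jk: "j < J" "k \<ge> k1 j" "z \<in> W j k" using sys(5) st(2) by blast
      have "k \<ge> K"
      proof (rule ccontr)
        assume "\<not> k \<ge> K"
        then have "real k powr \<alpha> \<le> real K powr \<alpha>" using \<alpha>_bounds by (intro powr_mono2) auto
        then have "C * real k powr \<alpha> \<le> C * real K powr \<alpha>" using sys(2) by (intro mult_left_mono) auto
        moreover have "norm z \<le> C * real k powr \<alpha>" using pl(1)[OF jk(1)] jk(2,3) unfolding pole_lattice_def by blast
        ultimately show False using st(1) R by (simp add: R1_def)
      qed
      then show ?thesis using jk z by blast
    qed
    \<comment> \<open>The weight k^(s(\<alpha>-1)) has the order of the s-th power of the diameter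
      bound and is reproduced by the inequality: l^(-2\<alpha>s) times the weight of the target l is
      l^(-s(1+\<alpha>)). One application therefore halves the constant \<open>Y\<close>.\<close>
    have step: "q j k \<le> ennreal (Y / 2 * real k powr (s * (\<alpha> - 1)))"
      if Y: "Y \<ge> 0" "\<And>j k. j < J \<Longrightarrow> q j k \<le> ennreal (Y * real k powr (s * (\<alpha> - 1)))" and j: "j < J" for Y j k
    proof (cases "k1 j \<le> k")
      case k: True
      have k0: "k > 0" using k pl(2)[OF j] by simp
      define B where "B j' i = {z \<in> E \<inter> W j k. f z \<in> E \<inter> W j' (i + K) \<and> k1 j' \<le> i + K}" for j' i
      define g where "g i = C powr (3 * s) * real k powr (s * (\<alpha> - 1)) * Y * t i" for i
      have Bb: "hausdorff_content s (B j' i) \<le> ennreal (g i)" if j': "j' < J" for j' i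
      proof (cases "k1 j' \<le> i + K")
        case True
        define k' where "k' = i + K"
        have k': "k' > 0" "k1 j' \<le> k'" using True by (auto simp: k'_def K_def)
        \<comment> \<open>One factor C comes from the Lipschitz bound in terms of 1/f on
          \<open>W j k\<close>, the other two from |f| \<ge> k'^\<alpha> / C at both points.\<close>
        define L where "L = C ^ 3 * real k powr (\<alpha> - 1) * real k' powr (- 2 * \<alpha>)"
        have L0: "L \<ge> 0" using sys(2) by (simp add: L_def)
        have Lip: "dist z z' \<le> L * dist (f z) (f z')" if z: "z \<in> B j' i" "z' \<in> B j' i" for z z'
        proof -
          have np: "\<not> is_pole f z" "\<not> is_pole f z'" using z stay_outside_step(2) by (auto simp: B_def E_def)
          have zW: "z \<in> W j k" "z' \<in> W j k" "f z \<in> W j' k'" "f z' \<in> W j' k'" using z by (auto simp: B_def k'_def)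
          have fb: "real k' powr \<alpha> \<le> C * norm (f z)" "real k' powr \<alpha> \<le> C * norm (f z')"
            using pl(1)[OF j'] k'(2) zW(3,4) unfolding pole_lattice_def by blast+
          have kp: "real k' powr \<alpha> > 0" using k' by simp
          then have fn: "norm (f z) > 0" "norm (f z') > 0" using fb sys(2)
            by (metis mult_zero_right norm_ge_zero not_le order_le_less)+
          have inv: "1 / norm (f z) \<le> C * real k' powr (- \<alpha>)" "1 / norm (f z') \<le> C * real k' powr (- \<alpha>)"
            using fb fn kp by (simp_all add: powr_minus field_simps)
          have "norm (z - z') \<le> C * real k powr (\<alpha> - 1) * norm (1 / f z - 1 / f z')"
            using pl(1)[OF j] k zW(1,2) np unfolding pole_lattice_def by blast
          also have "1 / f z - 1 / f z' = (f z' - f z) / (f z * f z')" using fn by (simp add: field_simps)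
          also have "norm \<dots> = norm (f z - f z') * ((1 / norm (f z)) * (1 / norm (f z')))"
            by (simp add: norm_divide norm_mult norm_minus_commute)
          also have "C * real k powr (\<alpha> - 1) * \<dots> \<le> C * real k powr (\<alpha> - 1) * (norm (f z - f z') * ((C * real k' powr (- \<alpha>)) * (C * real k' powr (- \<alpha>))))"
            using sys(2) by (intro mult_left_mono mult_mono inv) auto
          also have "\<dots> = C ^ 3 * real k powr (\<alpha> - 1) * (real k' powr (- \<alpha>) * real k' powr (- \<alpha>)) * norm (f z - f z')"
            by (simp add: power3_eq_cube)
          also have "real k' powr (- \<alpha>) * real k' powr (- \<alpha>) = real k' powr (- 2 * \<alpha>)"
            by (simp add: powr_add[symmetric])
          finally show ?thesis by (simp add: L_def dist_norm)
        qed
        have "hausdorff_content s (B j' i) \<le> ennreal (L powr s) * hausdorff_content s (f ` B j' i)"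
          by (rule hausdorff_content_expanding[OF s(1) L0 Lip])
        also have "\<dots> \<le> ennreal (L powr s) * hausdorff_content s (E \<inter> W j' k')"
          by (intro mult_left_mono hausdorff_content_mono) (auto simp: B_def k'_def)
        also have "hausdorff_content s (E \<inter> W j' k') = q j' k'" using k' by (simp add: q_def)
        also have "ennreal (L powr s) * q j' k' \<le> ennreal (L powr s) * ennreal (Y * real k' powr (s * (\<alpha> - 1)))"
          by (intro mult_left_mono Y(2) j') auto
        also have "\<dots> = ennreal (L powr s * (Y * real k' powr (s * (\<alpha> - 1))))"
          using Y(1) by (simp add: ennreal_mult)
        also have "L powr s * (Y * real k' powr (s * (\<alpha> - 1))) = g i"
        proof -
          have "L powr s = C powr (3 * s) * real k powr (s * (\<alpha> - 1)) * real k' powr (- 2 * \<alpha> * s)"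
          proof -
            have "C ^ 3 = C powr 3" using sys(2) by (simp add: powr_numeral)
            then have "(C ^ 3) powr s = C powr (3 * s)" by (simp only: powr_powr)
            moreover have "(real k powr (\<alpha> - 1)) powr s = real k powr (s * (\<alpha> - 1))"
              by (simp only: powr_powr mult.commute[of "\<alpha> - 1" s])
            moreover have "(real k' powr (- 2 * \<alpha>)) powr s = real k' powr (- 2 * \<alpha> * s)"
              by (rule powr_powr)
            ultimately show ?thesis unfolding L_def by (simp only: powr_mult)
          qed
          moreover have "real k' powr (- 2 * \<alpha> * s) * real k' powr (s * (\<alpha> - 1)) = t i"
            unfolding powr_add[symmetric] t_def k'_def[symmetric] by (simp add: algebra_simps)
          ultimately show ?thesis by (simp add: g_def mult_ac)
        qed
        finally show ?thesis .
      next
        case False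
        then have "B j' i = {}" by (auto simp: B_def)
        then show ?thesis using hausdorff_content_countable_UN_eq_0[of "{}" s "\<lambda>_. {}::complex set"] by simp
      qed
      have "E \<inter> W j k \<subseteq> (\<Union>i. \<Union>j'<J. B j' i)"
      proof
        fix z assume z: "z \<in> E \<inter> W j k"
        then have "f z \<in> E" using stay_outside_step(3) by (auto simp: E_def)
        from cover[OF this] obtain j' k' where jk: "j' < J" "k1 j' \<le> k'" "k' \<ge> K" "f z \<in> E \<inter> W j' k'" by blast
        then have "z \<in> B j' (k' - K)" using z by (simp add: B_def)
        then show "z \<in> (\<Union>i. \<Union>j'<J. B j' i)" using jk(1) by blast
      qed
      then have "q j k \<le> hausdorff_content s (\<Union>i. \<Union>j'<J. B j' i)"
        using k by (simp add: q_def hausdorff_content_mono)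
      also have "\<dots> \<le> (\<Sum>i. hausdorff_content s (\<Union>j'<J. B j' i))" by (rule hausdorff_content_UN_le)
      also have "\<dots> \<le> (\<Sum>i. ennreal (real J * g i))"
      proof (rule suminf_le)
        fix i
        have "hausdorff_content s (\<Union>j'<J. B j' i) \<le> (\<Sum>j'<J. hausdorff_content s (B j' i))"
          by (rule hausdorff_content_finite_UN_le)
        also have "\<dots> \<le> (\<Sum>j'<J. ennreal (g i))" by (intro sum_mono Bb) auto
        also have "\<dots> = ennreal (real J * g i)"
          using Y(1) t0 by (simp add: ennreal_mult g_def ennreal_of_nat_eq_real_of_nat)
        finally show "hausdorff_content s (\<Union>j'<J. B j' i) \<le> ennreal (real J * g i)" .
      qed auto
      also have "\<dots> = ennreal (\<Sum>i. real J * g i)"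
        using Y(1) t0 ts by (intro suminf_ennreal2) (auto simp: g_def intro!: summable_mult)
      also have "(\<Sum>i. real J * g i) = D * Y * real k powr (s * (\<alpha> - 1)) * suminf t"
      proof -
        have "(\<lambda>i. real J * g i) = (\<lambda>i. (D * Y * real k powr (s * (\<alpha> - 1))) * t i)"
          by (auto simp: g_def D_def mult_ac)
        then show ?thesis using suminf_mult[OF ts] by simp
      qed
      also have "ennreal \<dots> \<le> ennreal (Y / 2 * real k powr (s * (\<alpha> - 1)))"
      proof (rule ennreal_leI)
        have "D * suminf t \<le> D * (1 / (2 * D))" using tsum D by (intro mult_left_mono) auto
        then have "D * suminf t \<le> 1 / 2" using D by simp
        then have "Y * real k powr (s * (\<alpha> - 1)) * (D * suminf t) \<le> Y * real k powr (s * (\<alpha> - 1)) * (1 / 2)"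
          using Y(1) by (intro mult_left_mono) auto
        then show "D * Y * real k powr (s * (\<alpha> - 1)) * suminf t \<le> Y / 2 * real k powr (s * (\<alpha> - 1))"
          by (simp add: mult_ac)
      qed
      finally show ?thesis .
    qed (simp add: q_def)
    \<comment> \<open>The iteration starts with each piece covered by itself, a set of diameter at
      most C k^(\<alpha>-1).\<close>
    have qn: "q j k \<le> ennreal (C powr s / 2 ^ n * real k powr (s * (\<alpha> - 1)))" if "j < J" for n j k
      using that
    proof (induction n arbitrary: j k)
      case 0
      show ?case
      proof (cases "k1 j \<le> k")
        case k: True
        have bd: "bounded (E \<inter> W j k)" 
          using pl(1)[OF 0] k compact_imp_bounded unfolding pole_lattice_def by (metis bounded_Int)
        have dm: "diameter (E \<inter> W j k) \<le> C * real k powr (\<alpha> - 1)"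
        proof (rule diameter_le)
          show "norm (z - z') \<le> C * real k powr (\<alpha> - 1)" if "z \<in> E \<inter> W j k" "z' \<in> E \<inter> W j k" for z z'
            using pl(1)[OF 0] k that unfolding pole_lattice_def by blast
        qed (use sys(2) in auto)
        have "q j k \<le> ennreal (diameter (E \<inter> W j k) powr s)"
          using hausdorff_content_le_diameter[OF bd] k by (simp add: q_def)
        also have "\<dots> \<le> ennreal ((C * real k powr (\<alpha> - 1)) powr s)"
          using dm s diameter_ge_0[OF bd] by (intro ennreal_leI powr_mono2) auto
        also have "(C * real k powr (\<alpha> - 1)) powr s = C powr s * real k powr (s * (\<alpha> - 1))"
          using sys(2) by (simp add: powr_mult powr_powr mult.commute)
        finally show ?thesis by simp
      qed (simp add: q_def)
    next
      case (Suc n)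
      have "q j k \<le> ennreal (C powr s / 2 ^ n / 2 * real k powr (s * (\<alpha> - 1)))"
        by (rule step[OF _ Suc.IH Suc.prems]) auto
      then show ?case by (simp add: field_simps)
    qed
    have q0: "q j k = 0" if "j < J" for j k
    proof -
      have "(\<lambda>n. C powr s / 2 ^ n * real k powr (s * (\<alpha> - 1))) \<longlonglongrightarrow> 0"
        by real_asymp
      then have "(\<lambda>n. ennreal (C powr s / 2 ^ n * real k powr (s * (\<alpha> - 1)))) \<longlonglongrightarrow> ennreal 0"
        by (rule tendsto_ennrealI)
      then have "q j k \<le> ennreal 0" by (rule LIMSEQ_le_const) (use qn[OF that] in auto)
      then show ?thesis by simp
    qed
    define V where "V = (\<Union>i\<in>{(j,k). j < J \<and> k1 j \<le> k}. case i of (j,k) \<Rightarrow> E \<inter> W j k)"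
    have "E \<subseteq> V" using cover unfolding V_def by fastforce
    moreover have "hausdorff_content s V = 0"
      unfolding V_def
    proof (rule hausdorff_content_countable_UN_eq_0)
      show "hausdorff_content s (case i of (j,k) \<Rightarrow> E \<inter> W j k) = 0" if "i \<in> {(j,k). j < J \<and> k1 j \<le> k}" for i
        using that q0[of "fst i" "snd i"] by (auto simp: q_def)
    qed auto
    ultimately show "hausdorff_content s (stay_outside_set R f) = 0"
      using hausdorff_content_mono[of E V s] by (simp add: E_def)
  qed
qed

end

section \<open>The lower bound\<close>

text \<open>The only danger is a limit point at a pole, where f has a dummy value; but f tends to
  infinity there, while \<open>T\<close> is bounded.\<close>

lemma compact_preimage_avoiding_poles:
  assumes nm: "f nicely_meromorphic_on UNIV" and U: "compact U" and T: "compact T"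
  shows "compact {z \<in> U. \<not> is_pole f z \<and> f z \<in> T}"
proof -
  obtain M where M: "\<And>w. w \<in> T \<Longrightarrow> norm w \<le> M" using compact_imp_bounded[OF T] unfolding bounded_iff by blast
  have "closed {z \<in> U. \<not> is_pole f z \<and> f z \<in> T}"
    unfolding closed_sequential_limits
  proof (intro allI impI, elim conjE)
    fix x l assume x: "\<forall>n. x n \<in> {z \<in> U. \<not> is_pole f z \<and> f z \<in> T}" and xl: "x \<longlonglongrightarrow> l"
    have lU: "l \<in> U" using closed_sequentially[OF compact_imp_closed[OF U]] x xl by blast
    have np: "\<not> is_pole f l"
    proof
      assume pl: "is_pole f l"
      then have "filterlim f at_infinity (at l)" by (simp add: is_pole_def)
      then have "\<forall>\<^sub>F z in at l. norm (f z) > M"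
        by (simp add: filterlim_at_infinity_conv_norm_at_top filterlim_at_top_dense)
      moreover have "filterlim x (at l) sequentially"
        using xl x pl by (intro filterlim_atI) (auto intro!: always_eventually)
      ultimately have "\<forall>\<^sub>F n in sequentially. norm (f (x n)) > M"
        by (auto simp: filterlim_iff)
      then obtain n where "norm (f (x n)) > M" unfolding eventually_sequentially by blast
      then show False using M[of "f (x n)"] x by force
    qed
    have "f analytic_on {l}" by (rule nicely_meromorphic_on_imp_analytic_at[OF nm _ np]) simp
    then have "isCont f l" by (rule analytic_at_imp_isCont)
    then have "(\<lambda>n. f (x n)) \<longlonglongrightarrow> f l" using xl by (rule isCont_tendsto_compose)
    then have "f l \<in> T"
      using closed_sequentially[OF compact_imp_closed[OF T], of "\<lambda>n. f (x n)" "f l"] x by auto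
    then show "l \<in> {z \<in> U. \<not> is_pole f z \<and> f z \<in> T}" using lU np by blast
  qed
  then have "compact (U \<inter> {z \<in> U. \<not> is_pole f z \<and> f z \<in> T})" by (rule compact_Int_closed[OF U])
  moreover have "U \<inter> {z \<in> U. \<not> is_pole f z \<and> f z \<in> T} = {z \<in> U. \<not> is_pole f z \<and> f z \<in> T}" by blast
  ultimately show ?thesis by simp
qed

lemma power_powr_commute: "(x ^ n) powr a = (x powr a) ^ n" for x :: real
  by (induction n) (simp_all add: powr_mult)

text \<open>\<open>A m n\<close> consists of the points of \<open>V n\<close> whose next m iterates
  follow the itinerary. These sets are compact, nonempty by surjectivity and decreasing in m, so
  they have a common point.\<close>

lemma orbit_with_itinerary:
  assumes nm: "f nicely_meromorphic_on UNIV"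
    and comp: "\<And>n. compact (V n)" and ne: "\<And>n. V n \<noteq> {}"
    and onto: "\<And>n w. w \<in> V (Suc n) \<Longrightarrow> \<exists>z\<in>V n. \<not> is_pole f z \<and> f z = w"
  obtains z where "\<And>n. (f ^^ n) z \<in> V n" "\<And>n. \<not> is_pole f ((f ^^ n) z)"
proof -
  define A where "A m = rec_nat V (\<lambda>_ S n. {z \<in> V n. \<not> is_pole f z \<and> f z \<in> S (Suc n)}) m" for m
  have A0: "A 0 n = V n" and AS: "A (Suc m) n = {z \<in> V n. \<not> is_pole f z \<and> f z \<in> A m (Suc n)}" for m n
    by (simp_all add: A_def)
  have Ac: "compact (A m n)" for m n
    by (induction m arbitrary: n) (auto simp: A0 AS comp intro!: compact_preimage_avoiding_poles[OF nm])
  have AV: "A m n \<subseteq> V n" for m n by (cases m) (auto simp: A0 AS)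
  have An: "A m n \<noteq> {}" for m n
  proof (induction m arbitrary: n)
    case (Suc m)
    then obtain w where w: "w \<in> A m (Suc n)" by blast
    then obtain z where "z \<in> V n" "\<not> is_pole f z" "f z = w" using onto AV by blast
    then show ?case using w by (auto simp: AS)
  qed (simp add: A0 ne)
  have Ad: "A (Suc m) n \<subseteq> A m n" for m n
  proof (induction m arbitrary: n)
    case (Suc m)
    then show ?case by (auto simp: AS)
  qed (auto simp: A0 AS)
  have "(\<Inter>m. A m 0) \<noteq> {}"
  proof (rule compact_nest)
    show "A n 0 \<subseteq> A m 0" if "m \<le> n" for m n
      using lift_Suc_antimono_le[of "\<lambda>m. A m 0"] Ad that by blast
  qed (auto simp: Ac An)
  then obtain z where z: "\<And>m. z \<in> A m 0" by blast
  have it: "(f ^^ n) z \<in> A m n" for n m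
  proof (induction n arbitrary: m)
    case (Suc n)
    have "(f ^^ n) z \<in> A (Suc m) n" by (rule Suc)
    then show ?case by (simp add: AS)
  qed (simp add: z)
  show thesis
  proof (rule that[of z])
    show "(f ^^ n) z \<in> V n" for n using it[of n 0] by (simp add: A0)
    show "\<not> is_pole f ((f ^^ n) z)" for n using it[of n "Suc 0"] by (simp add: AS)
  qed
qed

context nevanlinna_pair begin

text \<open>The \<open>n\<close>-th digit of the expansion of \<open>x\<close> in the mixed radix \<open>N0, N0 + 1, \<dots>\<close> selects the pole that the
  \<open>n\<close>-th iterate is close to. The radices must tend to infinity for the orbit to escape, but
  slowly enough for one factor \<open>N n\<close> to be negligible against the product of the previous ones.\<close>

lemma hausdorff_content_escaping_pos:
  assumes nm: "f nicely_meromorphic_on UNIV"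
    and s: "0 < s" "s * (1 + \<alpha>) < 1"
  shows "hausdorff_content s (escaping_set f) > 0"
proof -
  obtain J W k1 C R0 where sys: "J > (0::nat)" "C > 0" "R0 > 0"
    "\<And>j. j < J \<Longrightarrow> k1 j > 0 \<and> pole_lattice f \<alpha> (W j) (k1 j) C"
    "\<And>z. norm z > R0 \<Longrightarrow> \<not> is_pole f z \<Longrightarrow> norm (f z) > R0 \<Longrightarrow> \<exists>j<J. \<exists>k\<ge>k1 j. z \<in> W j k"
    by (rule lattice_system) (rule that; assumption)
  define V where "V = W 0"
  define l1 where "l1 = k1 0"
  have C: "C > 0" by fact
  have pl: "l1 > 0" "pole_lattice f \<alpha> V l1 C" using sys(1,4) by (auto simp: V_def l1_def)
  note h = pl(2)[unfolded pole_lattice_def]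
  have h1: "compact (V k)" "\<And>z. z \<in> V k \<Longrightarrow> real k powr \<alpha> \<le> C * norm z" "\<And>z. z \<in> V k \<Longrightarrow> norm z \<le> C * real k powr \<alpha>"
    "\<And>z z'. z \<in> V k \<Longrightarrow> z' \<in> V k \<Longrightarrow> \<not> is_pole f z \<Longrightarrow> \<not> is_pole f z' \<Longrightarrow>
       real k powr (\<alpha> - 1) * norm (1 / f z - 1 / f z') \<le> C * norm (z - z')"
    "\<And>w. norm w \<ge> C \<Longrightarrow> \<exists>z\<in>V k. \<not> is_pole f z \<and> f z = w" if "k \<ge> l1" for k
    using h that by simp_all
  have h2: "\<bar>real k - real k'\<bar> * real N powr (\<alpha> - 1) \<le> C * norm (z - z')"
    if "N \<ge> l1" "N \<le> k" "k \<le> 2 * N" "N \<le> k'" "k' \<le> 2 * N" "k \<noteq> k'" "z \<in> V k" "z' \<in> V k'" for N k k' z z'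
    using h that by simp
  \<comment> \<open>The 8 is 2, for replacing the index by N in the power \<alpha>-1, times 4, for
    |f| \<le> 2 C N^\<alpha> at two points; C^3 is C^2 from these values times C from the
    bi-Lipschitz bound.\<close>
  define c where "c = 1 / (8 * C ^ 3)"
  have c: "c > 0" using C by (simp add: c_def)
  \<comment> \<open>The room below the critical exponent. The factor p^\<eta> will pay for the
    accumulated constants c^n and for one radix.\<close>
  define \<eta> where "\<eta> = 1 - s * (1 + \<alpha>)"
  have \<eta>: "\<eta> > 0" using s by (simp add: \<eta>_def)
  have s1: "s < 1"
  proof -
    have "s * 1 \<le> s * (1 + \<alpha>)" using s \<alpha>_bounds by (intro mult_left_mono) auto
    then show ?thesis using s by linarith
  qed
  \<comment> \<open>The third condition makes every point of the chosen neighbourhoods large enough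
    to be a value of f on each of the others. The last one lets p^\<eta> c^(sn) outgrow 2^n and with
    it the radices.\<close>
  obtain N0 :: nat where N0: "N0 \<ge> l1" "N0 \<ge> 1" "real N0 powr \<alpha> \<ge> C\<^sup>2" "real N0 powr \<eta> * c powr s \<ge> 2"
  proof -
    have "filterlim (\<lambda>n::nat. real n powr \<alpha>) at_top sequentially" "filterlim (\<lambda>n::nat. real n powr \<eta>) at_top sequentially"
      using \<alpha>_bounds \<eta> by real_asymp+
    then have "\<forall>\<^sub>F n in sequentially. real n powr \<alpha> \<ge> C\<^sup>2" "\<forall>\<^sub>F n in sequentially. real n powr \<eta> \<ge> 2 / c powr s"
      by (auto simp: filterlim_at_top)
    then have "\<forall>\<^sub>F n in sequentially. real n powr \<alpha> \<ge> C\<^sup>2 \<and> real n powr \<eta> \<ge> 2 / c powr s \<and> n \<ge> max l1 1"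
      using eventually_ge_at_top[of "max l1 1"] by eventually_elim auto
    then obtain n where n: "real n powr \<alpha> \<ge> C\<^sup>2" "real n powr \<eta> \<ge> 2 / c powr s" "n \<ge> max l1 1"
      unfolding eventually_sequentially by blast
    have "real n powr \<eta> * c powr s \<ge> 2" using n(2) c by (simp add: divide_le_eq)
    then show thesis using that[of n] n by simp
  qed
  define N where "N n = N0 + n" for n :: nat
  define p where "p n = (\<Prod>i\<le>n. N i)" for n
  have N: "N n \<ge> 1" "N n \<ge> N0" "N n \<ge> l1" for n using N0 by (auto simp: N_def)
  have pS: "p (Suc n) = p n * N (Suc n)" for n by (simp add: p_def)
  have p0: "p 0 = N 0" by (simp add: p_def)
  have ppos: "p n > 0" for n using N(1) by (induction n) (auto simp: p0 pS intro: less_le_trans[OF zero_less_one])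
  \<comment> \<open>The first n + 1 digits of x, read as a single integer.\<close>
  define D where "D n x = nat \<lfloor>x * real (p n)\<rfloor>" for n and x :: real
  have Dsub: "real (D n x) \<le> x * real (p n)" "x * real (p n) < real (D n x) + 1" if "x \<ge> 0" for n x
  proof -
    have "x * real (p n) \<ge> 0" using that by simp
    then have "real (D n x) = of_int \<lfloor>x * real (p n)\<rfloor>" by (simp add: D_def)
    then show "real (D n x) \<le> x * real (p n)" "x * real (p n) < real (D n x) + 1" by linarith+
  qed
  have Dunique: "D n x = k" if "x \<ge> 0" "real k \<le> x * real (p n)" "x * real (p n) < real k + 1" for n x k
  proof -
    have "\<lfloor>x * real (p n)\<rfloor> = int k" using that by (intro floor_unique) auto
    then show ?thesis by (simp add: D_def)
  qed
  have Ddiv: "D (Suc n) x div N (Suc n) = D n x" if x: "x \<ge> 0" for n x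
  proof -
    define m where "m = N (Suc n)"
    have m: "m > 0" using N(1)[of "Suc n"] by (simp add: m_def)
    define q where "q = D (Suc n) x div m"
    have "q * m \<le> D (Suc n) x" "D (Suc n) x + 1 \<le> (q + 1) * m"
      unfolding q_def using m by (auto simp: dividend_less_times_div Suc_leI)
         (metis Suc_leI add.commute dividend_less_times_div mult.commute mult_Suc)
    then have q: "real q * real m \<le> real (D (Suc n) x)" "real (D (Suc n) x) + 1 \<le> (real q + 1) * real m"
      by (metis of_nat_le_iff of_nat_mult, metis of_nat_le_iff of_nat_mult of_nat_add of_nat_1)
    have "real (p (Suc n)) = real (p n) * real m" by (simp add: pS m_def)
    then have "real q * real m \<le> (x * real (p n)) * real m" "(x * real (p n)) * real m < (real q + 1) * real m"
      using Dsub[OF x, of "Suc n"] q by (simp_all add: mult.assoc)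
    then have "real q \<le> x * real (p n)" "x * real (p n) < real q + 1" using m by simp_all
    then show ?thesis using Dunique[OF x] by (simp add: q_def m_def)
  qed
  have D0: "D 0 x < N 0" if "0 \<le> x" "x < 1" for x
  proof -
    have "x * real (p 0) < real (N 0)" using that N(1)[of 0] by (simp add: p0)
    then have "real (D 0 x) < real (N 0)" using Dsub(1)[of x 0] that by linarith
    then show ?thesis by simp
  qed
  define d where "d n x = D n x mod N n" for n x
  \<comment> \<open>Adding the radix puts the index between N and 2N, where all powers are
    comparable and the separation bound applies.\<close>
  define \<kappa> where "\<kappa> n x = N n + d n x" for n x
  have dN: "d n x < N n" for n x using N(1)[of n] by (simp add: d_def)
  have \<kappa>: "N n \<le> \<kappa> n x" "\<kappa> n x \<le> 2 * N n" "l1 \<le> \<kappa> n x" for n x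
    using dN[of n x] N(3)[of n] by (auto simp: \<kappa>_def)
  have "\<exists>z. (\<forall>n. (f ^^ n) z \<in> V (\<kappa> n x)) \<and> (\<forall>n. \<not> is_pole f ((f ^^ n) z))" for x
  proof -
    \<comment> \<open>Each chosen neighbourhood is mapped over every other one, so all digit
      sequences occur as itineraries.\<close>
    have onto: "\<exists>z\<in>V (\<kappa> n x). \<not> is_pole f z \<and> f z = w" if "w \<in> V (\<kappa> m x)" for n m w
    proof -
      have "C\<^sup>2 \<le> real (\<kappa> m x) powr \<alpha>"
      proof -
        have "N0 \<le> \<kappa> m x" using \<kappa>(1)[of m x] N(2)[of m] by linarith
        then have "real N0 powr \<alpha> \<le> real (\<kappa> m x) powr \<alpha>" using \<alpha>_bounds by (intro powr_mono2) auto
        then show ?thesis using N0(3) by linarith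
      qed
      also have "\<dots> \<le> C * norm w" by (rule h1(2)[OF \<kappa>(3) that])
      finally have "norm w \<ge> C" using C by (simp add: power2_eq_square)
      then show ?thesis by (rule h1(5)[OF \<kappa>(3)])
    qed
    have ne: "V (\<kappa> n x) \<noteq> {}" for n using h1(5)[OF \<kappa>(3), of "of_real C" n x] C by auto
    show ?thesis
      using orbit_with_itinerary[OF nm, of "\<lambda>n. V (\<kappa> n x)"] h1(1)[OF \<kappa>(3)] ne onto by metis
  qed
  then obtain e where e: "\<And>x n. (f ^^ n) (e x) \<in> V (\<kappa> n x)" "\<And>x n. \<not> is_pole f ((f ^^ n) (e x))" by metis
  have esc: "e x \<in> escaping_set f" for x
  proof -
    have b: "norm ((f ^^ n) (e x)) \<ge> real n powr \<alpha> / C" for n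
    proof -
      have "n \<le> \<kappa> n x" using \<kappa>(1)[of n x] by (simp add: N_def)
      then have "real n powr \<alpha> \<le> real (\<kappa> n x) powr \<alpha>" using \<alpha>_bounds by (intro powr_mono2) auto
      also have "\<dots> \<le> C * norm ((f ^^ n) (e x))" by (rule h1(2)[OF \<kappa>(3) e(1)])
      finally show ?thesis using C by (simp add: divide_le_eq mult.commute)
    qed
    have "filterlim (\<lambda>n::nat. real n powr \<alpha> / C) at_top sequentially"
      using \<alpha>_bounds C by real_asymp
    then have "filterlim (\<lambda>n. norm ((f ^^ n) (e x))) at_top sequentially"
      by (rule filterlim_at_top_mono) (use b in auto)
    then show ?thesis
      using e(2) by (auto simp: escaping_set_def iterates_defined_def filterlim_norm_at_top_imp_at_infinity)
  qed
  \<comment> \<open>The points start in the same neighbourhood, but their images may lie in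
    different ones, of comparable size. This last step before separation is therefore covered
    too.\<close>
  have contract: "norm (u - u') \<ge> c * real (N i) powr (\<alpha> - 1) * real (N (Suc i)) powr (- 2 * \<alpha>) * norm (f u - f u')"
    if u: "u \<in> V (\<kappa> i x)" "u' \<in> V (\<kappa> i x)" "\<not> is_pole f u" "\<not> is_pole f u'"
      and fu: "f u \<in> V (\<kappa> (Suc i) x)" "f u' \<in> V (\<kappa> (Suc i) y)" for i x y u u'
  proof -
    define M where "M = C * (2 * real (N (Suc i)) powr \<alpha>)"
    have fb: "norm (f u) \<le> M" "norm (f u') \<le> M" "norm (f u) > 0" "norm (f u') > 0"
    proof -
      have k: "real (\<kappa> (Suc i) t) powr \<alpha> \<le> 2 * real (N (Suc i)) powr \<alpha>" for t
      proof -
        have "real (\<kappa> (Suc i) t) \<le> 2 * real (N (Suc i))" using \<kappa>(2)[of "Suc i" t] by simp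
        then have "real (\<kappa> (Suc i) t) powr \<alpha> \<le> (2 * real (N (Suc i))) powr \<alpha>" using \<alpha>_bounds by (intro powr_mono2) auto
        also have "\<dots> = 2 powr \<alpha> * real (N (Suc i)) powr \<alpha>" by (rule powr_mult)
        also have "\<dots> \<le> 2 powr 1 * real (N (Suc i)) powr \<alpha>" using \<alpha>_bounds by (intro mult_right_mono powr_mono) auto
        finally show ?thesis by simp
      qed
      show "norm (f u) \<le> M" "norm (f u') \<le> M"
        using h1(3)[OF \<kappa>(3) fu(1)] h1(3)[OF \<kappa>(3) fu(2)] mult_left_mono[OF k, of C] C unfolding M_def by (meson order_trans less_imp_le)+
      have "real (\<kappa> (Suc i) t) powr \<alpha> > 0" for t using \<kappa>(1)[of "Suc i" t] N(1)[of "Suc i"] by simp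
      then show "norm (f u) > 0" "norm (f u') > 0"
        using h1(2)[OF \<kappa>(3) fu(1)] h1(2)[OF \<kappa>(3) fu(2)] by (metis mult_zero_right norm_ge_zero not_le order_le_less)+
    qed
    have Mp: "M > 0" using fb by linarith
    have kk: "real (N i) powr (\<alpha> - 1) / 2 \<le> real (\<kappa> i x) powr (\<alpha> - 1)"
    proof -
      have "2 powr (-1) = (1 / 2 :: real)" by (simp add: powr_minus_divide)
      then have "real (N i) powr (\<alpha> - 1) / 2 = 2 powr (-1) * real (N i) powr (\<alpha> - 1)" by simp
      also have "\<dots> \<le> 2 powr (\<alpha> - 1) * real (N i) powr (\<alpha> - 1)" using \<alpha>_bounds by (intro mult_right_mono powr_mono) auto
      also have "\<dots> = (2 * real (N i)) powr (\<alpha> - 1)" by (rule powr_mult[symmetric])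
      also have "\<dots> \<le> real (\<kappa> i x) powr (\<alpha> - 1)"
        using \<alpha>_bounds \<kappa>(1,2)[of i x] N(1)[of i] by (intro powr_mono2') auto
      finally show ?thesis .
    qed
    have "1 / f u - 1 / f u' = (f u' - f u) / (f u * f u')" using fb(3,4) by (simp add: field_simps)
    then have nn: "norm (1 / f u - 1 / f u') = norm (f u - f u') / (norm (f u) * norm (f u'))"
      by (simp add: norm_divide norm_mult norm_minus_commute)
    have "(real (N i) powr (\<alpha> - 1) / 2) * (norm (f u - f u') / (M * M)) \<le> real (\<kappa> i x) powr (\<alpha> - 1) * norm (1 / f u - 1 / f u')"
      unfolding nn by (intro mult_mono kk divide_left_mono mult_pos_pos fb) (use Mp in auto)
    also have "\<dots> \<le> C * norm (u - u')" by (rule h1(4)[OF \<kappa>(3) u])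
    finally have 1: "(real (N i) powr (\<alpha> - 1) / 2) * (norm (f u - f u') / (M * M)) \<le> C * norm (u - u')" .
    have "1 / (M * M) = real (N (Suc i)) powr (- 2 * \<alpha>) / (4 * C\<^sup>2)"
    proof -
      have "real (N (Suc i)) powr \<alpha> * real (N (Suc i)) powr \<alpha> = real (N (Suc i)) powr (2 * \<alpha>)" by (simp add: powr_add[symmetric])
      then have "M * M = 4 * C\<^sup>2 * real (N (Suc i)) powr (2 * \<alpha>)" by (simp add: M_def power2_eq_square)
      moreover have "real (N (Suc i)) powr (- 2 * \<alpha>) = 1 / real (N (Suc i)) powr (2 * \<alpha>)" by (simp add: powr_minus_divide)
      ultimately show ?thesis by simp
    qed
    then have eq: "(real (N i) powr (\<alpha> - 1) / 2) * (norm (f u - f u') / (M * M)) =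
        real (N i) powr (\<alpha> - 1) / 2 * norm (f u - f u') * (real (N (Suc i)) powr (- 2 * \<alpha>) / (4 * C\<^sup>2))"
      by (metis mult.assoc mult.right_neutral times_divide_eq_right)
    have "real (N i) powr (\<alpha> - 1) / 2 * norm (f u - f u') * (real (N (Suc i)) powr (- 2 * \<alpha>) / (4 * C\<^sup>2)) \<le> norm (u - u') * C"
      using 1 unfolding eq by (simp only: mult.commute[of C])
    then have "real (N i) powr (\<alpha> - 1) / 2 * norm (f u - f u') * (real (N (Suc i)) powr (- 2 * \<alpha>) / (4 * C\<^sup>2)) / C \<le> norm (u - u')"
      using C by (simp only: pos_divide_le_eq)
    then show ?thesis using C by (simp add: c_def power2_eq_square power3_eq_cube mult_ac)
  qed
  \<comment> \<open>Telescoping: as target and then as source, each intermediate radix contributes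
    N^(-(1+\<alpha>)), and these multiply to a power of p. The powers of N 0 and N n correct the two
    ends.\<close>
  have chain: "norm (e x - e y) \<ge> c ^ n * real (N 0) powr (2 * \<alpha>) * real (p n) powr (- (1 + \<alpha>)) * real (N n) powr (1 - \<alpha>) * norm ((f ^^ n) (e x) - (f ^^ n) (e y))"
    if "\<And>i. i < n \<Longrightarrow> \<kappa> i x = \<kappa> i y" for n x y
    using that
  proof (induction n)
    case 0
    have "real (N 0) powr (2 * \<alpha>) * real (p 0) powr (- (1 + \<alpha>)) * real (N 0) powr (1 - \<alpha>) = 1"
      using N(1)[of 0] by (simp add: p0 powr_add[symmetric])
    then show ?case by simp
  next
    case (Suc n)
    define X where "X = norm ((f ^^ n) (e x) - (f ^^ n) (e y))"
    define X' where "X' = norm ((f ^^ Suc n) (e x) - (f ^^ Suc n) (e y))"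
    have IH: "norm (e x - e y) \<ge> c ^ n * real (N 0) powr (2 * \<alpha>) * real (p n) powr (- (1 + \<alpha>)) * real (N n) powr (1 - \<alpha>) * X"
      using Suc unfolding X_def by simp
    have "(f ^^ n) (e y) \<in> V (\<kappa> n x)" using e(1)[of n y] Suc.prems[of n] by simp
    then have X: "X \<ge> c * real (N n) powr (\<alpha> - 1) * real (N (Suc n)) powr (- 2 * \<alpha>) * X'"
      using contract[of "(f ^^ n) (e x)" n x "(f ^^ n) (e y)" y] e(1)[of n x] e(1)[of "Suc n"] e(2)[of n]
      unfolding X_def X'_def by simp
    have "c ^ n * real (N 0) powr (2 * \<alpha>) * real (p n) powr (- (1 + \<alpha>)) * real (N n) powr (1 - \<alpha>) *
        (c * real (N n) powr (\<alpha> - 1) * real (N (Suc n)) powr (- 2 * \<alpha>) * X') \<le>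
        c ^ n * real (N 0) powr (2 * \<alpha>) * real (p n) powr (- (1 + \<alpha>)) * real (N n) powr (1 - \<alpha>) * X"
      using c by (intro mult_left_mono X) auto
    also have "\<dots> \<le> norm (e x - e y)" by (rule IH)
    also have "c ^ n * real (N 0) powr (2 * \<alpha>) * real (p n) powr (- (1 + \<alpha>)) * real (N n) powr (1 - \<alpha>) *
        (c * real (N n) powr (\<alpha> - 1) * real (N (Suc n)) powr (- 2 * \<alpha>) * X') =
        c ^ Suc n * real (N 0) powr (2 * \<alpha>) * real (p n) powr (- (1 + \<alpha>)) * real (N (Suc n)) powr (- 2 * \<alpha>) *
        (real (N n) powr (1 - \<alpha>) * real (N n) powr (\<alpha> - 1)) * X'" by (simp add: mult_ac)
    also have "real (N n) powr (1 - \<alpha>) * real (N n) powr (\<alpha> - 1) = 1" using N(1)[of n] by (simp add: powr_add[symmetric])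
    also have "real (N (Suc n)) powr (- 2 * \<alpha>) = real (N (Suc n)) powr (- (1 + \<alpha>)) * real (N (Suc n)) powr (1 - \<alpha>)"
      by (simp add: powr_add[symmetric])
    also have "c ^ Suc n * real (N 0) powr (2 * \<alpha>) * real (p n) powr (- (1 + \<alpha>)) * (real (N (Suc n)) powr (- (1 + \<alpha>)) * real (N (Suc n)) powr (1 - \<alpha>)) * 1 * X'
      = c ^ Suc n * real (N 0) powr (2 * \<alpha>) * (real (p n) powr (- (1 + \<alpha>)) * real (N (Suc n)) powr (- (1 + \<alpha>))) * real (N (Suc n)) powr (1 - \<alpha>) * X'"
      by simp
    also have "real (p n) powr (- (1 + \<alpha>)) * real (N (Suc n)) powr (- (1 + \<alpha>)) = real (p (Suc n)) powr (- (1 + \<alpha>))"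
      unfolding pS of_nat_mult by (rule powr_mult[symmetric])
    finally show ?case unfolding X'_def .
  qed
  define C' where "C' = 2 * C powr s * real N0"
  have C': "C' > 0" using C N0 by (simp add: C'_def)
  have H: "\<bar>x - y\<bar> \<le> C' * dist (e x) (e y) powr s" if xy: "x \<in> {0..<1}" "y \<in> {0..<1}" for x y
  proof (cases "x = y")
    case True then show ?thesis using C' by simp
  next
    case False
    have x0: "x \<ge> 0" "y \<ge> 0" "x < 1" "y < 1" using xy by auto
    have pge: "real (p n) \<ge> real N0 ^ Suc n" for n
    proof (induction n)
      case (Suc n)
      have "real N0 ^ Suc n * real N0 \<le> real (p n) * real (N (Suc n))"
        using Suc N(2)[of "Suc n"] by (intro mult_mono) auto
      then show ?case by (simp add: pS mult_ac)
    qed (simp add: p0 N_def)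
    have "\<exists>n. D n x \<noteq> D n y"
    proof (rule ccontr)
      assume "\<not> (\<exists>n. D n x \<noteq> D n y)"
      then have eq: "D n x = D n y" for n by simp
      have b: "\<bar>x - y\<bar> * real (p n) < 1" for n
        using Dsub[OF x0(1), of n] Dsub[OF x0(2), of n] eq[of n] by (auto simp: abs_if algebra_simps)
      have big: "real (p n) \<ge> real n" for n
      proof (induction n)
        case (Suc n)
        have "real (Suc n) \<le> 1 * real (N (Suc n))" using N0 by (simp add: N_def)
        also have "\<dots> \<le> real (p n) * real (N (Suc n))" using ppos[of n] by (intro mult_right_mono) auto
        finally show ?case by (simp add: pS)
      qed simp
      obtain n where "real n * \<bar>x - y\<bar> > 1" using False reals_Archimedean3[of "\<bar>x - y\<bar>"] by auto
      moreover have "real n * \<bar>x - y\<bar> \<le> real (p n) * \<bar>x - y\<bar>" by (intro mult_right_mono big) auto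
      ultimately show False using b[of n] by (simp add: mult.commute)
    qed
    \<comment> \<open>Before time n the two itineraries agree, so the chain of contractions applies;
      at time n the orbits are near different poles.\<close>
    define n where "n = (LEAST n. D n x \<noteq> D n y)"
    have Dn: "D n x \<noteq> D n y" unfolding n_def by (rule LeastI_ex) fact
    have Dl: "D i x = D i y" if "i < n" for i using not_less_Least[OF that[unfolded n_def]] by simp
    have \<kappa>eq: "\<kappa> i x = \<kappa> i y" if "i < n" for i using Dl[OF that] by (simp add: \<kappa>_def d_def)
    have Ddiff: "real (D n x) - real (D n y) = real (d n x) - real (d n y)"
    proof (cases n)
      case 0
      then show ?thesis using D0[OF x0(1,3)] D0[OF x0(2,4)] by (simp add: d_def)
    next
      case (Suc m)
      have "D n x div N n = D n y div N n" using Ddiv x0 Dl[of m] Suc by simp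
      then have "real (D n x div N n) * real (N n) = real (D n y div N n) * real (N n)" by simp
      moreover have dm: "real (D n t) = real (D n t div N n) * real (N n) + real (d n t)" for t
        unfolding d_def by (metis div_mult_mod_eq of_nat_add of_nat_mult)
      ultimately show ?thesis using dm[of x] dm[of y] by linarith
    qed
    define \<delta> where "\<delta> = \<bar>real (d n x) - real (d n y)\<bar>"
    have \<delta>: "\<delta> \<ge> 1" "\<delta> \<le> real (N n)"
    proof -
      have "d n x \<noteq> d n y" using Dn Ddiff by auto
      then show "\<delta> \<ge> 1" by (auto simp: \<delta>_def abs_if)
      show "\<delta> \<le> real (N n)" using dN[of n x] dN[of n y] by (auto simp: \<delta>_def abs_if)
    qed
    \<comment> \<open>The integer parts differ by \<delta> \<ge> 1, so the error of less than 1 from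
      the fractional parts only doubles the bound.\<close>
    have "\<bar>x - y\<bar> * real (p n) \<le> \<delta> + 1"
      using Dsub[OF x0(1), of n] Dsub[OF x0(2), of n] Ddiff unfolding \<delta>_def by (auto simp: abs_if algebra_simps)
    then have "\<bar>x - y\<bar> * real (p n) \<le> 2 * \<delta>" using \<delta> by linarith
    then have xyb: "\<bar>x - y\<bar> \<le> 2 * \<delta> / real (p n)" using ppos[of n] by (simp add: le_divide_eq)
    have "\<kappa> n x \<noteq> \<kappa> n y" using Dn Ddiff by (auto simp: \<kappa>_def)
    then have "\<bar>real (\<kappa> n x) - real (\<kappa> n y)\<bar> * real (N n) powr (\<alpha> - 1) \<le> C * norm ((f ^^ n) (e x) - (f ^^ n) (e y))"
      by (intro h2[OF N(3) \<kappa>(1,2) \<kappa>(1,2)] e(1))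
    then have sep: "\<delta> * real (N n) powr (\<alpha> - 1) / C \<le> norm ((f ^^ n) (e x) - (f ^^ n) (e y))"
      using C by (simp add: \<delta>_def \<kappa>_def divide_le_eq mult.commute)
    \<comment> \<open>The separation \<delta> N n^(\<alpha>-1) / C at time n, carried back to time
      0: the power of N n cancels, and N 0^(2\<alpha>) \<ge> 1 is dropped.\<close>
    define Q where "Q = c ^ n * real (p n) powr (- (1 + \<alpha>)) * (\<delta> / C)"
    have "Q \<le> dist (e x) (e y)"
    proof -
      have "1 \<le> real (N 0) powr (2 * \<alpha>)" using N(1)[of 0] \<alpha>_bounds by (intro ge_one_powr_ge_zero) auto
      then have "c ^ n * 1 * real (p n) powr (- (1 + \<alpha>)) * (\<delta> / C) \<le> c ^ n * real (N 0) powr (2 * \<alpha>) * real (p n) powr (- (1 + \<alpha>)) * (\<delta> / C)"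
        using c C \<delta> by (intro mult_right_mono mult_left_mono) auto
      also have "\<dots> = c ^ n * real (N 0) powr (2 * \<alpha>) * real (p n) powr (- (1 + \<alpha>)) * real (N n) powr (1 - \<alpha>) * (\<delta> * real (N n) powr (\<alpha> - 1) / C)"
      proof -
        have "real (N n) powr (1 - \<alpha>) * real (N n) powr (\<alpha> - 1) = 1" using N(1)[of n] by (simp add: powr_add[symmetric])
        moreover have "c ^ n * real (N 0) powr (2 * \<alpha>) * real (p n) powr (- (1 + \<alpha>)) * real (N n) powr (1 - \<alpha>) * (\<delta> * real (N n) powr (\<alpha> - 1) / C)
           = c ^ n * real (N 0) powr (2 * \<alpha>) * real (p n) powr (- (1 + \<alpha>)) * (\<delta> / C) * (real (N n) powr (1 - \<alpha>) * real (N n) powr (\<alpha> - 1))"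
          by simp
        ultimately show ?thesis by (simp only: mult_1_right)
      qed
      also have "\<dots> \<le> c ^ n * real (N 0) powr (2 * \<alpha>) * real (p n) powr (- (1 + \<alpha>)) * real (N n) powr (1 - \<alpha>) * norm ((f ^^ n) (e x) - (f ^^ n) (e y))"
        using c by (intro mult_left_mono sep) auto
      also have "\<dots> \<le> norm (e x - e y)" by (rule chain[OF \<kappa>eq])
      finally show ?thesis by (simp add: Q_def dist_norm)
    qed
    then have Qs: "Q powr s \<le> dist (e x) (e y) powr s"
      using s c C \<delta> by (intro powr_mono2) (auto simp: Q_def)
    have "2 * \<delta> / real (p n) \<le> C' * Q powr s"
    proof -
      have Qe: "Q powr s = (c powr s) ^ n * real (p n) powr (- (s * (1 + \<alpha>))) * (\<delta> powr s / C powr s)"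
      proof -
        have "(c ^ n) powr s = (c powr s) ^ n" by (rule power_powr_commute)
        moreover have "(real (p n) powr (- (1 + \<alpha>))) powr s = real (p n) powr (- (s * (1 + \<alpha>)))"
        proof -
          have "- (1 + \<alpha>) * s = - (s * (1 + \<alpha>))" by (simp add: algebra_simps)
          then show ?thesis by (simp only: powr_powr)
        qed
        moreover have "(\<delta> / C) powr s = \<delta> powr s / C powr s" using \<delta> C by (simp add: powr_divide)
        ultimately show ?thesis unfolding Q_def by (simp only: powr_mult)
      qed
      \<comment> \<open>Here the slow growth of the radices pays off: N n \<le> N0 2^n, while 2^n is
        at most (N0^\<eta> c^s)^n by the choice of N0, and N0^n \<le> p n.\<close>
      have "real (N n) \<le> real N0 * (real (p n) powr \<eta> * (c powr s) ^ n)"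
      proof -
        have "real (N n) \<le> real N0 * 2 ^ n"
        proof (induction n)
          case (Suc n)
          have "real (N (Suc n)) = real (N n) + 1" by (simp add: N_def)
          also have "\<dots> \<le> real N0 * 2 ^ n + real N0 * 2 ^ n"
          proof (intro add_mono Suc)
            have "1 * 1 \<le> real N0 * 2 ^ n" using N0 by (intro mult_mono) auto
            then show "1 \<le> real N0 * 2 ^ n" by simp
          qed
          finally show ?case by simp
        qed (simp add: N_def)
        also have "(2::real) ^ n \<le> (real N0 powr \<eta> * c powr s) ^ n" using N0(4) by (intro power_mono) auto
        also have "\<dots> = (real N0 powr \<eta>) ^ n * (c powr s) ^ n" by (rule power_mult_distrib)
        also have "(real N0 powr \<eta>) ^ n \<le> real (p n) powr \<eta>"
        proof -
          have "(real N0 powr \<eta>) ^ n = (real N0 ^ n) powr \<eta>" by (rule power_powr_commute[symmetric])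
          also have "\<dots> \<le> real (p n) powr \<eta>"
          proof (intro powr_mono2)
            have "real N0 ^ n \<le> real N0 ^ Suc n" using N0 by (intro power_increasing) auto
            then show "real N0 ^ n \<le> real (p n)" using pge[of n] by linarith
          qed (use \<eta> in auto)
          finally show ?thesis .
        qed
        finally show ?thesis using N0 by (simp add: mult_left_mono mult_right_mono)
      qed
      \<comment> \<open>The distance bound supplies only \<delta>^s, whereas |x - y| is of order
        \<delta> / p n; the missing factor \<delta>^(1-s) is at most one radix.\<close>
      then have m: "\<delta> powr (1 - s) \<le> real N0 * (real (p n) powr \<eta> * (c powr s) ^ n)"
      proof -
        have "\<delta> powr (1 - s) \<le> \<delta> powr 1" using \<delta> s s1 by (intro powr_mono) auto
        also have "\<dots> \<le> real (N n)" using \<delta> by simp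
        finally show ?thesis using \<open>real (N n) \<le> real N0 * (real (p n) powr \<eta> * (c powr s) ^ n)\<close> by linarith
      qed
      have "2 * \<delta> / real (p n) = 2 * (\<delta> powr (1 - s) * \<delta> powr s) / real (p n)"
        using \<delta> by (simp add: powr_add[symmetric])
      also have "\<dots> = 2 * \<delta> powr s / real (p n) * \<delta> powr (1 - s)" by simp
      also have "\<dots> \<le> 2 * \<delta> powr s / real (p n) * (real N0 * (real (p n) powr \<eta> * (c powr s) ^ n))"
        using m ppos[of n] by (intro mult_left_mono) auto
      also have "\<dots> = 2 * \<delta> powr s * real N0 * (c powr s) ^ n * (real (p n) powr \<eta> / real (p n))" by simp
      also have "real (p n) powr \<eta> / real (p n) = real (p n) powr (- (s * (1 + \<alpha>)))"
      proof -
        have "real (p n) powr (\<eta> - 1) = real (p n) powr \<eta> / real (p n)" using ppos[of n] by (simp add: powr_diff)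
        then show ?thesis by (simp add: \<eta>_def)
      qed
      also have "2 * \<delta> powr s * real N0 * (c powr s) ^ n * real (p n) powr (- (s * (1 + \<alpha>))) = C' * Q powr s"
        unfolding Qe C'_def using C by simp
      finally show ?thesis .
    qed
    also have "\<dots> \<le> C' * dist (e x) (e y) powr s" using Qs C' by (intro mult_left_mono) auto
    finally show ?thesis using xyb by linarith
  qed
  show ?thesis by (rule hausdorff_content_Hoelder_pos[OF s(1) C' esc H])
qed

section \<open>Comparison of the two dimensions\<close>

lemma hausdorff_dim_escaping_ge:
  assumes nm: "f nicely_meromorphic_on UNIV"
  shows "hausdorff_dim (escaping_set f) \<ge> ennreal (1 / (1 + \<alpha>))"
proof (rule dense_le)
  fix b assume b: "b < ennreal (1 / (1 + \<alpha>))"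
  then obtain t where t: "b = ennreal t" "t \<ge> 0" by (cases b) auto
  then have "t < 1 / (1 + \<alpha>)" using b by (simp add: ennreal_less_iff)
  then obtain s where s: "t < s" "s < 1 / (1 + \<alpha>)" using dense by blast
  have "s * (1 + \<alpha>) < 1" using s \<alpha>_bounds by (simp add: less_divide_eq)
  then have "hausdorff_dim (escaping_set f) \<ge> ennreal s"
    using hausdorff_content_escaping_pos[OF nm, of s] s t by (intro hausdorff_dim_ge) auto
  moreover have "b \<le> ennreal s" using t s by (simp add: ennreal_leI)
  ultimately show "b \<le> hausdorff_dim (escaping_set f)" by simp
qed

lemma hausdorff_dim_escaping_le: "hausdorff_dim (escaping_set f) \<le> hausdorff_dim (stay_outside_set R f)"
  using hausdorff_content_escaping_eq_0 by (intro hausdorff_dim_mono_null) auto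

text \<open>The escaping set has at most the dimension of each J_R. Its lower bound therefore serves
  every J_R, and the upper bound for J_R with R large serves the escaping set.\<close>

lemma tendsto_hausdorff_dim_stay_outside:
  assumes nm: "f nicely_meromorphic_on UNIV"
  shows "((\<lambda>R. hausdorff_dim (stay_outside_set R f)) \<longlongrightarrow> ennreal (1 / (1 + \<alpha>))) at_top"
    and "hausdorff_dim (escaping_set f) = ennreal (1 / (1 + \<alpha>))"
proof -
  have up: "\<forall>\<^sub>F R in at_top. hausdorff_dim (stay_outside_set R f) < b" if b: "ennreal (1 / (1 + \<alpha>)) < b" for b
  proof -
    obtain b' where b': "ennreal (1 / (1 + \<alpha>)) < b'" "b' < b" using dense[OF b] by blast
    then obtain s where s: "b' = ennreal s" "s \<ge> 0" by (cases b') auto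
    have s1: "1 / (1 + \<alpha>) < s" using b'(1) s \<alpha>_bounds by (simp add: ennreal_less_iff)
    moreover have "1 / (1 + \<alpha>) > 0" using \<alpha>_bounds by simp
    ultimately have s0: "s > 0" by linarith
    have "s * (1 + \<alpha>) > 1" using s1 \<alpha>_bounds by (simp add: divide_less_eq)
    then obtain R1 where R1: "\<And>R. R \<ge> R1 \<Longrightarrow> hausdorff_content s (stay_outside_set R f) = 0"
      using hausdorff_content_stay_outside_eq_0[OF s0] by blast
    show ?thesis
      using eventually_ge_at_top[of R1]
    proof eventually_elim
      case (elim R)
      have "hausdorff_dim (stay_outside_set R f) \<le> ennreal s" by (rule hausdorff_dim_le[OF s0 R1[OF elim]])
      then show ?case using b'(2) s by simp
    qed
  qed
  show "((\<lambda>R. hausdorff_dim (stay_outside_set R f)) \<longlongrightarrow> ennreal (1 / (1 + \<alpha>))) at_top"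
  proof (rule order_tendstoI)
    fix b assume "b < ennreal (1 / (1 + \<alpha>))"
    then show "\<forall>\<^sub>F R in at_top. b < hausdorff_dim (stay_outside_set R f)"
      using hausdorff_dim_escaping_ge[OF nm] hausdorff_dim_escaping_le by (intro always_eventually allI) (meson order_less_le_trans order_trans)
  qed (rule up)
  show "hausdorff_dim (escaping_set f) = ennreal (1 / (1 + \<alpha>))"
  proof (rule antisym[OF _ hausdorff_dim_escaping_ge[OF nm]], rule dense_ge)
    fix b assume "ennreal (1 / (1 + \<alpha>)) < b"
    then obtain R where "hausdorff_dim (stay_outside_set R f) < b"
      using up eventually_happens'[OF trivial_limit_at_top_linorder] by blast
    then show "hausdorff_dim (escaping_set f) \<le> b" using hausdorff_dim_escaping_le[of R] by simp
  qed
qed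

end

theorem theorem1:
  fixes f :: "complex \<Rightarrow> complex" and S :: "complex poly" and m :: nat
  assumes "transcendental_meromorphic f"
    and "\<forall>\<^sub>\<approx>z. schwarzian f z = poly S z"
    and "degree S = m"
    and "\<not> asymptotic_value f None"
  shows "((\<lambda>R. hausdorff_dim (stay_outside_set R f)) \<longlongrightarrow>
            ennreal ((real m + 2) / (real m + 4))) at_top \<and>
         hausdorff_dim (escaping_set f) = ennreal ((real m + 2) / (real m + 4))"
proof -
  have nm: "f nicely_meromorphic_on UNIV" using assms(1) by (simp add: transcendental_meromorphic_def)
  obtain w1 w2 where w: "w1 holomorphic_on UNIV" "w2 holomorphic_on UNIV"
    "\<And>z. deriv (deriv w1) z = - (poly S z / 2) * w1 z"
    "\<And>z. deriv (deriv w2) z = - (poly S z / 2) * w2 z"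
    "\<And>z. is_pole f z \<longleftrightarrow> w2 z = 0" "\<And>z. w2 z \<noteq> 0 \<Longrightarrow> f z = w1 z / w2 z"
    "\<And>z. deriv w1 z * w2 z - w1 z * deriv w2 z = 1"
    by (rule nevanlinna_quotient_of_solutions[OF assms(1,2)]) (rule that; assumption)
  \<comment> \<open>The factor 1/2 turns S into the potential of the linear equation and leaves the
    degree unchanged, so \<alpha> is 2/(m+2).\<close>
  interpret nevanlinna_pair f w1 w2 "smult (1 / 2) S"
    by standard (use w assms(4) transcendental_schwarzian_nonzero[OF assms(1,2)] in auto)
  have "1 / (1 + \<alpha>) = (real m + 2) / (real m + 4)"
    using assms(3) by (simp add: \<alpha>_def field_simps)
  then show ?thesis using tendsto_hausdorff_dim_stay_outside[OF nm] by simp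
qed

end
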